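(* Let $(\Omega,\mathcal{F},P,\{\mathcal{F}_t\}_{t\ge 0})$ be a filtered complete probability space carrying a standard $\mathcal{F}_t$-adapted $m$-dimensional Brownian motion $W(t)$ with $W(0)=0$, and let $T>0$. Let $r(t)>0$, $\mu_i(t)$, $\sigma_{ij}(t)$ ($i,j=1,\dots,m$) be deterministic functions of $t\ge 0$, set $\sigma(t):=(\sigma_{ij}(t))_{m\times m}$, $B(t):=(\mu_1(t)-r(t),\dots,\mu_m(t)-r(t))$ (a row vector) and $\theta(t):=B(t)(\sigma(t)')^{-1}$. Assume (A1) there is $\delta>0$ with $\sigma(t)\sigma(t)'\ge \delta I$ for all $t\in[0,T]$, and (A2) $0<\int_0^T|\theta(t)|^2dt<+\infty$. Let $x_0>0$ and $z> x_0e^{\int_0^T r(t)dt}$, and set $$\gamma:=\frac{z-x_0e^{\int_0^T[r(t)-|\theta(t)|^2]dt}}{1-e^{-\int_0^T|\theta(t)|^2dt}}.$$ Let $x^z(\cdot)$ be the solution of $$dx(t)=[r(t)x(t)+B(t)\pi(t)]dt+\pi(t)'\sigma(t)\,dW(t),\quad 0\le t\le T,\qquad x(0)=x_0,$$ under the feedback portfolio $\pi^z(t)=-[\sigma(t)\sigma(t)']^{-1}B(t)'\big[x^z(t)-\gamma e^{-\int_t^T r(s)ds}\big]$, and let $\tau^z:=\inf\{0\le t\le T:\ x^z(t)=z e^{-\int_t^T r(s)ds}\}$ (with $\inf\emptyset=+\infty$). Then $$P(\tau^z\le T)=\frac12\,\mathrm{Erfc}\Big(-\frac{\sqrt{\i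nt_0^T|\theta(s)|^2ds}}{2\sqrt2}\Big)+\frac12\,e^{3\int_0^T|\theta(s)|^2ds}\,\mathrm{Erfc}\Big(\frac{5\sqrt{\int_0^T|\theta(s)|^2ds}}{2\sqrt2}\Big).$$
   Context: $M'$ denotes transpose. $\mathrm{Erfc}(x):=\frac{2}{\sqrt\pi}\int_x^\infty e^{-v^2}dv$ for $x\in\mathbb{R}$ (complementary error function). The portfolio $\pi^z$ is the mean-variance efficient portfolio for target expected terminal wealth $z$ in the market with bank account $dS_0=r(t)S_0dt$ and stocks $dS_i=S_i[\mu_i(t)dt+\sum_j\sigma_{ij}(t)dW^j(t)]$; $\pi_i(t)$ is the amount of wealth held in stock $i$. *)

theory Defs
  imports "HOL-Probability.Probability"
begin

definition erfc :: "real \<Rightarrow> real" where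
  "erfc x = 2 / sqrt pi * integral {x..} (\<lambda>v. exp (- (v ^ 2)))"

definition filtration_on :: "'a measure \<Rightarrow> (real \<Rightarrow> 'a measure) \<Rightarrow> bool" where
  "filtration_on M F \<longleftrightarrow>
     (\<forall>t. space (F t) = space M \<and> sets (F t) \<subseteq> sets M) \<and>
     (\<forall>s t. s \<le> t \<longrightarrow> sets (F s) \<subseteq> sets (F t))"

definition std_BM :: "'a measure \<Rightarrow> (real \<Rightarrow> 'a measure) \<Rightarrow> (real \<Rightarrow> 'a \<Rightarrow> real^'m) \<Rightarrow> bool" where
  "std_BM M F W \<longleftrightarrow>
     (\<forall>t\<ge>0. W t \<in> borel_measurable (F t)) \<and>
     (\<forall>\<omega>\<in>space M. W 0 \<omega> = 0 \<and> continuous_on {0..} (\<lambda>t. W t \<omega>)) \<and>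
     (\<forall>s t. 0 \<le> s \<longrightarrow> s < t \<longrightarrow>
        (\<forall>A\<in>sets (F s). \<forall>C\<in>sets (borel :: (real^'m) measure).
           measure M (A \<inter> {\<omega>\<in>space M. W t \<omega> - W s \<omega> \<in> C})
             = measure M A * measure M {\<omega>\<in>space M. W t \<omega> - W s \<omega> \<in> C}) \<and>
        prob_space.indep_vars M (\<lambda>_. borel) (\<lambda>i \<omega>. (W t \<omega> - W s \<omega>) $ i) UNIV \<and>
        (\<forall>i. distributed M lborel (\<lambda>\<omega>. (W t \<omega> - W s \<omega>) $ i)
                (\<lambda>y. ennreal (normal_density 0 (sqrt (t - s)) y))))"

definition conv_in_prob :: "'a measure \<Rightarrow> (nat \<Rightarrow> 'a \<Rightarrow> real) \<Rightarrow> ('a \<Rightarrow> real) \<Rightarrow> bool" where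
  "conv_in_prob M X Y \<longleftrightarrow>
     (\<forall>n. X n \<in> borel_measurable M) \<and> Y \<in> borel_measurable M \<and>
     (\<forall>\<epsilon>>0. (\<lambda>n. measure M {\<omega>\<in>space M. \<epsilon> < \<bar>X n \<omega> - Y \<omega>\<bar>}) \<longlonglongrightarrow> 0)"

definition simple_adapted ::
  "'a measure \<Rightarrow> (real \<Rightarrow> 'a measure) \<Rightarrow> real \<Rightarrow> real list \<Rightarrow> (nat \<Rightarrow> 'a \<Rightarrow> real^'m) \<Rightarrow> bool" where
  "simple_adapted M F T ts \<xi> \<longleftrightarrow>
     2 \<le> length ts \<and> hd ts = 0 \<and> last ts = T \<and> sorted_wrt (<) ts \<and>
     (\<forall>j < length ts - 1. \<xi> j \<in> borel_measurable (F (ts ! j)))"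

definition step_proc :: "real list \<Rightarrow> (nat \<Rightarrow> 'a \<Rightarrow> real^'m) \<Rightarrow> real \<Rightarrow> 'a \<Rightarrow> real^'m" where
  "step_proc ts \<xi> t \<omega> =
     (\<Sum>j < length ts - 1. indicator {ts ! j ..< ts ! (j + 1)} t *\<^sub>R \<xi> j \<omega>)"

definition step_int ::
  "real list \<Rightarrow> (nat \<Rightarrow> 'a \<Rightarrow> real^'m) \<Rightarrow> (real \<Rightarrow> 'a \<Rightarrow> real^'m) \<Rightarrow> real \<Rightarrow> 'a \<Rightarrow> real" where
  "step_int ts \<xi> W t \<omega> =
     (\<Sum>j < length ts - 1. \<xi> j \<omega> \<bullet> (W (min (ts ! (j + 1)) t) \<omega> - W (min (ts ! j) t) \<omega>))"

definition ito_integrand ::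
  "'a measure \<Rightarrow> (real \<Rightarrow> 'a measure) \<Rightarrow> real \<Rightarrow> (real \<Rightarrow> 'a \<Rightarrow> real^'m) \<Rightarrow> bool" where
  "ito_integrand M F T \<phi> \<longleftrightarrow>
     (\<forall>t\<in>{0..T}. \<phi> t \<in> borel_measurable (F t)) \<and>
     (\<lambda>(t, \<omega>). \<phi> t \<omega>) \<in> borel_measurable (restrict_space lborel {0..T} \<Otimes>\<^sub>M M) \<and>
     (AE \<omega> in M. (\<lambda>t. norm (\<phi> t \<omega>) ^ 2) integrable_on {0..T})"

definition ito_integral ::
  "'a measure \<Rightarrow> (real \<Rightarrow> 'a measure) \<Rightarrow> (real \<Rightarrow> 'a \<Rightarrow> real^'m) \<Rightarrow> real \<Rightarrow>
   (real \<Rightarrow> 'a \<Rightarrow> real^'m) \<Rightarrow> (real \<Rightarrow> 'a \<Rightarrow> real) \<Rightarrow> bool" where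
  "ito_integral M F W T \<phi> I \<longleftrightarrow>
     ito_integrand M F T \<phi> \<and>
     (\<exists>ts \<xi>. (\<forall>n. simple_adapted M F T (ts n) (\<xi> n)) \<and>
        conv_in_prob M
          (\<lambda>n \<omega>. integral {0..T} (\<lambda>t. norm (step_proc (ts n) (\<xi> n) t \<omega> - \<phi> t \<omega>) ^ 2))
          (\<lambda>\<omega>. 0) \<and>
        (\<forall>t\<in>{0..T}. conv_in_prob M (\<lambda>n. step_int (ts n) (\<xi> n) W t) (I t)))"

text \<open>x is a (continuous, adapted) solution on [0,T] of
  dx = [r x + B pi] dt + pi' sigma dW,  x(0) = x0,
  where the portfolio pi may depend on x (feedback). Note pi' sigma dW = (sigma' pi) \<bullet> dW.\<close>
definition wealth_solution ::
  "'a measure \<Rightarrow> (real \<Rightarrow> 'a measure) \<Rightarrow> (real \<Rightarrow> 'a \<Rightarrow> real^'m) \<Rightarrow> real \<Rightarrow>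
   (real \<Rightarrow> real) \<Rightarrow> (real \<Rightarrow> real^'m) \<Rightarrow> (real \<Rightarrow> real^'m^'m) \<Rightarrow> real \<Rightarrow>
   (real \<Rightarrow> 'a \<Rightarrow> real^'m) \<Rightarrow> (real \<Rightarrow> 'a \<Rightarrow> real) \<Rightarrow> bool" where
  "wealth_solution M F W T r B \<sigma> x0 \<pi> x \<longleftrightarrow>
     (\<forall>t\<in>{0..T}. x t \<in> borel_measurable (F t)) \<and>
     (\<forall>\<omega>\<in>space M. continuous_on {0..T} (\<lambda>t. x t \<omega>)) \<and>
     (\<exists>I. ito_integral M F W T (\<lambda>t \<omega>. transpose (\<sigma> t) *v \<pi> t \<omega>) I \<and>
        (\<forall>t\<in>{0..T}. AE \<omega> in M.
           (\<lambda>s. r s * x s \<omega> + B s \<bullet> \<pi> s \<omega>) integrable_on {0..t} \<and>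
           x t \<omega> = x0 + integral {0..t} (\<lambda>s. r s * x s \<omega> + B s \<bullet> \<pi> s \<omega>) + I t \<omega>))"

end

theory Submission
  imports Defs
begin

text \<open>
  Write \<open>\<rho>(t) = exp (- \<integral>\<^sub>t\<^sup>T r)\<close>. Under the feedback portfolio, \<open>y = x - \<gamma> \<rho>\<close> solves the linear equation
  \<open>dy = (r - |\<theta>|\<^sup>2) y dt - y \<theta> dW\<close>, so that the discounted and normalised process \<open>V\<close> is \<open>exp (- X)\<close>, where \<open>X\<close> is a
  Brownian motion with drift \<open>3 / 2\<close> run at the clock \<open>\<integral>\<^sub>0\<^sup>t |\<theta>|\<^sup>2\<close>; the wealth reaches its target when \<open>X\<close> reaches
  \<open>\<Theta> = \<integral>\<^sub>0\<^sup>T |\<theta>|\<^sup>2\<close>. Ito's formula is avoided: comparing an Euler scheme of the equation in mean square with the explicit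
  solution for piecewise constant \<open>\<theta>\<close> shows that the conditional law of \<open>y(T)\<close> given the past is lognormal. By the method
  of images there is a payoff in \<open>X(T)\<close> whose conditional expectation is \<open>1\<close> on the target level, hence its expectation
  is the hitting probability. This is optional stopping, carried out on finer and finer finite grids.
\<close>

section \<open>Gaussian laws and Brownian increments\<close>

text \<open>The Ito integral is given only as a limit in probability of step integrals at each fixed
  time, and \<open>y\<close> carries no moment bound. Mean-square estimates are therefore run on
  truncated errors, and the truncation is undone on events of probability close to 1. The Euler
  comparison process is a product of lognormal factors; those after a grid time are independent of
  the past. This gives the conditional law that optional stopping requires, and not only the law at
  \<open>T\<close>.

  The drift \<open>3 / 2\<close> is \<open>1 + 1 / 2\<close>: the term \<open>- |\<theta>|^2\<close>
  in the drift of \<open>y\<close> contributes 1, the stochastic exponential contributes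
  \<open>1 / 2\<close>. For drift \<open>b\<close>, reflecting the endpoint \<open>X\<close> at the
  level \<open>c\<close> changes its density by the factor \<open>exp (2 * b * (c - X))\<close>.
  Here this is \<open>exp (3 * (c - X))\<close>, the origin of the cube in the payoff and of
  \<open>exp (3 * \<Theta>)\<close> in the result.

  A path can touch the level between grid times, and at a grid time it has usually overshot. So the
  upper and the lower bound use levels slightly different from \<open>c\<close>; they meet because
  the closed formula is continuous in the level.\<close>

lemma integral_std_normal_distribution:
  fixes f :: "real \<Rightarrow> 'b :: {banach, second_countable_topology}"
  assumes [measurable]: "f \<in> borel_measurable borel"
  shows "integral\<^sup>L std_normal_distribution f = (\<integral>z. std_normal_density z *\<^sub>R f z \<partial>lborel)"
  by (rule integral_density) auto

lemma prob_space_std_normal_distribution: "prob_space std_normal_distribution"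
  using real_dist_normal_dist by (simp add: real_distribution_def)

text \<open>Tilting the standard normal density by \<open>exp (c * z)\<close> moves its mean to
  \<open>c\<close> and multiplies its mass by \<open>exp (c\<^sup>2 / 2)\<close>, by completing the
  square; both integrals are moments of the shifted density.\<close>

lemma has_bochner_integral_exp_std_normal:
  fixes c :: real
  shows "has_bochner_integral std_normal_distribution (\<lambda>z. exp (c * z)) (exp (c\<^sup>2 / 2))"
    and "has_bochner_integral std_normal_distribution (\<lambda>z. z * exp (c * z)) (c * exp (c\<^sup>2 / 2))"
proof -
  have eq: "std_normal_density z * exp (c * z) = exp (c\<^sup>2 / 2) * normal_density c 1 z" for z
    by (simp add: normal_density_def exp_add[symmetric] power2_eq_square field_simps)
  have "has_bochner_integral lborel (\<lambda>z. exp (c\<^sup>2 / 2) * normal_density c 1 z) (exp (c\<^sup>2 / 2) * 1)"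
    by (intro has_bochner_integral_mult_right) (auto simp: has_bochner_integral_iff)
  then show "has_bochner_integral std_normal_distribution (\<lambda>z. exp (c * z)) (exp (c\<^sup>2 / 2))"
    by (intro has_bochner_integral_density) (auto simp: eq)
  have "has_bochner_integral lborel (\<lambda>z. exp (c\<^sup>2 / 2) * (normal_density c 1 z * z)) (exp (c\<^sup>2 / 2) * c)"
    by (intro has_bochner_integral_mult_right normal_moment_nz_1) simp
  moreover have "exp (c\<^sup>2 / 2) * (normal_density c 1 z * z) = std_normal_density z *\<^sub>R (z * exp (c * z))" for z
    using eq[of z] by (metis mult.assoc mult.left_commute mult.commute real_scaleR_def)
  ultimately have "has_bochner_integral lborel (\<lambda>z. std_normal_density z *\<^sub>R (z * exp (c * z))) (c * exp (c\<^sup>2 / 2))"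
    by (simp only: mult.commute)
  then show "has_bochner_integral std_normal_distribution (\<lambda>z. z * exp (c * z)) (c * exp (c\<^sup>2 / 2))"
    by (intro has_bochner_integral_density) auto
qed

lemma has_bochner_integral_std_normal_moments:
  shows "has_bochner_integral std_normal_distribution (\<lambda>z. z) 0"
    and "has_bochner_integral std_normal_distribution (\<lambda>z. z\<^sup>2) 1"
proof -
  show "has_bochner_integral std_normal_distribution (\<lambda>z. z) 0"
    using integrable_std_normal_distribution_moment[of 1] integral_std_normal_distribution_moment_odd[of 1]
    by (simp add: has_bochner_integral_iff)
  show "has_bochner_integral std_normal_distribution (\<lambda>z. z\<^sup>2) 1"
    using std_normal_distribution_even_moments[of 1]
    by (simp add: has_bochner_integral_iff)
qed

text \<open>Defined as an image measure, not by a density, since \<open>v = 0\<close> occurs.\<close>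

definition gauss :: "real \<Rightarrow> real measure" where
  "gauss v = distr std_normal_distribution borel (\<lambda>z. sqrt v * z)"

lemma real_distribution_gauss: "real_distribution (gauss v)"
  unfolding gauss_def
  by (intro prob_space.real_distribution_distr prob_space_std_normal_distribution) simp

lemma char_gauss: "0 \<le> v \<Longrightarrow> char (gauss v) u = exp (- (v * u\<^sup>2) / 2)"
proof -
  assume v: "0 \<le> v"
  have "char (gauss v) u = char std_normal_distribution (sqrt v * u)"
    unfolding char_def gauss_def by (subst integral_distr) (auto simp: mult_ac)
  also have "\<dots> = exp (- (v * u\<^sup>2) / 2)"
    using v by (simp add: char_std_normal_distribution power_mult_distrib)
  finally show ?thesis .
qed

lemma has_bochner_integral_gauss_iff:
  fixes f :: "real \<Rightarrow> 'b :: {banach, second_countable_topology}"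
  assumes "f \<in> borel_measurable borel"
  shows "has_bochner_integral (gauss v) f I \<longleftrightarrow>
    has_bochner_integral std_normal_distribution (\<lambda>z. f (sqrt v * z)) I"
  unfolding gauss_def has_bochner_integral_iff using assms
  by (simp add: integral_distr integrable_distr_eq)

text \<open>These are the one-step quantities of the Euler scheme: the multiplier
  \<open>1 - x\<close> of the error recursion, the factor \<open>exp (- x - v / 2)\<close> of mean 1
  in the exact solution, and the gap between the two, whose mean square \<open>exp v - 1 - v\<close>
  is of second order in \<open>v\<close>.\<close>

lemma gauss_moments:
  assumes v: "0 \<le> v"
  shows "has_bochner_integral (gauss v) (\<lambda>x. x) 0"
    and "has_bochner_integral (gauss v) (\<lambda>x. x\<^sup>2) v"
    and "has_bochner_integral (gauss v) (\<lambda>x. exp (- x - v / 2)) 1"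
    and "has_bochner_integral (gauss v) (\<lambda>x. (exp (- x - v / 2))\<^sup>2) (exp v)"
    and "has_bochner_integral (gauss v) (\<lambda>x. (exp (- x - v / 2) - 1 + x)\<^sup>2) (exp v - 1 - v)"
    and "has_bochner_integral (gauss v) (\<lambda>x. (1 - x)\<^sup>2) (1 + v)"
    and "has_bochner_integral (gauss v) (\<lambda>x. 1::real) 1"
proof -
  let ?s = "sqrt v"
  note E = has_bochner_integral_exp_std_normal and Mo = has_bochner_integral_std_normal_moments
  interpret N: prob_space std_normal_distribution by (rule prob_space_std_normal_distribution)
  have "has_bochner_integral std_normal_distribution (\<lambda>x. 1::real) 1"
    using N.prob_space by (simp add: has_bochner_integral_iff)
  then show 7: "has_bochner_integral (gauss v) (\<lambda>x. 1::real) 1"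
    by (subst has_bochner_integral_gauss_iff) simp_all
  have "has_bochner_integral std_normal_distribution (\<lambda>z. ?s * z) (?s * 0)"
    by (intro has_bochner_integral_mult_right Mo)
  then show 1: "has_bochner_integral (gauss v) (\<lambda>x. x) 0"
    by (subst has_bochner_integral_gauss_iff) auto
  have "has_bochner_integral std_normal_distribution (\<lambda>z. v * z\<^sup>2) (v * 1)"
    by (intro has_bochner_integral_mult_right Mo)
  then show 2: "has_bochner_integral (gauss v) (\<lambda>x. x\<^sup>2) v"
    using v by (subst has_bochner_integral_gauss_iff) (auto simp: power_mult_distrib)
  have "has_bochner_integral std_normal_distribution (\<lambda>z. exp (- v / 2) * exp ((- ?s) * z))
     (exp (- v / 2) * exp ((- ?s)\<^sup>2 / 2))"
    by (intro has_bochner_integral_mult_right E)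
  then show 3: "has_bochner_integral (gauss v) (\<lambda>x. exp (- x - v / 2)) 1"
    using v by (subst has_bochner_integral_gauss_iff) (auto simp: exp_add[symmetric] field_simps)
  have "has_bochner_integral std_normal_distribution (\<lambda>z. exp (- v) * exp ((- 2 * ?s) * z))
     (exp (- v) * exp ((- 2 * ?s)\<^sup>2 / 2))"
    by (intro has_bochner_integral_mult_right E)
  note exp2 = this
  show 4: "has_bochner_integral (gauss v) (\<lambda>x. (exp (- x - v / 2))\<^sup>2) (exp v)"
  proof -
    have "exp (- v) * exp ((- 2 * ?s) * z) = (exp (- (?s * z) - v / 2))\<^sup>2" for z
      unfolding power2_eq_square exp_add[symmetric] by (rule arg_cong[where f=exp]) (simp add: field_simps)
    with exp2 v show ?thesis by (simp add: exp_add[symmetric] has_bochner_integral_gauss_iff power_mult_distrib)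
  qed
  have "has_bochner_integral std_normal_distribution (\<lambda>z. (exp (- v / 2) * ?s) * (z * exp ((- ?s) * z)))
     ((exp (- v / 2) * ?s) * ((- ?s) * exp ((- ?s)\<^sup>2 / 2)))"
    by (intro has_bochner_integral_mult_right E)
  moreover have "(exp (- v / 2) * ?s) * (z * exp ((- ?s) * z)) = (?s * z) * exp (- (?s * z) - v / 2)" for z
  proof -
    have "exp (- (?s * z) - v / 2) = exp (- v / 2) * exp ((- ?s) * z)"
      unfolding exp_add[symmetric] by (rule arg_cong[where f=exp]) (simp add: field_simps)
    then show ?thesis by (simp only: mult_ac)
  qed
  moreover have "(exp (- v / 2) * ?s) * ((- ?s) * exp ((- ?s)\<^sup>2 / 2)) = - v"
    using v by (simp add: exp_minus field_simps)
  ultimately have "has_bochner_integral std_normal_distribution (\<lambda>z. (?s * z) * exp (- (?s * z) - v / 2)) (- v)"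
    by (simp only: )
  then have 8: "has_bochner_integral (gauss v) (\<lambda>x. x * exp (- x - v / 2)) (- v)"
    by (subst has_bochner_integral_gauss_iff) simp_all
  have "has_bochner_integral (gauss v)
     (\<lambda>x. (exp (- x - v / 2))\<^sup>2 + (- 2) * exp (- x - v / 2) + 1 + x\<^sup>2 + (2 * (x * exp (- x - v / 2)) + (- 2) * x))
     (exp v + (- 2) * 1 + 1 + v + (2 * (- v) + (- 2) * 0))"
    by (intro has_bochner_integral_add has_bochner_integral_mult_right 1 2 3 4 7 8)
  then show "has_bochner_integral (gauss v) (\<lambda>x. (exp (- x - v / 2) - 1 + x)\<^sup>2) (exp v - 1 - v)"
    by (simp add: power2_eq_square algebra_simps)
  have "has_bochner_integral (gauss v) (\<lambda>x. 1 + (- 2) * x + x\<^sup>2) (1 + (- 2) * 0 + v)"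
    by (intro has_bochner_integral_add has_bochner_integral_mult_right 1 2 7)
  then show "has_bochner_integral (gauss v) (\<lambda>x. (1 - x)\<^sup>2) (1 + v)"
    by (simp add: power2_eq_square algebra_simps)
qed

lemma borel_measurable_vec_nth [measurable (raw)]:
  fixes f :: "'a \<Rightarrow> ('b::topological_space)^'m"
  assumes "f \<in> borel_measurable M"
  shows "(\<lambda>x. f x $ i) \<in> borel_measurable M"
proof -
  have "(\<lambda>x::'b^'m. x $ i) \<in> borel_measurable borel"
    by (intro borel_measurable_continuous_onI continuous_intros)
  then show ?thesis using assms by (rule measurable_compose[rotated])
qed

section \<open>Increments of a vector Brownian motion relative to the filtration\<close>

locale brownian = prob_space M
  for M :: "'a measure" and F :: "real \<Rightarrow> 'a measure" and W :: "real \<Rightarrow> 'a \<Rightarrow> real^'m" +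
  assumes filtration: "filtration_on M F"
    and BM: "std_BM M F W"
begin

lemma space_F [simp]: "space (F t) = space M"
  and sets_F: "sets (F t) \<subseteq> sets M"
  and sets_F_mono: "s \<le> t \<Longrightarrow> sets (F s) \<subseteq> sets (F t)"
  using filtration by (auto simp: filtration_on_def)

lemma measurable_F_mono: "X \<in> measurable (F s) N \<Longrightarrow> s \<le> t \<Longrightarrow> X \<in> measurable (F t) N"
  using sets_F_mono[of s t] by (auto simp: measurable_def)

lemma measurable_F_M: "X \<in> measurable (F s) N \<Longrightarrow> X \<in> measurable M N"
  using sets_F[of s] by (auto simp: measurable_def)

lemma W_measurable: "0 \<le> s \<Longrightarrow> s \<le> t \<Longrightarrow> W s \<in> borel_measurable (F t)"
  using BM by (auto simp: std_BM_def intro: measurable_F_mono)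

lemma W_measurable_M [measurable]: "0 \<le> s \<Longrightarrow> W s \<in> borel_measurable M"
  using W_measurable[of s s] measurable_F_M by blast

lemma W_incr_measurable_M: "0 \<le> s \<Longrightarrow> s \<le> t \<Longrightarrow> (\<lambda>\<omega>. W t \<omega> - W s \<omega>) \<in> borel_measurable M"
  by (intro borel_measurable_diff) auto

text \<open>\<open>X\<close> generates a sub-sigma-algebra of \<open>F s\<close>, and the preimages
  under \<open>Y\<close> already form a sigma-algebra, so the product rule on these events is all of
  independence.\<close>

lemma indep_varI_F:
  assumes X: "X \<in> measurable (F s) N" and Y: "Y \<in> measurable M N'"
    and ind: "\<And>A C. A \<in> sets (F s) \<Longrightarrow> C \<in> sets N' \<Longrightarrow> prob (A \<inter> (Y -` C \<inter> space M)) = prob A * prob (Y -` C \<inter> space M)"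
  shows "indep_var N X N' Y"
proof -
  let ?A = "{X -` A \<inter> space M |A. A \<in> sets N}" and ?B = "{Y -` A \<inter> space M |A. A \<in> sets N'}"
  have "?A \<subseteq> sets (F s)" using measurable_sets[OF X] by auto
  then have A: "sigma_sets (space M) ?A \<subseteq> sets (F s)"
    using sets.sigma_sets_subset[of ?A "F s"] by simp
  have B: "sigma_sets (space M) ?B = ?B"
    using sets_vimage_algebra[of "space M" Y N'] sets_vimage_algebra2[of Y "space M" N'] measurable_space[OF Y] by auto
  have "indep_set (sigma_sets (space M) ?A) (sigma_sets (space M) ?B)"
    unfolding indep_sets2_eq B using A sets_F[of s] measurable_sets[OF Y] ind by auto
  then show ?thesis unfolding indep_var_eq using measurable_F_M[OF X] Y by auto
qed

lemma indep_var_incr: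
  assumes st: "0 \<le> s" "s < t" and X: "X \<in> measurable (F s) N" and g: "g \<in> measurable borel N'"
  shows "indep_var N X N' (\<lambda>\<omega>. g (W t \<omega> - W s \<omega>))"
proof (rule indep_varI_F[OF X])
  let ?Y = "\<lambda>\<omega>. W t \<omega> - W s \<omega>"
  have Y: "?Y \<in> borel_measurable M" using st W_incr_measurable_M by auto
  then show "(\<lambda>\<omega>. g (?Y \<omega>)) \<in> measurable M N'" using g by (rule measurable_compose)
  fix A C assume A: "A \<in> sets (F s)" and "C \<in> sets N'"
  then have C: "g -` C \<in> sets borel" using measurable_sets[OF g, of C] by simp
  have "\<forall>A\<in>sets (F s). \<forall>C\<in>sets borel. prob (A \<inter> {\<omega>\<in>space M. ?Y \<omega> \<in> C})
             = prob A * prob {\<omega>\<in>space M. ?Y \<omega> \<in> C}"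
    using BM st unfolding std_BM_def by blast
  then have "prob (A \<inter> {\<omega>\<in>space M. ?Y \<omega> \<in> g -` C}) = prob A * prob {\<omega>\<in>space M. ?Y \<omega> \<in> g -` C}"
    using A C by blast
  moreover have "(\<lambda>\<omega>. g (?Y \<omega>)) -` C \<inter> space M = {\<omega>\<in>space M. ?Y \<omega> \<in> g -` C}" by auto
  ultimately show "prob (A \<inter> ((\<lambda>\<omega>. g (?Y \<omega>)) -` C \<inter> space M)) = prob A * prob ((\<lambda>\<omega>. g (?Y \<omega>)) -` C \<inter> space M)"
    by simp
qed

lemma incr_component:
  assumes st: "0 \<le> s" "s < t"
  shows "distr M borel (\<lambda>\<omega>. (W t \<omega> - W s \<omega>) $ i) = gauss (t - s)"
    and "indep_vars (\<lambda>_. borel) (\<lambda>i \<omega>. (W t \<omega> - W s \<omega>) $ i) UNIV"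
proof -
  show ind: "indep_vars (\<lambda>_. borel) (\<lambda>i \<omega>. (W t \<omega> - W s \<omega>) $ i) UNIV"
    using st BM unfolding std_BM_def by blast
  have d: "distributed M lborel (\<lambda>\<omega>. (W t \<omega> - W s \<omega>) $ i)
                (\<lambda>y. ennreal (normal_density 0 (sqrt (t - s)) y))"
    using st BM unfolding std_BM_def by blast
  interpret N: prob_space std_normal_distribution by (rule prob_space_std_normal_distribution)
  have "distributed std_normal_distribution lborel (\<lambda>x. x) (normal_density 0 1)"
    unfolding distributed_def by (auto simp: distr_id2 intro!: distr_id)
  from N.normal_density_affine[OF this, of "sqrt (t - s)" 0] st
  have "distributed std_normal_distribution lborel (\<lambda>x. sqrt (t - s) * x) (normal_density 0 (sqrt (t - s)))"
    by simp
  then have "distr std_normal_distribution lborel (\<lambda>x. sqrt (t - s) * x) = 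
      distr M lborel (\<lambda>\<omega>. (W t \<omega> - W s \<omega>) $ i)"
    using d by (simp add: distributed_def)
  then show "distr M borel (\<lambda>\<omega>. (W t \<omega> - W s \<omega>) $ i) = gauss (t - s)"
    unfolding gauss_def by (simp add: distr_def)
qed

text \<open>The coordinates are independent centred normals, so their characteristic functions
  multiply and the variances \<open>(l $ i)\<^sup>2 * (t - s)\<close> add up. Arguing with
  characteristic functions also covers \<open>l = 0\<close>, where there is no density.\<close>

lemma distr_incr:
  assumes st: "0 \<le> s" "s < t"
  shows "distr M borel (\<lambda>\<omega>. l \<bullet> (W t \<omega> - W s \<omega>)) = gauss ((norm l)\<^sup>2 * (t - s))"
proof (rule Levy_uniqueness)
  let ?Y = "\<lambda>i \<omega>. (W t \<omega> - W s \<omega>) $ i"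
  have [measurable]: "(\<lambda>\<omega>. W t \<omega> - W s \<omega>) \<in> borel_measurable M" using W_incr_measurable_M st by auto
  have [measurable]: "W s \<in> borel_measurable M" "W t \<in> borel_measurable M"
    using st by (auto intro: W_measurable_M)
  show "real_distribution (distr M borel (\<lambda>\<omega>. l \<bullet> (W t \<omega> - W s \<omega>)))"
    by (intro real_distribution_distr) measurable
  show "real_distribution (gauss ((norm l)\<^sup>2 * (t - s)))" by (rule real_distribution_gauss)
  show "char (distr M borel (\<lambda>\<omega>. l \<bullet> (W t \<omega> - W s \<omega>))) = char (gauss ((norm l)\<^sup>2 * (t - s)))"
  proof
    fix u
    have "indep_vars (\<lambda>_. borel) (\<lambda>i \<omega>. l $ i * ?Y i \<omega>) UNIV"
      by (rule indep_vars_compose2[OF incr_component(2)[OF st]]) simp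
    from char_distr_sum[OF this, of u]
    have "char (distr M borel (\<lambda>\<omega>. \<Sum>i\<in>UNIV. l $ i * ?Y i \<omega>)) u =
       (\<Prod>i\<in>UNIV. char (distr M borel (\<lambda>\<omega>. l $ i * ?Y i \<omega>)) u)" .
    also have "\<dots> = (\<Prod>i\<in>UNIV. complex_of_real (exp (- ((t - s) * (u * l $ i)\<^sup>2) / 2)))"
    proof (rule prod.cong[OF refl])
      fix i
      have eq: "char (distr M borel (\<lambda>\<omega>. l $ i * ?Y i \<omega>)) u = char (distr M borel (?Y i)) (u * l $ i)"
        unfolding char_def by (subst (1 2) integral_distr) (auto simp: mult_ac)
      show "char (distr M borel (\<lambda>\<omega>. l $ i * ?Y i \<omega>)) u = exp (- ((t - s) * (u * l $ i)\<^sup>2) / 2)"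
        unfolding eq incr_component(1)[OF st] using st by (simp add: char_gauss)
    qed
    also have "(\<Prod>i\<in>UNIV. complex_of_real (exp (- ((t - s) * (u * l $ i)\<^sup>2) / 2))) = 
        complex_of_real (exp (\<Sum>i\<in>UNIV. - ((t - s) * (u * l $ i)\<^sup>2) / 2))"
      by (subst exp_sum) auto
    also have "(\<Sum>i\<in>UNIV. - ((t - s) * (u * l $ i)\<^sup>2) / 2) = - ((norm l)\<^sup>2 * (t - s) * u\<^sup>2) / 2"
      unfolding power2_norm_eq_inner
      by (simp add: inner_vec_def sum_distrib_left sum_distrib_right sum_divide_distrib sum_negf power2_eq_square mult_ac)
    finally show "char (distr M borel (\<lambda>\<omega>. l \<bullet> (W t \<omega> - W s \<omega>))) u = char (gauss ((norm l)\<^sup>2 * (t - s))) u"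
      using st by (simp add: char_gauss inner_vec_def)
  qed
qed

lemma has_bochner_integral_mult_incr:
  fixes f :: "real \<Rightarrow> real"
  assumes st: "0 \<le> s" "s < t" and X: "X \<in> borel_measurable (F s)" "integrable M X"
    and f: "has_bochner_integral (gauss ((norm l)\<^sup>2 * (t - s))) f I"
  shows "has_bochner_integral M (\<lambda>\<omega>. X \<omega> * f (l \<bullet> (W t \<omega> - W s \<omega>))) (expectation X * I)"
proof -
  have Y[measurable]: "(\<lambda>\<omega>. W t \<omega> - W s \<omega>) \<in> borel_measurable M" using W_incr_measurable_M st by auto
  have fm[measurable]: "f \<in> borel_measurable borel"
    using f by (auto simp: gauss_def has_bochner_integral_iff dest: borel_measurable_integrable)
  have ind: "indep_var borel X borel (\<lambda>\<omega>. f (l \<bullet> (W t \<omega> - W s \<omega>)))"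
    by (rule indep_var_incr[OF st X(1)]) measurable
  have "has_bochner_integral (distr M borel (\<lambda>\<omega>. l \<bullet> (W t \<omega> - W s \<omega>))) f I"
    using f distr_incr[OF st] by simp
  then have "has_bochner_integral M (\<lambda>\<omega>. f (l \<bullet> (W t \<omega> - W s \<omega>))) I"
    unfolding has_bochner_integral_iff by (auto simp: integral_distr integrable_distr_eq)
  then show ?thesis
    using indep_var_lebesgue_integral[OF ind X(2)] indep_var_integrable[OF ind X(2)]
    by (auto simp: has_bochner_integral_iff)
qed

text \<open>What is available is the law of a linear form of the increment, independent of
  \<open>X\<close>. Mixed products are reduced to squares of linear forms by polarization along
  \<open>axis i 1 + axis j 1\<close>, whose squared norm is 2 when \<open>i\<close> and
  \<open>j\<close> differ.\<close>

lemma has_bochner_integral_mult_incr_component: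
  assumes st: "0 \<le> s" "s < t" and X: "X \<in> borel_measurable (F s)" "integrable M X"
  shows "has_bochner_integral M (\<lambda>\<omega>. X \<omega> * (W t \<omega> - W s \<omega>) $ i) 0"
    and "has_bochner_integral M (\<lambda>\<omega>. X \<omega> * ((W t \<omega> - W s \<omega>) $ i * (W t \<omega> - W s \<omega>) $ j))
      (if i = j then expectation X * (t - s) else 0)"
proof -
  let ?Y = "\<lambda>i \<omega>. (W t \<omega> - W s \<omega>) $ i"
  have sq: "has_bochner_integral M (\<lambda>\<omega>. X \<omega> * (l \<bullet> (W t \<omega> - W s \<omega>))\<^sup>2) (expectation X * ((norm l)\<^sup>2 * (t - s)))" for l
    by (rule has_bochner_integral_mult_incr[OF st X gauss_moments(2)]) (use st in auto)
  have ax: "axis i 1 \<bullet> (v::real^'m) = v $ i" for i v by (simp add: inner_axis' )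
  have "has_bochner_integral M (\<lambda>\<omega>. X \<omega> * (axis i 1 \<bullet> (W t \<omega> - W s \<omega>))) (expectation X * 0)"
    by (rule has_bochner_integral_mult_incr[OF st X gauss_moments(1)]) (use st in auto)
  then show "has_bochner_integral M (\<lambda>\<omega>. X \<omega> * ?Y i \<omega>) 0" unfolding ax by simp
  show "has_bochner_integral M (\<lambda>\<omega>. X \<omega> * (?Y i \<omega> * ?Y j \<omega>)) (if i = j then expectation X * (t - s) else 0)"
  proof (cases "i = j")
    case True
    then show ?thesis using sq[of "axis i 1"] unfolding ax by (simp add: power2_eq_square norm_axis_1)
  next
    case False
    have nrm: "(norm (axis i 1 + axis j 1 :: real^'m))\<^sup>2 = 2"
      unfolding power2_norm_eq_inner using False
      by (simp add: inner_add_left inner_add_right inner_axis_axis)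
    have "has_bochner_integral M (\<lambda>\<omega>. (1/2) * (X \<omega> * ((axis i 1 + axis j 1) \<bullet> (W t \<omega> - W s \<omega>))\<^sup>2
        - X \<omega> * (axis i 1 \<bullet> (W t \<omega> - W s \<omega>))\<^sup>2 - X \<omega> * (axis j 1 \<bullet> (W t \<omega> - W s \<omega>))\<^sup>2))
      ((1/2) * (expectation X * (2 * (t - s)) - expectation X * ((norm (axis i 1 :: real^'m))\<^sup>2 * (t - s))
        - expectation X * ((norm (axis j 1 :: real^'m))\<^sup>2 * (t - s))))"
      unfolding nrm[symmetric]
      by (intro has_bochner_integral_mult_right has_bochner_integral_diff sq)
    moreover have "(1/2) * (x * ((axis i 1 + axis j 1) \<bullet> v)\<^sup>2 - x * (axis i 1 \<bullet> v)\<^sup>2 - x * (axis j 1 \<bullet> v)\<^sup>2)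
       = x * (v $ i * v $ j)" for x and v :: "real^'m"
      unfolding inner_add_left ax by (simp add: power2_eq_square algebra_simps)
    moreover have "(1/2) * (expectation X * (2 * (t - s)) - expectation X * ((norm (axis i 1 :: real^'m))\<^sup>2 * (t - s))
        - expectation X * ((norm (axis j 1 :: real^'m))\<^sup>2 * (t - s))) = 0"
      by (simp add: norm_axis_1 algebra_simps)
    ultimately show ?thesis using False by (simp only: if_False)
  qed
qed

text \<open>One-step Ito isometry and martingale property. The integrand is random, so the law of a
  fixed linear form does not apply directly; expanding in coordinates collects all randomness of
  \<eta> and \<open>X\<close> in factors known at time \<open>s\<close>.\<close>

lemma martingale_increment:
  fixes \<eta> :: "'a \<Rightarrow> real^'m"
  assumes st: "0 \<le> s" "s < t" and \<eta>: "\<eta> \<in> borel_measurable (F s)" and bd: "\<And>\<omega>. norm (\<eta> \<omega>) \<le> C"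
  shows "has_bochner_integral M (\<lambda>\<omega>. (\<eta> \<omega> \<bullet> (W t \<omega> - W s \<omega>))\<^sup>2) (expectation (\<lambda>\<omega>. (norm (\<eta> \<omega>))\<^sup>2) * (t - s))"
    and "\<And>X. X \<in> borel_measurable (F s) \<Longrightarrow> integrable M (\<lambda>\<omega>. (X \<omega>)\<^sup>2) \<Longrightarrow>
      has_bochner_integral M (\<lambda>\<omega>. X \<omega> * (\<eta> \<omega> \<bullet> (W t \<omega> - W s \<omega>))) 0"
proof -
  have \<eta>M [measurable]: "\<eta> \<in> borel_measurable M" using measurable_F_M[OF \<eta>] .
  have \<eta>F [measurable]: "(\<lambda>\<omega>. \<eta> \<omega> $ i) \<in> borel_measurable (F s)" for i using \<eta> by measurable
  have bdi: "\<bar>\<eta> \<omega> $ i\<bar> \<le> C" for i \<omega> using bd[of \<omega>] component_le_norm_cart[of "\<eta> \<omega>" i] by linarith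
  have C: "0 \<le> C" using bd[of undefined] norm_ge_zero order_trans by blast
  have int: "integrable M (\<lambda>\<omega>. \<eta> \<omega> $ i * \<eta> \<omega> $ j)" for i j
    by (rule integrable_const_bound[where B="C * C"]) (auto simp: abs_mult intro!: AE_I2 mult_mono bdi C)
  have "has_bochner_integral M (\<lambda>\<omega>. \<Sum>i\<in>UNIV. \<Sum>j\<in>UNIV. (\<eta> \<omega> $ i * \<eta> \<omega> $ j) * ((W t \<omega> - W s \<omega>) $ i * (W t \<omega> - W s \<omega>) $ j))
    (\<Sum>i\<in>UNIV. \<Sum>j\<in>UNIV. if i = j then expectation (\<lambda>\<omega>. \<eta> \<omega> $ i * \<eta> \<omega> $ j) * (t - s) else 0)"
    by (intro has_bochner_integral_sum has_bochner_integral_mult_incr_component st int) measurable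
  moreover have "(\<Sum>i\<in>UNIV. \<Sum>j\<in>UNIV. (\<eta> \<omega> $ i * \<eta> \<omega> $ j) * ((W t \<omega> - W s \<omega>) $ i * (W t \<omega> - W s \<omega>) $ j))
      = (\<eta> \<omega> \<bullet> (W t \<omega> - W s \<omega>))\<^sup>2" for \<omega>
    unfolding inner_vec_def power2_eq_square sum_product by (simp add: mult_ac)
  moreover have "(\<Sum>i\<in>UNIV. expectation (\<lambda>\<omega>. \<eta> \<omega> $ i * \<eta> \<omega> $ i)) = expectation (\<lambda>\<omega>. (norm (\<eta> \<omega>))\<^sup>2)"
    unfolding power2_norm_eq_inner inner_vec_def by (subst Bochner_Integration.integral_sum) (auto intro: int)
  ultimately show "has_bochner_integral M (\<lambda>\<omega>. (\<eta> \<omega> \<bullet> (W t \<omega> - W s \<omega>))\<^sup>2) (expectation (\<lambda>\<omega>. (norm (\<eta> \<omega>))\<^sup>2) * (t - s))"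
    by (simp add: sum_distrib_right[symmetric])
  fix X :: "'a \<Rightarrow> real" assume X: "X \<in> borel_measurable (F s)" and X2: "integrable M (\<lambda>\<omega>. (X \<omega>)\<^sup>2)"
  have [measurable]: "X \<in> borel_measurable M" using measurable_F_M[OF X] .
  have Xi: "integrable M X" by (rule square_integrable_imp_integrable[OF _ X2]) measurable
  have int: "integrable M (\<lambda>\<omega>. X \<omega> * \<eta> \<omega> $ i)" for i
    by (rule Bochner_Integration.integrable_bound[OF integrable_mult_left[OF integrable_abs[OF Xi], of C]])
      (auto simp: abs_mult intro!: AE_I2 mult_mono bdi order_trans[OF bdi])
  have "has_bochner_integral M (\<lambda>\<omega>. \<Sum>i\<in>UNIV. (X \<omega> * \<eta> \<omega> $ i) * (W t \<omega> - W s \<omega>) $ i) (\<Sum>i\<in>(UNIV::'m set). 0)"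
    by (intro has_bochner_integral_sum has_bochner_integral_mult_incr_component st int borel_measurable_times X \<eta>F)
  then show "has_bochner_integral M (\<lambda>\<omega>. X \<omega> * (\<eta> \<omega> \<bullet> (W t \<omega> - W s \<omega>))) 0"
    by (simp add: inner_vec_def sum_distrib_left mult_ac)
qed

text \<open>The last increment is independent of everything known at \<open>t q\<close>, the
  indicator of \<open>A\<close> included, and splits off as a factor. The event \<open>A\<close> is
  carried along because it encodes the past.\<close>

lemma char_incr_sum:
  fixes l :: "nat \<Rightarrow> real^'m" and t :: "nat \<Rightarrow> real"
  assumes t: "0 \<le> t p" "\<And>k. t k < t (Suc k)" and pq: "p \<le> q" and A: "A \<in> sets (F (t p))"
  shows "(\<integral>\<omega>. indicator A \<omega> * iexp (u * (\<Sum>k=p..<q. l k \<bullet> (W (t (Suc k)) \<omega> - W (t k) \<omega>))) \<partial>M)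
    = prob A * exp (- ((\<Sum>k=p..<q. (norm (l k))\<^sup>2 * (t (Suc k) - t k)) * u\<^sup>2) / 2)"
  using pq
proof (induction q rule: dec_induct)
  case base
  have A: "A \<in> sets M" using A sets_F by blast
  have "(\<integral>\<omega>. indicator A \<omega> \<partial>M) = (\<integral>\<omega>. complex_of_real (indicator A \<omega>) \<partial>M)"
    by (intro Bochner_Integration.integral_cong) (auto simp: indicator_def)
  then show ?case using A by simp
next
  case (step q)
  have mono: "t i \<le> t j" if "i \<le> j" for i j
    by (rule lift_Suc_mono_le[of t, OF _ that]) (simp add: t(2) less_imp_le)
  have tq: "0 \<le> t q" using mono[of p q] step t by linarith
  let ?d = "\<lambda>k \<omega>. l k \<bullet> (W (t (Suc k)) \<omega> - W (t k) \<omega>)"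
  let ?Z = "\<lambda>\<omega>. indicator A \<omega> * iexp (u * (\<Sum>k=p..<q. ?d k \<omega>))"
  have A': "A \<in> sets (F (t q))" using A sets_F_mono[OF mono[of p q]] step by auto
  have W': "W (t k) \<in> borel_measurable (F (t q))" if "p \<le> k" "k \<le> q" for k
    using W_measurable mono[of p k] mono[of k q] that t(1) by auto
  have dm: "?d k \<in> borel_measurable (F (t q))" if "p \<le> k" "k < q" for k
    using W'[of k] W'[of "Suc k"] that by (intro borel_measurable_inner borel_measurable_diff) auto
  have Zm: "?Z \<in> borel_measurable (F (t q))"
  proof -
    have [measurable]: "(\<lambda>\<omega>. \<Sum>k=p..<q. ?d k \<omega>) \<in> borel_measurable (F (t q))"
      by (intro borel_measurable_sum dm) auto
    show ?thesis using A' by measurable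
  qed
  have Y[measurable]: "(\<lambda>\<omega>. W (t (Suc q)) \<omega> - W (t q) \<omega>) \<in> borel_measurable M"
    using W_incr_measurable_M tq t(2)[of q] by auto
  have ind: "indep_var borel ?Z borel (\<lambda>\<omega>. iexp (u * ?d q \<omega>))"
    by (rule indep_var_incr[OF tq t(2) Zm]) measurable
  have i1: "integrable M ?Z"
    using measurable_F_M[OF Zm] by (intro integrable_const_bound[where B=1]) (auto simp: norm_mult split: split_indicator)
  have i2: "integrable M (\<lambda>\<omega>. iexp (u * ?d q \<omega>))"
    by (intro integrable_const_bound[where B=1]) auto
  have "(\<integral>\<omega>. indicator A \<omega> * iexp (u * (\<Sum>k=p..<Suc q. ?d k \<omega>)) \<partial>M) = (\<integral>\<omega>. ?Z \<omega> * iexp (u * ?d q \<omega>) \<partial>M)"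
    using step by (intro Bochner_Integration.integral_cong) (auto simp: distrib_left exp_add mult_ac)
  also have "\<dots> = (\<integral>\<omega>. ?Z \<omega> \<partial>M) * (\<integral>\<omega>. iexp (u * ?d q \<omega>) \<partial>M)"
    by (rule indep_var_lebesgue_integral[OF ind i1 i2])
  also have "(\<integral>\<omega>. iexp (u * ?d q \<omega>) \<partial>M) = char (distr M borel (?d q)) u"
    unfolding char_def by (subst integral_distr) auto
  also have "\<dots> = exp (- (((norm (l q))\<^sup>2 * (t (Suc q) - t q)) * u\<^sup>2) / 2)"
    using t(2)[of q] by (simp add: distr_incr[OF tq t(2)] char_gauss)
  finally have "(\<integral>\<omega>. indicator A \<omega> * iexp (u * (\<Sum>k=p..<Suc q. ?d k \<omega>)) \<partial>M) =
     (\<integral>\<omega>. ?Z \<omega> \<partial>M) * exp (- (((norm (l q))\<^sup>2 * (t (Suc q) - t q)) * u\<^sup>2) / 2)" .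
  moreover have "(\<integral>\<omega>. ?Z \<omega> \<partial>M) = prob A * exp (- ((\<Sum>k=p..<q. (norm (l k))\<^sup>2 * (t (Suc k) - t k)) * u\<^sup>2) / 2)"
    by (rule step.IH)
  moreover have "exp (- ((\<Sum>k=p..<Suc q. (norm (l k))\<^sup>2 * (t (Suc k) - t k)) * u\<^sup>2) / 2) =
     exp (- ((\<Sum>k=p..<q. (norm (l k))\<^sup>2 * (t (Suc k) - t k)) * u\<^sup>2) / 2) *
     exp (- (((norm (l q))\<^sup>2 * (t (Suc q) - t q)) * u\<^sup>2) / 2)"
    unfolding exp_add[symmetric] using step by (intro arg_cong[where f=exp]) (simp add: field_simps)
  ultimately show ?case
    by (simp only: of_real_mult mult.assoc)
qed

text \<open>Conditioning \<open>M\<close> on a non-null event of the past leaves the characteristic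
  function of \<open>S\<close> unchanged, hence its law. A law that does not see the conditioning is
  independence of the past.\<close>

lemma incr_sum_law:
  fixes l :: "nat \<Rightarrow> real^'m" and t :: "nat \<Rightarrow> real"
  assumes t: "0 \<le> t p" "\<And>k. t k < t (Suc k)" and pq: "p \<le> q"
  defines "H \<equiv> \<Sum>k=p..<q. (norm (l k))\<^sup>2 * (t (Suc k) - t k)"
  defines "S \<equiv> \<lambda>\<omega>. \<Sum>k=p..<q. l k \<bullet> (W (t (Suc k)) \<omega> - W (t k) \<omega>)"
  shows "distr M borel S = gauss H"
    and "X \<in> measurable (F (t p)) N \<Longrightarrow> indep_var N X borel S"
proof -
  have mono: "t i \<le> t j" if "i \<le> j" for i j
    by (rule lift_Suc_mono_le[of t, OF _ that]) (simp add: t(2) less_imp_le)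
  have tk: "0 \<le> t k" if "p \<le> k" for k using mono[of p k] that t by linarith
  have S[measurable]: "S \<in> borel_measurable M"
    unfolding S_def using W_incr_measurable_M[OF tk, of _ "t (Suc _)"] t(2)
    by (intro borel_measurable_sum borel_measurable_inner borel_measurable_const) (auto intro: less_imp_le)
  have H: "0 \<le> H" unfolding H_def using t(2) by (intro sum_nonneg mult_nonneg_nonneg) (auto intro: less_imp_le)
  have law: "distr (density M (\<lambda>\<omega>. ennreal (indicator A \<omega> / prob A))) borel S = gauss H"
    if A: "A \<in> sets (F (t p))" and pos: "prob A > 0" for A
  proof (rule Levy_uniqueness)
    have AM[measurable]: "A \<in> sets M" using A sets_F by blast
    let ?Q = "density M (\<lambda>\<omega>. ennreal (indicator A \<omega> / prob A))"
    have "integrable M (indicat_real A)" by (rule integrable_const_bound[where B=1]) auto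
    then have "emeasure ?Q (space M) = ennreal (\<integral>\<omega>. indicator A \<omega> / prob A \<partial>M)"
      by (subst emeasure_density, simp, simp, subst nn_integral_eq_integral[symmetric])
         (auto intro!: nn_integral_cong integrable_divide)
    then have "prob_space ?Q" using pos by (intro prob_spaceI) simp
    then show "real_distribution (distr ?Q borel S)"
      by (rule prob_space.real_distribution_distr) simp
    show "real_distribution (gauss H)" by (rule real_distribution_gauss)
    show "char (distr ?Q borel S) = char (gauss H)"
    proof
      fix u
      have "char (distr ?Q borel S) u = (\<integral>\<omega>. (indicator A \<omega> / prob A) *\<^sub>R iexp (u * S \<omega>) \<partial>M)"
        unfolding char_def by (subst integral_distr, simp, simp, subst integral_density) auto
      also have "\<dots> = (\<integral>\<omega>. indicator A \<omega> * iexp (u * S \<omega>) / prob A \<partial>M)"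
        by (intro Bochner_Integration.integral_cong) (auto simp: indicator_def scaleR_conv_of_real)
      also have "\<dots> = (\<integral>\<omega>. indicator A \<omega> * iexp (u * S \<omega>) \<partial>M) / prob A" by simp
      also have "\<dots> = char (gauss H) u"
        using char_incr_sum[OF t pq A, of u l] pos H by (simp add: S_def H_def char_gauss)
      finally show "char (distr ?Q borel S) u = char (gauss H) u" .
    qed
  qed
  have "density M (\<lambda>\<omega>. ennreal (indicator (space M) \<omega> / prob (space M))) = M"
  proof -
    have "density M (\<lambda>\<omega>. ennreal (indicator (space M) \<omega> / prob (space M))) = density M (\<lambda>_. 1)"
      by (intro density_cong) (auto simp: prob_space)
    then show ?thesis by (simp add: density_1)
  qed
  then show lawM: "distr M borel S = gauss H"
    using law[of "space M"] sets.top[of "F (t p)"] by (simp add: prob_space)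
  assume X: "X \<in> measurable (F (t p)) N"
  show "indep_var N X borel S"
  proof (rule indep_varI_F[OF X S])
    fix a C assume a: "a \<in> sets (F (t p))" and C[measurable]: "C \<in> sets (borel :: real measure)"
    define b where bC: "b = S -` C \<inter> space M"
    have "prob (a \<inter> b) = prob a * prob b"
    proof (cases "prob a = 0")
      case True
      have "prob (a \<inter> b) \<le> prob a" using a sets_F by (intro finite_measure_mono) auto
      then show ?thesis using True by (simp add: measure_le_0_iff)
    next
      case False
      then have pos: "prob a > 0" by (simp add: zero_less_measure_iff)
      have [measurable]: "a \<in> sets M" using a sets_F by auto
      have [measurable]: "b \<in> sets M" unfolding bC by measurable
      have "prob b = measure (distr M borel S) C" by (simp add: measure_distr bC)
      also have "\<dots> = measure (distr (density M (\<lambda>\<omega>. ennreal (indicator a \<omega> / prob a))) borel S) C"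
        by (simp only: lawM law[OF a pos])
      also have "\<dots> = measure (density M (\<lambda>\<omega>. ennreal (indicator a \<omega> / prob a))) b"
        by (subst measure_distr) (auto simp: bC)
      also have "\<dots> = prob (a \<inter> b) / prob a"
      proof -
        have "emeasure (density M (\<lambda>\<omega>. ennreal (indicator a \<omega> / prob a))) b
           = (\<integral>\<^sup>+\<omega>. ennreal (indicator (a \<inter> b) \<omega> / prob a) \<partial>M)"
          by (subst emeasure_density) (auto intro!: nn_integral_cong split: split_indicator)
        also have "\<dots> = ennreal (\<integral>\<omega>. indicator (a \<inter> b) \<omega> / prob a \<partial>M)"
          using integrable_const_bound[of "indicat_real (a \<inter> b)" 1] by (intro nn_integral_eq_integral integrable_divide) auto
        finally show ?thesis by (simp add: measure_def)
      qed
      finally show ?thesis using pos by simp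
    qed
    then show "prob (a \<inter> (S -` C \<inter> space M)) = prob a * prob (S -` C \<inter> space M)" unfolding bC .
  qed
qed

end

section \<open>Approximation of integrals on an interval\<close>

lemma sum_integral_grid:
  fixes t :: "nat \<Rightarrow> real" and f :: "real \<Rightarrow> 'b::banach"
  assumes t: "\<And>k. t k \<le> t (Suc k)" and f: "f integrable_on {t 0..t n}"
  shows "(\<Sum>k<n. integral {t k..t (Suc k)} f) = integral {t 0..t n} f"
  using f
proof (induction n)
  case (Suc n)
  have m: "t 0 \<le> t n" by (rule lift_Suc_mono_le[of t, OF t]) simp
  have "f integrable_on {t 0..t n}"
    by (rule integrable_subinterval_real[OF Suc.prems]) (use t[of n] in auto)
  then show ?case
    using Suc Henstock_Kurzweil_Integration.integral_combine[OF m t Suc.prems] by simp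
qed simp

lemma absolutely_integrable_mult_continuous:
  fixes f g :: "real \<Rightarrow> real"
  assumes f: "f absolutely_integrable_on {a..b}" and g: "continuous_on {a..b} g"
  shows "(\<lambda>s. g s * f s) absolutely_integrable_on {a..b}"
proof (rule absolutely_integrable_bounded_measurable_product_real[OF _ _ _ f])
  show "g \<in> borel_measurable (lebesgue_on {a..b})"
    by (rule continuous_imp_measurable_on_sets_lebesgue[OF g]) simp
  show "bounded (g ` {a..b})" using compact_continuous_image[OF g] compact_imp_bounded by auto
qed simp

lemma abs_exp_minus_linear_le:
  fixes x :: real
  assumes "\<bar>x\<bar> \<le> 1"
  shows "\<bar>exp x - 1 - x\<bar> \<le> x\<^sup>2"
proof (cases "x \<ge> 0")
  case True
  then show ?thesis unfolding abs_le_iff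
    using exp_bound[of x] exp_ge_add_one_self[of x] zero_le_power2[of x] assms by linarith
next
  case False
  have "exp x \<le> 1 + x + x\<^sup>2"
  proof -
    \<comment> \<open>The product \<open>(1 + x + x\<^sup>2) * (1 - x)\<close> equals
      \<open>1 - x ^ 3\<close>, which is at least 1 for negative \<open>x\<close>, and
      \<open>1 - x \<le> exp (- x)\<close>.\<close>
    have "x * x\<^sup>2 \<le> 0" using False by (intro mult_nonpos_nonneg) auto
    then have "1 \<le> (1 + x + x\<^sup>2) * (1 - x)" by (simp add: algebra_simps power2_eq_square)
    also have "\<dots> \<le> (1 + x + x\<^sup>2) * exp (- x)"
      using exp_ge_add_one_self[of "- x"] False assms
      by (intro mult_left_mono) (auto intro: add_nonneg_nonneg)
    finally have "1 \<le> (1 + x + x\<^sup>2) * exp (- x)" .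
    then show ?thesis by (simp add: exp_minus field_simps)
  qed
  then show ?thesis unfolding abs_le_iff
    using exp_ge_add_one_self[of x] zero_le_power2[of x] by linarith
qed

text \<open>A telescoping substitute for "zero derivative implies constant": increments that are
  uniformly negligible against those of \<open>G\<close> sum to nothing. It suits indefinite
  integrals, which need not be differentiable at every point.\<close>

lemma eq_if_increments_small:
  fixes \<Phi> G :: "real \<Rightarrow> real"
  assumes ab: "a \<le> b"
    and small: "\<And>e. e > 0 \<Longrightarrow> \<exists>d>0. \<forall>s t. a \<le> s \<longrightarrow> s \<le> t \<longrightarrow> t \<le> b \<longrightarrow> t - s < d \<longrightarrow> \<bar>\<Phi> t - \<Phi> s\<bar> \<le> e * (G t - G s)"
  shows "\<Phi> b = \<Phi> a"
proof -
  have "\<bar>\<Phi> b - \<Phi> a\<bar> \<le> e * (G b - G a)" if "e > 0" for e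
  proof -
    from small[OF that] obtain d where d: "d > 0"
      "\<And>s t. a \<le> s \<Longrightarrow> s \<le> t \<Longrightarrow> t \<le> b \<Longrightarrow> t - s < d \<Longrightarrow> \<bar>\<Phi> t - \<Phi> s\<bar> \<le> e * (G t - G s)" by blast
    obtain n :: nat where n: "(b - a) / d < real n" using reals_Archimedean2 by blast
    have "0 \<le> (b - a) / d" using ab d by simp
    then have n0: "n > 0" using n by linarith
    define t where "t k = a + real k * ((b - a) / real n)" for k
    have st: "t (Suc k) - t k = (b - a) / n" for k by (simp only: t_def of_nat_Suc distrib_right)
    have le: "t k \<le> t (Suc k)" for k
    proof -
      have "0 \<le> (b - a) / n" using ab by simp
      then show ?thesis using st[of k] by linarith
    qed
    have t0: "t 0 = a" and tn: "t n = b" using n0 by (auto simp: t_def)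
    have mono: "t i \<le> t j" if "i \<le> j" for i j by (rule lift_Suc_mono_le[of t, OF le that])
    have "(b - a) / n < d" using n n0 d by (simp add: field_simps)
    then have "\<bar>\<Phi> (t (Suc k)) - \<Phi> (t k)\<bar> \<le> e * (G (t (Suc k)) - G (t k))" if "k < n" for k
      using mono[of 0 k] mono[of "Suc k" n] that t0 tn st[of k] le[of k] by (intro d(2)) auto
    then have "(\<Sum>k<n. \<bar>\<Phi> (t (Suc k)) - \<Phi> (t k)\<bar>) \<le> (\<Sum>k<n. e * (G (t (Suc k)) - G (t k)))"
      by (intro sum_mono) auto
    also have "\<dots> = e * (G b - G a)"
      unfolding sum_distrib_left[symmetric] by (simp add: sum_lessThan_telescope[of "\<lambda>k. G (t k)"] t0 tn)
    finally have "(\<Sum>k<n. \<bar>\<Phi> (t (Suc k)) - \<Phi> (t k)\<bar>) \<le> e * (G b - G a)" .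
    moreover have "\<bar>\<Phi> b - \<Phi> a\<bar> \<le> (\<Sum>k<n. \<bar>\<Phi> (t (Suc k)) - \<Phi> (t k)\<bar>)"
      using sum_abs[of "\<lambda>k. \<Phi> (t (Suc k)) - \<Phi> (t k)" "{..<n}"]
      by (simp add: sum_lessThan_telescope[of "\<lambda>k. \<Phi> (t k)"] t0 tn)
    ultimately show ?thesis by linarith
  qed
  then have le: "\<bar>\<Phi> b - \<Phi> a\<bar> \<le> e * \<bar>G b - G a\<bar>" if "e > 0" for e
    using that by (metis abs_ge_self mult_left_mono order_trans less_imp_le)
  have "\<bar>\<Phi> b - \<Phi> a\<bar> \<le> 0 + e" if "e > 0" for e
  proof -
    have "\<bar>\<Phi> b - \<Phi> a\<bar> \<le> e / (1 + \<bar>G b - G a\<bar>) * \<bar>G b - G a\<bar>"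
      using that by (intro le divide_pos_pos) auto
    also have "\<dots> \<le> e" using that by (simp add: field_simps)
    finally show ?thesis by simp
  qed
  then have "\<bar>\<Phi> b - \<Phi> a\<bar> \<le> 0" by (rule field_le_epsilon)
  then show ?thesis by simp
qed

text \<open>The chain rule for \<open>exp P\<close> in integrated form, with \<open>f\<close> merely
  integrable. On a short interval the defect consists of the oscillation of \<open>exp P\<close>
  against \<open>|f|\<close> and of a Taylor remainder quadratic in the increment of
  \<open>P\<close>; both are small multiples of the integral of \<open>|f|\<close>.\<close>

lemma has_integral_exp_primitive:
  fixes f :: "real \<Rightarrow> real"
  assumes ab: "a \<le> b" and f: "f absolutely_integrable_on {a..b}"
  defines "P \<equiv> \<lambda>u. integral {a..u} f"
  shows "((\<lambda>s. f s * exp (P s)) has_integral exp (P b) - 1) {a..b}"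
proof -
  have fi: "f integrable_on {a..b}" using f by (simp add: absolutely_integrable_on_def)
  have nf: "(\<lambda>s. \<bar>f s\<bar>) integrable_on {a..b}"
    using f by (simp add: absolutely_integrable_on_def)
  have P: "continuous_on {a..b} P" unfolding P_def by (rule indefinite_integral_continuous_1[OF fi])
  have E: "continuous_on {a..b} (\<lambda>s. exp (P s))" by (intro continuous_intros P)
  have "(\<lambda>s. exp (P s) * f s) absolutely_integrable_on {a..b}"
    by (rule absolutely_integrable_mult_continuous[OF f E])
  then have gi: "(\<lambda>s. f s * exp (P s)) integrable_on {a..b}"
    by (simp add: absolutely_integrable_on_def mult.commute)
  obtain C where "\<forall>x\<in>(\<lambda>s. exp (P s)) ` {a..b}. norm x \<le> C"
    using compact_imp_bounded[OF compact_continuous_image[OF E compact_Icc]] unfolding bounded_iff by blast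
  then have C: "exp (P s) \<le> C" if "s \<in> {a..b}" for s using that by force
  have C0: "C > 0" using C[of a] ab by (smt (verit) exp_gt_zero atLeastAtMost_iff)
  define \<Phi> where "\<Phi> u = integral {a..u} (\<lambda>s. f s * exp (P s)) - exp (P u)" for u
  have "\<Phi> b = \<Phi> a"
  proof (rule eq_if_increments_small[where G="\<lambda>u. integral {a..u} (\<lambda>s. \<bar>f s\<bar>)", OF ab])
    fix e :: real assume e: "e > 0"
    \<comment> \<open>\<open>e'\<close> is spent once on the oscillation of \<open>exp P\<close> and
      \<open>C\<close> times on the Taylor remainder, whence the denominator \<open>C + 1\<close>.
      The bound 1 keeps the exponent in the range of \<open>abs_exp_minus_linear_le\<close>.\<close>
    define e' where "e' = min 1 (e / (C + 1))"
    have e': "0 < e'" "e' \<le> 1" using e C0 by (auto simp: e'_def)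
    have "(C + 1) * e' \<le> (C + 1) * (e / (C + 1))" using C0 by (intro mult_left_mono) (auto simp: e'_def)
    then have e'': "(C + 1) * e' \<le> e" using C0 by simp
    have "uniformly_continuous_on {a..b} (\<lambda>s. exp (P s))" "uniformly_continuous_on {a..b} P"
      using compact_uniformly_continuous[OF E] compact_uniformly_continuous[OF P] by auto
    with e' obtain d1 d2 where d1: "d1 > 0" "\<And>s t. s \<in> {a..b} \<Longrightarrow> t \<in> {a..b} \<Longrightarrow> dist t s < d1 \<Longrightarrow> dist (exp (P t)) (exp (P s)) < e'"
      and d2: "d2 > 0" "\<And>s t. s \<in> {a..b} \<Longrightarrow> t \<in> {a..b} \<Longrightarrow> dist t s < d2 \<Longrightarrow> dist (P t) (P s) < e'"
      unfolding uniformly_continuous_on_def by metis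
    show "\<exists>d>0. \<forall>s t. a \<le> s \<longrightarrow> s \<le> t \<longrightarrow> t \<le> b \<longrightarrow> t - s < d \<longrightarrow>
       \<bar>\<Phi> t - \<Phi> s\<bar> \<le> e * (integral {a..t} (\<lambda>s. \<bar>f s\<bar>) - integral {a..s} (\<lambda>s. \<bar>f s\<bar>))"
    proof (intro exI[of _ "min d1 d2"] conjI allI impI)
      fix s t assume st: "a \<le> s" "s \<le> t" "t \<le> b" "t - s < min d1 d2"
      have split: "integral {a..t} h - integral {a..s} h = integral {s..t} h" if "h integrable_on {a..b}" for h :: "real \<Rightarrow> real"
        using Henstock_Kurzweil_Integration.integral_combine[of a s t h] integrable_subinterval_real[OF that, of a t] st by auto
      have sub: "h integrable_on {s..t}" if "h integrable_on {a..b}" for h :: "real \<Rightarrow> real"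
        using integrable_subinterval_real[OF that, of s t] st by auto
      define D where "D = P t - P s"
      define A where "A = integral {s..t} (\<lambda>s. \<bar>f s\<bar>)"
      have Dint: "D = integral {s..t} f" using split[OF fi] by (simp add: D_def P_def)
      have DA: "\<bar>D\<bar> \<le> A" unfolding Dint A_def
        using integral_norm_bound_integral[OF sub[OF fi] sub[OF nf]] by simp
      have D1: "\<bar>D\<bar> < e'" using d2(2)[of s t] st by (simp add: D_def dist_real_def)
      have "\<Phi> t - \<Phi> s = integral {s..t} (\<lambda>u. f u * exp (P u)) - (exp (P t) - exp (P s))"
        using split[OF gi] by (simp add: \<Phi>_def)
      also have "exp (P t) - exp (P s) = exp (P s) * (exp D - 1)"
        by (simp add: D_def exp_diff right_diff_distrib)
      also have "integral {s..t} (\<lambda>u. f u * exp (P u)) = integral {s..t} (\<lambda>u. f u * (exp (P u) - exp (P s))) + exp (P s) * D"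
      proof -
        have "integral {s..t} (\<lambda>u. f u * exp (P u) - f u * exp (P s)) = integral {s..t} (\<lambda>u. f u * exp (P u)) - integral {s..t} (\<lambda>u. f u * exp (P s))"
          by (intro Henstock_Kurzweil_Integration.integral_diff sub[OF gi] integrable_on_mult_left sub[OF fi])
        then show ?thesis by (simp add: Dint right_diff_distrib mult.commute)
      qed
      finally have eq: "\<Phi> t - \<Phi> s = integral {s..t} (\<lambda>u. f u * (exp (P u) - exp (P s))) - exp (P s) * (exp D - 1 - D)"
        by (simp add: algebra_simps)
      have "norm (integral {s..t} (\<lambda>u. f u * (exp (P u) - exp (P s)))) \<le> integral {s..t} (\<lambda>u. e' * \<bar>f u\<bar>)"
      proof (rule integral_norm_bound_integral)
        show "(\<lambda>u. f u * (exp (P u) - exp (P s))) integrable_on {s..t}"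
          unfolding right_diff_distrib by (intro integrable_diff sub[OF gi] integrable_on_mult_left sub[OF fi])
        show "(\<lambda>u. e' * \<bar>f u\<bar>) integrable_on {s..t}" by (intro integrable_on_mult_right sub[OF nf])
        fix u assume "u \<in> {s..t}"
        then have "\<bar>exp (P u) - exp (P s)\<bar> \<le> e'" using d1(2)[of s u] st by (simp add: dist_real_def)
        then show "norm (f u * (exp (P u) - exp (P s))) \<le> e' * \<bar>f u\<bar>"
          by (simp add: abs_mult mult.commute[of e'] mult_left_mono)
      qed
      then have 1: "\<bar>integral {s..t} (\<lambda>u. f u * (exp (P u) - exp (P s)))\<bar> \<le> e' * A" by (simp add: A_def)
      have "\<bar>exp D - 1 - D\<bar> \<le> D\<^sup>2" using D1 e' by (intro abs_exp_minus_linear_le) simp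
      also have "\<dots> = \<bar>D\<bar> * \<bar>D\<bar>" by (simp add: power2_eq_square)
      also have "\<dots> \<le> e' * A" using D1 DA e' by (intro mult_mono) auto
      finally have "\<bar>exp (P s) * (exp D - 1 - D)\<bar> \<le> C * (e' * A)"
        unfolding abs_mult using C[of s] st C0 by (intro mult_mono) auto
      with 1 have "\<bar>\<Phi> t - \<Phi> s\<bar> \<le> e' * A + C * (e' * A)" unfolding eq by linarith
      also have "\<dots> = ((C + 1) * e') * A" by (simp add: algebra_simps)
      also have "\<dots> \<le> e * A" using e'' DA by (intro mult_right_mono) auto
      finally show "\<bar>\<Phi> t - \<Phi> s\<bar> \<le> e * (integral {a..t} (\<lambda>s. \<bar>f s\<bar>) - integral {a..s} (\<lambda>s. \<bar>f s\<bar>))"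
        using split[OF nf] by (simp add: A_def)
    qed (use d1 d2 in auto)
  qed
  then have "integral {a..b} (\<lambda>s. f s * exp (P s)) = exp (P b) - 1"
    by (simp add: \<Phi>_def P_def)
  then show ?thesis using gi integrable_integral by fastforce
qed

lemma integrable_norm_diff_square:
  fixes f g :: "real \<Rightarrow> 'b::euclidean_space"
  assumes f: "f \<in> borel_measurable (lebesgue_on {a..b})" "(\<lambda>s. (norm (f s))\<^sup>2) integrable_on {a..b}"
    and g: "g \<in> borel_measurable (lebesgue_on {a..b})" "(\<lambda>s. (norm (g s))\<^sup>2) integrable_on {a..b}"
  shows "(\<lambda>s. (norm (f s - g s))\<^sup>2) integrable_on {a..b}"
    and "integral {a..b} (\<lambda>s. (norm (f s - g s))\<^sup>2) \<le>
      2 * integral {a..b} (\<lambda>s. (norm (f s))\<^sup>2) + 2 * integral {a..b} (\<lambda>s. (norm (g s))\<^sup>2)"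
proof -
  have le: "(norm (f s - g s))\<^sup>2 \<le> 2 * (norm (f s))\<^sup>2 + 2 * (norm (g s))\<^sup>2" for s
  proof -
    have "(norm (f s - g s))\<^sup>2 \<le> (norm (f s) + norm (g s))\<^sup>2"
      by (intro power_mono norm_triangle_ineq4) simp
    also have "\<dots> \<le> 2 * (norm (f s))\<^sup>2 + 2 * (norm (g s))\<^sup>2"
      using sum_squares_bound[of "norm (f s)" "norm (g s)"] by (simp add: power2_sum)
    finally show ?thesis .
  qed
  have int: "(\<lambda>s. 2 * (norm (f s))\<^sup>2 + 2 * (norm (g s))\<^sup>2) integrable_on {a..b}"
    using f g by (intro integrable_add integrable_on_mult_right) auto
  show 1: "(\<lambda>s. (norm (f s - g s))\<^sup>2) integrable_on {a..b}"
  proof (rule measurable_bounded_by_integrable_imp_integrable[OF _ int])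
    show "(\<lambda>s. (norm (f s - g s))\<^sup>2) \<in> borel_measurable (lebesgue_on {a..b})" using f(1) g(1) by measurable
  qed (use le in auto)
  have "integral {a..b} (\<lambda>s. (norm (f s - g s))\<^sup>2) \<le> integral {a..b} (\<lambda>s. 2 * (norm (f s))\<^sup>2 + 2 * (norm (g s))\<^sup>2)"
    by (rule integral_le[OF 1 int]) (rule le)
  also have "\<dots> = 2 * integral {a..b} (\<lambda>s. (norm (f s))\<^sup>2) + 2 * integral {a..b} (\<lambda>s. (norm (g s))\<^sup>2)"
    using f g by (subst Henstock_Kurzweil_Integration.integral_add) (auto intro: integrable_on_mult_right)
  finally show "integral {a..b} (\<lambda>s. (norm (f s - g s))\<^sup>2) \<le>
      2 * integral {a..b} (\<lambda>s. (norm (f s))\<^sup>2) + 2 * integral {a..b} (\<lambda>s. (norm (g s))\<^sup>2)" .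
qed

lemma tendsto_integral_norm_square_zero:
  fixes f :: "nat \<Rightarrow> real \<Rightarrow> 'b::euclidean_space"
  assumes f: "\<And>n. f n \<in> borel_measurable (lebesgue_on {a..b})"
    and h: "h integrable_on {a..b}" and le: "\<And>n s. s \<in> {a..b} \<Longrightarrow> (norm (f n s))\<^sup>2 \<le> h s"
    and N: "negligible N" and lim: "\<And>s. s \<in> {a..b} - N \<Longrightarrow> (\<lambda>n. f n s) \<longlonglongrightarrow> 0"
  shows "(\<lambda>n. integral {a..b} (\<lambda>s. (norm (f n s))\<^sup>2)) \<longlonglongrightarrow> 0"
    and "\<And>n. (\<lambda>s. (norm (f n s))\<^sup>2) integrable_on {a..b}"
proof -
  show int: "(\<lambda>s. (norm (f n s))\<^sup>2) integrable_on {a..b}" for n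
  proof (rule measurable_bounded_by_integrable_imp_integrable[OF _ h])
    show "(\<lambda>s. (norm (f n s))\<^sup>2) \<in> borel_measurable (lebesgue_on {a..b})" using f by measurable
  qed (use le in auto)
  \<comment> \<open>Convergence is known off \<open>N\<close> only; setting the integrand to 0 there
    makes it hold at every point and leaves the integrals unchanged.\<close>
  define F where "F n s = (if s \<in> N then 0 else (norm (f n s))\<^sup>2)" for n s
  have Fi: "F n integrable_on {a..b}" for n
    by (rule integrable_spike[OF int N]) (auto simp: F_def)
  have h0: "0 \<le> h s" if "s \<in> {a..b}" for s using le[OF that, of 0] by (meson order_trans zero_le_power2)
  have "(\<lambda>n. integral {a..b} (F n)) \<longlonglongrightarrow> integral {a..b} (\<lambda>s. 0)"
  proof (rule dominated_convergence(2)[OF Fi h])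
    fix n s assume s: "s \<in> {a..b}"
    show "norm (F n s) \<le> h s" using le[OF s] h0[OF s] by (simp add: F_def)
  next
    fix s assume s: "s \<in> {a..b}"
    have "(\<lambda>n. (norm (f n s))\<^sup>2) \<longlonglongrightarrow> 0" if "s \<notin> N"
      using tendsto_power[OF tendsto_norm[OF lim[of s]], of 2] s that by simp
    then show "(\<lambda>n. F n s) \<longlonglongrightarrow> 0" by (cases "s \<in> N") (simp_all add: F_def)
  qed
  moreover have "integral {a..b} (F n) = integral {a..b} (\<lambda>s. (norm (f n s))\<^sup>2)" for n
    by (rule integral_spike[OF N]) (auto simp: F_def)
  ultimately show "(\<lambda>n. integral {a..b} (\<lambda>s. (norm (f n s))\<^sup>2)) \<longlonglongrightarrow> 0" by simp
qed

text \<open>The radial contraction \<open>c n\<close> is continuous, bounded by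
  \<open>Suc n\<close>, and tends to the identity. Composed with \<theta> it gives an approximation
  by bounded functions. Composed with continuous functions that converge to \<theta> almost
  everywhere it provides the bound for a second use of dominated convergence.\<close>

lemma L2_continuous_approx:
  fixes \<theta> :: "real \<Rightarrow> 'b::euclidean_space"
  assumes \<theta>: "\<theta> \<in> borel_measurable (lebesgue_on {a..b})" "(\<lambda>s. (norm (\<theta> s))\<^sup>2) integrable_on {a..b}"
    and e: "e > 0"
  obtains g where "continuous_on UNIV g" "(\<lambda>s. (norm (\<theta> s - g s))\<^sup>2) integrable_on {a..b}"
    "integral {a..b} (\<lambda>s. (norm (\<theta> s - g s))\<^sup>2) < e"
proof -
  define c where "c n v = (real (Suc n) / (real (Suc n) + norm v)) *\<^sub>R v" for n and v :: 'b
  have cpos: "real (Suc n) + norm v > 0" for n and v :: 'b by (intro add_pos_nonneg) auto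
  have cc: "continuous_on UNIV (c n)" for n
    unfolding c_def using cpos[of n] by (intro continuous_intros) (auto simp: less_imp_neq[symmetric])
  have cb: "norm (c n v) \<le> real (Suc n)" for n v
  proof -
    have "norm (c n v) = real (Suc n) * (norm v / (real (Suc n) + norm v))"
      using cpos[of n v] by (simp add: c_def)
    also have "\<dots> \<le> real (Suc n) * 1" using cpos[of n v] by (intro mult_left_mono) (auto simp: divide_le_eq_1)
    finally show ?thesis by simp
  qed
  have cd: "v - c n v = (norm v / (real (Suc n) + norm v)) *\<^sub>R v" for n v
  proof -
    have "1 - real (Suc n) / (real (Suc n) + norm v) = norm v / (real (Suc n) + norm v)"
      using cpos[of n v] by (simp add: field_simps)
    then show ?thesis unfolding c_def by (metis scaleR_left_diff_distrib scaleR_one)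
  qed
  have cm: "(\<lambda>s. c n (f s)) \<in> borel_measurable (lebesgue_on {a..b})"
    if "f \<in> borel_measurable (lebesgue_on {a..b})" for n f
    using that borel_measurable_continuous_onI[OF cc[of n]] by (rule measurable_compose)
  have "(\<lambda>n. integral {a..b} (\<lambda>s. (norm (\<theta> s - c n (\<theta> s)))\<^sup>2)) \<longlonglongrightarrow> 0"
  proof (rule tendsto_integral_norm_square_zero(1)[OF _ \<theta>(2) _ negligible_empty])
    show "(\<lambda>s. \<theta> s - c n (\<theta> s)) \<in> borel_measurable (lebesgue_on {a..b})" for n
      using \<theta>(1) cm[OF \<theta>(1)] by measurable
    show "(norm (\<theta> s - c n (\<theta> s)))\<^sup>2 \<le> (norm (\<theta> s))\<^sup>2" for n s
    proof (rule power_mono)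
      have "norm (\<theta> s - c n (\<theta> s)) = (norm (\<theta> s) / (real (Suc n) + norm (\<theta> s))) * norm (\<theta> s)"
        using cpos[of n "\<theta> s"] by (simp add: cd)
      also have "\<dots> \<le> 1 * norm (\<theta> s)" using cpos[of n "\<theta> s"] by (intro mult_right_mono) (auto simp: divide_le_eq_1)
      finally show "norm (\<theta> s - c n (\<theta> s)) \<le> norm (\<theta> s)" by simp
    qed simp
    show "(\<lambda>n. \<theta> s - c n (\<theta> s)) \<longlonglongrightarrow> 0" for s
    proof -
      have "(\<lambda>n. norm (\<theta> s) / (real (Suc n) + norm (\<theta> s))) \<longlonglongrightarrow> 0" by real_asymp
      from tendsto_scaleR[OF this tendsto_const[of "\<theta> s"]] show ?thesis by (simp add: cd)
    qed
  qed
  moreover have "0 < e / 4" using e by simp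
  ultimately obtain K where K: "integral {a..b} (\<lambda>s. (norm (\<theta> s - c K (\<theta> s)))\<^sup>2) < e / 4"
    by (metis (lifting) order_tendstoD(2) eventually_happens trivial_limit_sequentially)
  have "\<theta> measurable_on {a..b}" using \<theta>(1) by (simp add: measurable_on_iff_borel_measurable)
  then obtain N g where N: "negligible N" and g: "\<And>n. continuous_on UNIV (g n)"
    and lim: "\<And>x. x \<notin> N \<Longrightarrow> (\<lambda>n. g n x) \<longlonglongrightarrow> (if x \<in> {a..b} then \<theta> x else 0)"
    unfolding measurable_on_def by blast
  have gm: "g n \<in> borel_measurable (lebesgue_on {a..b})" for n
    by (intro continuous_imp_measurable_on_sets_lebesgue continuous_on_subset[OF g]) auto
  have cgb: "norm (c K v - c K w) \<le> 2 * real (Suc K)" for v w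
    using order_trans[OF norm_triangle_ineq4 add_mono[OF cb cb], of K v K w] by simp
  have const: "(\<lambda>s. (2 * real (Suc K))\<^sup>2) integrable_on {a..b}" by (rule integrable_const_ivl)
  have dm: "(\<lambda>s. c K (\<theta> s) - c K (g n s)) \<in> borel_measurable (lebesgue_on {a..b})" for n
    using cm[OF \<theta>(1)] cm[OF gm] by measurable
  have dl: "(\<lambda>n. c K (\<theta> s) - c K (g n s)) \<longlonglongrightarrow> 0" if "s \<in> {a..b} - N" for s
  proof -
    have "isCont (c K) (\<theta> s)" using cc[of K] by (simp add: continuous_on_eq_continuous_at)
    moreover have "(\<lambda>n. g n s) \<longlonglongrightarrow> \<theta> s" using lim[of s] that by simp
    ultimately have "(\<lambda>n. c K (g n s)) \<longlonglongrightarrow> c K (\<theta> s)" by (rule isCont_tendsto_compose)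
    from tendsto_diff[OF tendsto_const[of "c K (\<theta> s)"] this] show ?thesis by simp
  qed
  have db: "(norm (c K (\<theta> s) - c K (g n s)))\<^sup>2 \<le> (2 * real (Suc K))\<^sup>2" for n s
    by (intro power_mono cgb) simp
  have "(\<lambda>n. integral {a..b} (\<lambda>s. (norm (c K (\<theta> s) - c K (g n s)))\<^sup>2)) \<longlonglongrightarrow> 0"
    by (rule tendsto_integral_norm_square_zero(1)[OF dm const db N dl])
  then obtain n where n: "integral {a..b} (\<lambda>s. (norm (c K (\<theta> s) - c K (g n s)))\<^sup>2) < e / 4"
    using \<open>0 < e / 4\<close> by (metis (lifting) order_tendstoD(2) eventually_happens trivial_limit_sequentially)
  have dint: "(\<lambda>s. (norm (c K (\<theta> s) - c K (g n s)))\<^sup>2) integrable_on {a..b}"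
    by (rule tendsto_integral_norm_square_zero(2)[OF dm const db N dl])
  have cint: "(\<lambda>s. (norm (c K (f s)))\<^sup>2) integrable_on {a..b}" if "f \<in> borel_measurable (lebesgue_on {a..b})" for f
  proof (rule measurable_bounded_by_integrable_imp_integrable[of _ _ "\<lambda>_. (real (Suc K))\<^sup>2"])
    show "(\<lambda>s. (norm (c K (f s)))\<^sup>2) \<in> borel_measurable (lebesgue_on {a..b})" using cm[OF that] by measurable
    show "norm ((norm (c K (f s)))\<^sup>2) \<le> (real (Suc K))\<^sup>2" for s
      using power_mono[OF cb[of K "f s"], of 2] by simp
  qed auto
  have tint: "(\<lambda>s. (norm (\<theta> s - c K (\<theta> s)))\<^sup>2) integrable_on {a..b}"
    by (rule integrable_norm_diff_square(1)[OF \<theta> cm[OF \<theta>(1)] cint[OF \<theta>(1)]])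
  have tm: "(\<lambda>s. \<theta> s - c K (\<theta> s)) \<in> borel_measurable (lebesgue_on {a..b})"
    using \<theta>(1) cm[OF \<theta>(1)] by measurable
  \<comment> \<open>The sign is reversed so that the estimate for a difference, applied to the two
    approximation errors, bounds their sum.\<close>
  have dm': "(\<lambda>s. - (c K (\<theta> s) - c K (g n s))) \<in> borel_measurable (lebesgue_on {a..b})"
    using dm by measurable
  have eq: "\<theta> s - c K (\<theta> s) - (- (c K (\<theta> s) - c K (g n s))) = \<theta> s - c K (g n s)" for s by simp
  have dint': "(\<lambda>s. (norm (- (c K (\<theta> s) - c K (g n s))))\<^sup>2) integrable_on {a..b}"
    unfolding norm_minus_cancel by (rule dint)
  note R = integrable_norm_diff_square[OF tm tint dm' dint', unfolded eq norm_minus_cancel]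
  show ?thesis
  proof (rule that[OF _ R(1)])
    show "continuous_on UNIV (\<lambda>s. c K (g n s))"
      by (rule continuous_on_compose2[OF cc g]) auto
    show "integral {a..b} (\<lambda>s. (norm (\<theta> s - c K (g n s)))\<^sup>2) < e" using R(2) K n by linarith
  qed
qed

text \<open>The number of cells is a multiple of \<open>p\<close>, so that each
  \<open>j * T / p\<close> is a grid point. The last conclusion keeps the variance of every single
  step small, which the Euler defect requires.\<close>

lemma L2_step_approx:
  fixes \<theta> :: "real \<Rightarrow> 'b::euclidean_space"
  assumes T: "T > 0" and p: "p > 0"
    and \<theta>: "\<theta> \<in> borel_measurable (lebesgue_on {0..T})" "(\<lambda>s. (norm (\<theta> s))\<^sup>2) integrable_on {0..T}"
    and e: "e > 0"
  obtains L l where "L > 0" "1 / e \<le> real (p * L)"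
    "(\<Sum>k<p * L. integral {real k * T / real (p * L)..real (Suc k) * T / real (p * L)} (\<lambda>s. (norm (\<theta> s - l k))\<^sup>2)) < e"
    "\<And>k. k < p * L \<Longrightarrow> (norm (l k))\<^sup>2 * (T / real (p * L)) < e"
proof -
  obtain g where g: "continuous_on UNIV g" "(\<lambda>s. (norm (\<theta> s - g s))\<^sup>2) integrable_on {0..T}"
    "integral {0..T} (\<lambda>s. (norm (\<theta> s - g s))\<^sup>2) < e / 4"
    using L2_continuous_approx[OF \<theta>, of "e / 4"] e by auto
  have g': "continuous_on {0..T} g" using g(1) continuous_on_subset by blast
  obtain C where C: "\<And>s. s \<in> {0..T} \<Longrightarrow> norm (g s) \<le> C" "C > 0"
    using compact_imp_bounded[OF compact_continuous_image[OF g' compact_Icc]] unfolding bounded_pos by force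
  \<comment> \<open>With this value the oscillation of \<open>g\<close> costs
    \<open>2 * \<kappa>\<^sup>2 * T = e / 4\<close>, next to \<open>e / 2\<close> for replacing
    \<theta> by \<open>g\<close>.\<close>
  define \<kappa> where "\<kappa> = sqrt (e / (8 * T))"
  have \<kappa>: "\<kappa> > 0" "\<kappa>\<^sup>2 = e / (8 * T)" using e T by (auto simp: \<kappa>_def)
  obtain d where d: "d > 0" "\<And>s t. s \<in> {0..T} \<Longrightarrow> t \<in> {0..T} \<Longrightarrow> dist t s < d \<Longrightarrow> dist (g t) (g s) < \<kappa>"
    using compact_uniformly_continuous[OF g'] \<kappa> unfolding uniformly_continuous_on_def by (metis compact_Icc)
  obtain L :: nat where L: "1 / e + T / d + C\<^sup>2 * T / e < real L" using reals_Archimedean2 by blast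
  have pos: "0 \<le> 1 / e" "0 \<le> T / d" "0 \<le> C\<^sup>2 * T / e" using e T d by auto
  have L0: "L > 0" using L pos by linarith
  define N where "N = p * L"
  have "real L \<le> real N" unfolding N_def of_nat_le_iff using p by (cases p) auto
  then have N: "1 / e \<le> real N" "T / d < real N" "C\<^sup>2 * T / e < real N" using L pos by linarith+
  have N0: "N > 0" using p L0 by (simp add: N_def)
  have Td: "T / real N < d" using N(2) N0 d by (simp add: field_simps)
  have CN: "C\<^sup>2 * (T / real N) < e" using N(3) N0 e by (simp add: field_simps)
  define t where "t k = real k * T / real N" for k
  have tS: "t (Suc k) - t k = T / N" for k by (simp only: t_def of_nat_Suc distrib_right add_divide_distrib)
  have TN: "0 < T / N" using T N0 by simp
  have t_le: "t k \<le> t (Suc k)" for k using tS[of k] TN by linarith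
  have t0: "t 0 = 0" and tN: "t N = T" using N0 by (auto simp: t_def)
  have mono: "t i \<le> t j" if "i \<le> j" for i j by (rule lift_Suc_mono_le[of t, OF t_le that])
  define l where "l k = g (t k)" for k
  have tin: "t k \<in> {0..T}" if "k \<le> N" for k using mono[of 0 k] mono[of k N] that t0 tN by auto
  have "(norm (l k))\<^sup>2 * (T / real N) < e" if "k < N" for k
  proof -
    have "(norm (l k))\<^sup>2 * (T / real N) \<le> C\<^sup>2 * (T / real N)"
      unfolding l_def using TN C(1)[OF tin[of k]] that by (intro mult_right_mono power_mono) auto
    then show ?thesis using CN by linarith
  qed
  moreover have "(\<Sum>k<N. integral {t k..t (Suc k)} (\<lambda>s. (norm (\<theta> s - l k))\<^sup>2)) < e"
  proof -
    have "integral {t k..t (Suc k)} (\<lambda>s. (norm (\<theta> s - l k))\<^sup>2) \<le>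
      integral {t k..t (Suc k)} (\<lambda>s. 2 * (norm (\<theta> s - g s))\<^sup>2 + 2 * \<kappa>\<^sup>2)" if k: "k < N" for k
    proof (rule integral_le)
      have sub: "{t k..t (Suc k)} \<subseteq> {0..T}" using tin[of k] tin[of "Suc k"] k by auto
      have \<theta>k: "\<theta> \<in> borel_measurable (lebesgue_on {t k..t (Suc k)})"
        using \<theta>(1) sub by (rule measurable_restrict_mono)
      show "(\<lambda>s. (norm (\<theta> s - l k))\<^sup>2) integrable_on {t k..t (Suc k)}"
      proof (rule integrable_norm_diff_square(1)[where f=\<theta> and g="\<lambda>_. l k"])
        show "(\<lambda>s. (norm (\<theta> s))\<^sup>2) integrable_on {t k..t (Suc k)}"
          using \<theta>(2) sub by (rule integrable_subinterval_real)
      qed (auto intro: integrable_const_ivl \<theta>k)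
      show "(\<lambda>s. 2 * (norm (\<theta> s - g s))\<^sup>2 + 2 * \<kappa>\<^sup>2) integrable_on {t k..t (Suc k)}"
        by (intro integrable_add integrable_on_mult_right integrable_subinterval_real[OF g(2) sub]) auto
      fix s assume s: "s \<in> {t k..t (Suc k)}"
      have "dist s (t k) < d" using s tS[of k] Td by (simp add: dist_real_def)
      then have "norm (g s - l k) < \<kappa>" using d(2)[of "t k" s] s sub tin[of k] k by (auto simp: l_def dist_norm)
      then have "(norm (g s - l k))\<^sup>2 \<le> \<kappa>\<^sup>2" by (intro power_mono) auto
      moreover have "(norm (\<theta> s - l k))\<^sup>2 \<le> (norm (\<theta> s - g s) + norm (g s - l k))\<^sup>2"
        using norm_triangle_ineq[of "\<theta> s - g s" "g s - l k"] by (intro power_mono) auto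
      moreover have "\<dots> \<le> 2 * (norm (\<theta> s - g s))\<^sup>2 + 2 * (norm (g s - l k))\<^sup>2"
        using sum_squares_bound[of "norm (\<theta> s - g s)" "norm (g s - l k)"] by (simp add: power2_sum)
      ultimately show "(norm (\<theta> s - l k))\<^sup>2 \<le> 2 * (norm (\<theta> s - g s))\<^sup>2 + 2 * \<kappa>\<^sup>2" by linarith
    qed
    then have "(\<Sum>k<N. integral {t k..t (Suc k)} (\<lambda>s. (norm (\<theta> s - l k))\<^sup>2)) \<le>
      (\<Sum>k<N. integral {t k..t (Suc k)} (\<lambda>s. 2 * (norm (\<theta> s - g s))\<^sup>2 + 2 * \<kappa>\<^sup>2))"
      by (intro sum_mono) auto
    also have "\<dots> = integral {t 0..t N} (\<lambda>s. 2 * (norm (\<theta> s - g s))\<^sup>2 + 2 * \<kappa>\<^sup>2)"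
      by (rule sum_integral_grid[of t, OF t_le])
        (unfold t0 tN, intro integrable_add integrable_on_mult_right g(2) integrable_const_ivl)
    also have "\<dots> = 2 * integral {0..T} (\<lambda>s. (norm (\<theta> s - g s))\<^sup>2) + 2 * \<kappa>\<^sup>2 * T"
      unfolding t0 tN using T
      by (subst Henstock_Kurzweil_Integration.integral_add) (auto intro!: integrable_on_mult_right g(2))
    also have "\<dots> < 2 * (e / 4) + 2 * \<kappa>\<^sup>2 * T" using g(3) by simp
    also have "\<dots> \<le> e" unfolding \<kappa>(2) using T e by (simp add: field_simps)
    finally show ?thesis .
  qed
  ultimately show ?thesis using L0 N(1) that[of L l] unfolding N_def t_def by blast
qed

section \<open>Discrete stochastic integrals and recursions\<close>

text \<open>The inequality \<open>g 0 \<le> g L\<close> is part of the induction because gluing the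
  integrals over adjacent intervals uses it.\<close>

lemma has_integral_step:
  fixes g :: "nat \<Rightarrow> real" and G :: "real \<Rightarrow> real"
  assumes g: "\<And>i. i < L \<Longrightarrow> g i < g (Suc i)"
    and G: "\<And>i s. i < L \<Longrightarrow> g i \<le> s \<Longrightarrow> s < g (Suc i) \<Longrightarrow> G s = c i"
  shows "(G has_integral (\<Sum>i<L. c i * (g (Suc i) - g i))) {g 0..g L} \<and> g 0 \<le> g L"
  using assms
proof (induction L)
  case (Suc L)
  have IH: "(G has_integral (\<Sum>i<L. c i * (g (Suc i) - g i))) {g 0..g L}" "g 0 \<le> g L"
    using Suc by auto
  have lt: "g L < g (Suc L)" using Suc.prems(1) by simp
  have "((\<lambda>_. c L) has_integral c L * (g (Suc L) - g L)) {g L..g (Suc L)}"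
    using has_integral_const_real[of "c L" "g L" "g (Suc L)"] lt by (simp add: mult.commute)
  then have "(G has_integral c L * (g (Suc L) - g L)) {g L..g (Suc L)}"
    by (rule has_integral_spike_finite[rotated 2, of _ _ _ "{g (Suc L)}"]) (use Suc.prems(2)[of L] in auto)
  from has_integral_combine[OF IH(2) _ IH(1) this] lt show ?case using IH(2) by auto
qed (simp add: has_integral_refl)

lemma sum_if_between:
  fixes f :: "nat \<Rightarrow> 'b::ab_group_add" and g :: "nat \<Rightarrow> real"
  assumes g: "\<And>i j. i < j \<Longrightarrow> j \<le> L \<Longrightarrow> g i < g j" and pq: "p \<le> q" "q \<le> L"
  shows "(\<Sum>i<L. if g p \<le> g i \<and> g i < g q then f (Suc i) - f i else 0) = f q - f p"
proof -
  have le: "g i \<le> g j \<longleftrightarrow> i \<le> j" if "i \<le> L" "j \<le> L" for i j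
    using g[of i j] g[of j i] that by (cases i j rule: linorder_cases) auto
  have "(\<Sum>i<L. if g p \<le> g i \<and> g i < g q then f (Suc i) - f i else 0) =
        (\<Sum>i<L. if i \<in> {p..<q} then f (Suc i) - f i else 0)"
    using pq le[of p] le[of q] le[of _ q] by (intro sum.cong refl if_cong) (auto simp: not_le[symmetric])
  also have "\<dots> = (\<Sum>i\<in>{..<L} \<inter> {p..<q}. f (Suc i) - f i)" by (simp add: sum.inter_restrict)
  also have "{..<L} \<inter> {p..<q} = {p..<q}" using pq by auto
  also have "(\<Sum>i\<in>{p..<q}. f (Suc i) - f i) = f q - f p" by (rule sum_Suc_diff'[OF pq(1)])
  finally show ?thesis .
qed

text \<open>Once the breakpoints of the step process and the points of \<open>S\<close> lie in one
  grid, the truncations by \<open>min\<close> in \<open>step_int\<close> disappear: up to a grid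
  time the integral is a sum over whole cells, with integrands known at the left endpoints.\<close>

lemma (in brownian) step_common_refinement:
  fixes \<xi> :: "nat \<Rightarrow> 'a \<Rightarrow> real^'m"
  assumes simple: "simple_adapted M F T ts \<xi>" and S: "finite S" "S \<subseteq> {0..T}"
  obtains L g where "\<And>i j. i < j \<Longrightarrow> j \<le> L \<Longrightarrow> g i < g j" "g 0 = 0" "g L = T" "S \<subseteq> g ` {..L}"
    "\<And>i. i \<le> L \<Longrightarrow> g i \<in> {0..T}"
    "\<And>i. i < L \<Longrightarrow> step_proc ts \<xi> (g i) \<in> borel_measurable (F (g i))"
    "\<And>i s \<omega>. i < L \<Longrightarrow> g i \<le> s \<Longrightarrow> s < g (Suc i) \<Longrightarrow> step_proc ts \<xi> s \<omega> = step_proc ts \<xi> (g i) \<omega>"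
    "\<And>u \<omega>. u \<in> g ` {..L} \<Longrightarrow> step_int ts \<xi> W u \<omega> =
       (\<Sum>i<L. if g i < u then step_proc ts \<xi> (g i) \<omega> \<bullet> (W (g (Suc i)) \<omega> - W (g i) \<omega>) else 0)"
proof -
  have ts: "2 \<le> length ts" "hd ts = 0" "last ts = T" "sorted_wrt (<) ts"
    "\<And>j. j < length ts - 1 \<Longrightarrow> \<xi> j \<in> borel_measurable (F (ts ! j))"
    using simple by (auto simp: simple_adapted_def)
  have ts_le: "ts ! i \<le> ts ! j" if "i \<le> j" "j < length ts" for i j
    using sorted_wrt_nth_less[OF ts(4), of i j] that by (cases "i = j") auto
  have ts0: "ts ! 0 = 0" using ts(1,2) by (metis hd_conv_nth list.size(3) not_numeral_le_zero)
  have tsl: "ts ! (length ts - 1) = T" using ts(1,3) by (metis last_conv_nth list.size(3) not_numeral_le_zero)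
  have ts_in: "v \<in> {0..T}" if v: "v \<in> set ts" for v
  proof -
    from v obtain j where j: "j < length ts" "v = ts ! j" by (auto simp: in_set_conv_nth)
    then show ?thesis using ts_le[of 0 j] ts_le[of j "length ts - 1"] ts0 tsl ts(1) by auto
  qed
  have "0 < length ts" "length ts - 1 < length ts" using ts(1) by linarith+
  then have "ts ! 0 \<in> set ts" "ts ! (length ts - 1) \<in> set ts" by (auto intro: nth_mem)
  then have 0: "0 \<in> set ts" "T \<in> set ts" using ts0 tsl by auto
  define Q where "Q = set ts \<union> S"
  have Q: "finite Q" "Q \<subseteq> {0..T}" "0 \<in> Q" "T \<in> Q" using S ts_in 0 by (auto simp: Q_def)
  define P where "P = sorted_list_of_set Q"
  have setP: "set P = Q" and sP: "sorted_wrt (<) P" using Q by (auto simp: P_def)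
  define L where "L = length P - 1"
  have lP: "length P = Suc L" using setP Q by (cases P) (auto simp: L_def)
  define g where "g i = P ! i" for i
  have g_less: "g i < g j" if "i < j" "j \<le> L" for i j
    using sorted_wrt_nth_less[OF sP] that lP by (simp add: g_def)
  have gQ: "g i \<in> Q" if "i \<le> L" for i using that lP setP nth_mem[of i P] by (simp add: g_def)
  have Qg: "\<exists>i\<le>L. v = g i" if "v \<in> Q" for v
    using that setP lP by (auto simp: g_def in_set_conv_nth[of v P, unfolded setP] less_Suc_eq_le)
  have gT: "g i \<in> {0..T}" if "i \<le> L" for i using gQ[OF that] Q by auto
  have g_le: "g i \<le> g j \<longleftrightarrow> i \<le> j" if "i \<le> L" "j \<le> L" for i j
    using g_less[of i j] g_less[of j i] that by (cases i j rule: linorder_cases) auto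
  have g0: "g 0 = 0"
  proof -
    from Qg[OF Q(3)] obtain i where "i \<le> L" "0 = g i" by auto
    then show ?thesis using g_le[of 0 i] gT[of 0] by auto
  qed
  have gL: "g L = T"
  proof -
    from Qg[OF Q(4)] obtain i where "i \<le> L" "T = g i" by auto
    then show ?thesis using g_le[of i L] gT[of L] by auto
  qed
  \<comment> \<open>No point of \<open>Q\<close> lies strictly inside a cell, so comparisons with
    points of \<open>Q\<close> give the same answer throughout the cell.\<close>
  have nogap: "v \<le> g i \<longleftrightarrow> v \<le> s" if "v \<in> Q" "i < L" "g i \<le> s" "s < g (Suc i)" for v i s
  proof -
    from Qg[OF that(1)] obtain m where m: "m \<le> L" "v = g m" by auto
    then show ?thesis using g_le[of m i] g_le[of "Suc i" m] that by auto
  qed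
  have tsQ: "ts ! j \<in> Q" if "j < length ts" for j using that by (auto simp: Q_def)
  have const: "step_proc ts \<xi> s \<omega> = step_proc ts \<xi> (g i) \<omega>" if "i < L" "g i \<le> s" "s < g (Suc i)" for i s \<omega>
    unfolding step_proc_def
  proof (intro sum.cong refl)
    fix j assume "j \<in> {..<length ts - 1}"
    then have "indicator {ts ! j ..< ts ! (j + 1)} s = (indicator {ts ! j ..< ts ! (j + 1)} (g i) :: real)"
      using nogap[OF tsQ[of j] that] nogap[OF tsQ[of "j + 1"] that]
      by (auto simp: indicator_def not_le[symmetric])
    then show "indicator {ts ! j ..< ts ! (j + 1)} s *\<^sub>R \<xi> j \<omega> =
       indicator {ts ! j ..< ts ! (j + 1)} (g i) *\<^sub>R \<xi> j \<omega>" by simp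
  qed
  have meas: "step_proc ts \<xi> (g i) \<in> borel_measurable (F (g i))" if "i < L" for i
  proof -
    have "(\<lambda>\<omega>. indicator {ts ! j ..< ts ! (j + 1)} (g i) *\<^sub>R \<xi> j \<omega>) \<in> borel_measurable (F (g i))"
      if j: "j < length ts - 1" for j
    proof (cases "ts ! j \<le> g i")
      case True
      then have "\<xi> j \<in> borel_measurable (F (g i))" using ts(5)[OF j] measurable_F_mono by blast
      then show ?thesis by measurable
    qed (simp add: indicator_def)
    then have "(\<lambda>\<omega>. \<Sum>j<length ts - 1. indicator {ts ! j ..< ts ! (j + 1)} (g i) *\<^sub>R \<xi> j \<omega>) \<in> borel_measurable (F (g i))"
      by (intro borel_measurable_sum) auto
    then show ?thesis by (simp add: step_proc_def[abs_def])
  qed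
  have int: "step_int ts \<xi> W u \<omega> =
       (\<Sum>i<L. if g i < u then step_proc ts \<xi> (g i) \<omega> \<bullet> (W (g (Suc i)) \<omega> - W (g i) \<omega>) else 0)"
    if u: "u \<in> g ` {..L}" for u \<omega>
  proof -
    let ?d = "\<lambda>i. W (g (Suc i)) \<omega> - W (g i) \<omega>"
    have uQ: "u \<in> Q" using u gQ by auto
    have "\<xi> j \<omega> \<bullet> (W (min (ts ! (j + 1)) u) \<omega> - W (min (ts ! j) u) \<omega>) =
       (\<Sum>i<L. if g i < u then (indicator {ts ! j ..< ts ! (j + 1)} (g i) *\<^sub>R \<xi> j \<omega>) \<bullet> ?d i else 0)"
      if j: "j < length ts - 1" for j
    proof -
      let ?a = "ts ! j" and ?b = "ts ! (j + 1)"
      have ab: "?a < ?b" using sorted_wrt_nth_less[OF ts(4), of j "j + 1"] j by auto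
      have "min ?a u \<in> Q" "min ?b u \<in> Q" using tsQ[of j] tsQ[of "j + 1"] uQ j by (auto simp: min_def)
      then obtain p q where pq: "p \<le> L" "min ?a u = g p" "q \<le> L" "min ?b u = g q" using Qg by metis
      have "g p \<le> g q" unfolding pq(2,4)[symmetric] using ab by (auto simp: min_def)
      then have "p \<le> q" using g_le pq by auto
      have "(\<Sum>i<L. if g i < u then (indicator {?a ..< ?b} (g i) *\<^sub>R \<xi> j \<omega>) \<bullet> ?d i else 0)
         = (\<Sum>i<L. \<xi> j \<omega> \<bullet> (if g p \<le> g i \<and> g i < g q then ?d i else 0))"
        unfolding pq(2,4)[symmetric] using ab by (intro sum.cong) (auto simp: indicator_def min_def)
      also have "\<dots> = \<xi> j \<omega> \<bullet> (\<Sum>i<L. if g p \<le> g i \<and> g i < g q then ?d i else 0)"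
        by (simp add: inner_sum_right)
      also have "(\<Sum>i<L. if g p \<le> g i \<and> g i < g q then ?d i else 0) = W (g q) \<omega> - W (g p) \<omega>"
        by (rule sum_if_between[of L g p q "\<lambda>i. W (g i) \<omega>", OF g_less \<open>p \<le> q\<close> pq(3)])
      finally show ?thesis unfolding pq(2,4) by simp
    qed
    then have "step_int ts \<xi> W u \<omega> =
       (\<Sum>j<length ts - 1. \<Sum>i<L. if g i < u then (indicator {ts ! j ..< ts ! (j + 1)} (g i) *\<^sub>R \<xi> j \<omega>) \<bullet> ?d i else 0)"
      unfolding step_int_def by (intro sum.cong) auto
    also have "\<dots> = (\<Sum>i<L. \<Sum>j<length ts - 1. if g i < u then (indicator {ts ! j ..< ts ! (j + 1)} (g i) *\<^sub>R \<xi> j \<omega>) \<bullet> ?d i else 0)"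
      by (rule sum.swap)
    also have "\<dots> = (\<Sum>i<L. if g i < u then step_proc ts \<xi> (g i) \<omega> \<bullet> ?d i else 0)"
      by (intro sum.cong refl) (auto simp: step_proc_def inner_sum_left)
    finally show ?thesis .
  qed
  show ?thesis
  proof (rule that[of L g])
    show "S \<subseteq> g ` {..L}" using Qg by (force simp: Q_def)
  qed (rule g_less g0 gL gT meas const int; assumption)+
qed

text \<open>The mixed term \<open>e * P\<close> is kept since its expectation will vanish. As
  \<open>n\<close> and \<open>P\<close> may be dependent, \<open>e * n * P\<close> is absorbed into
  \<open>e\<^sup>2 * n\<^sup>2 + P\<^sup>2\<close>. The remainder \<open>D\<close>, which may be
  correlated with everything, is split off by Young's inequality with weight
  \<open>c\<close>.\<close>

lemma quadratic_step_bound: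
  fixes e n P D c d :: real
  assumes c: "c > 0" and D: "\<bar>D\<bar> \<le> d"
  shows "(e * (1 - n) + P + D)\<^sup>2 \<le> (1 + c) * (e\<^sup>2 * (1 - n)\<^sup>2 + 2 * (e * P) + e\<^sup>2 * n\<^sup>2 + 2 * P\<^sup>2) + (1 + 1 / c) * d\<^sup>2"
proof -
  let ?A = "e * (1 - n) + P"
  have "?A\<^sup>2 = e\<^sup>2 * (1 - n)\<^sup>2 + 2 * (e * P) - 2 * (e * n) * P + P\<^sup>2"
    by (simp add: power2_eq_square algebra_simps)
  moreover have "0 \<le> (e * n + P)\<^sup>2" by simp
  ultimately have A: "?A\<^sup>2 \<le> e\<^sup>2 * (1 - n)\<^sup>2 + 2 * (e * P) + e\<^sup>2 * n\<^sup>2 + 2 * P\<^sup>2"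
    by (simp add: power2_eq_square algebra_simps)
  have "(A + D)\<^sup>2 \<le> (1 + c) * A\<^sup>2 + (1 + 1 / c) * D\<^sup>2" for A
  proof -
    have "0 \<le> (c * A - D)\<^sup>2 / c" using c by simp
    also have "(c * A - D)\<^sup>2 / c = c * A\<^sup>2 - 2 * A * D + (1 / c) * D\<^sup>2"
      using c by (simp add: power2_eq_square field_simps)
    finally show ?thesis by (simp add: power2_sum distrib_right)
  qed
  from this[of ?A] have "(?A + D)\<^sup>2 \<le> (1 + c) * ?A\<^sup>2 + (1 + 1 / c) * D\<^sup>2" .
  moreover have "D\<^sup>2 \<le> d\<^sup>2" using power_mono[OF D, of 2] by simp
  ultimately show ?thesis using A c
    by (smt (verit) mult_left_mono divide_nonneg_pos)
qed

lemma discrete_gronwall: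
  fixes a b c :: "nat \<Rightarrow> real"
  assumes a0: "a 0 \<le> 0" and step: "\<And>k. k < n \<Longrightarrow> a (Suc k) \<le> exp (c k) * a k + b k"
    and b: "\<And>k. 0 \<le> b k" and c: "\<And>k. 0 \<le> c k"
  shows "a n \<le> exp (\<Sum>k<n. c k) * (\<Sum>k<n. b k)"
  using step
proof (induction n)
  case (Suc n)
  have "a (Suc n) \<le> exp (c n) * a n + b n" using Suc.prems by simp
  also have "\<dots> \<le> exp (c n) * (exp (\<Sum>k<n. c k) * (\<Sum>k<n. b k)) + exp (c n + (\<Sum>k<n. c k)) * b n"
  proof (rule add_mono)
    show "exp (c n) * a n \<le> exp (c n) * (exp (\<Sum>k<n. c k) * (\<Sum>k<n. b k))"
      using Suc by (intro mult_left_mono) auto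
    have "1 * b n \<le> exp (c n + (\<Sum>k<n. c k)) * b n"
      using b c by (intro mult_right_mono) (auto intro!: add_nonneg_nonneg sum_nonneg)
    then show "b n \<le> exp (c n + (\<Sum>k<n. c k)) * b n" by simp
  qed
  also have "\<dots> = exp (\<Sum>k<Suc n. c k) * (\<Sum>k<Suc n. b k)"
    by (simp add: exp_add algebra_simps)
  finally show ?case .
qed (use a0 in simp)

lemma sum_stopped_le:
  fixes v :: "nat \<Rightarrow> real"
  assumes v: "\<And>i. 0 \<le> v i" and \<delta>: "0 \<le> \<delta>"
  shows "(\<Sum>i<n. if (\<Sum>j\<le>i. v j) \<le> \<delta> then v i else 0) \<le> \<delta>"
proof (induction n)
  case (Suc n)
  show ?case
  proof (cases "(\<Sum>j\<le>n. v j) \<le> \<delta>")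
    case True
    have "(\<Sum>i<Suc n. if (\<Sum>j\<le>i. v j) \<le> \<delta> then v i else 0) \<le> (\<Sum>i<Suc n. v i)"
      by (intro sum_mono) (use v in auto)
    then show ?thesis using True by (simp add: lessThan_Suc_atMost)
  next
    case False
    then show ?thesis using Suc by simp
  qed
qed (use \<delta> in simp)

section \<open>Mean-square estimates for one step and for blocks of cells\<close>

context brownian
begin

lemma integrable_mult_of_squares:
  fixes X Y :: "'a \<Rightarrow> real"
  assumes [measurable]: "X \<in> borel_measurable M" "Y \<in> borel_measurable M"
    and int: "integrable M (\<lambda>\<omega>. (X \<omega>)\<^sup>2)" "integrable M (\<lambda>\<omega>. (Y \<omega>)\<^sup>2)"
  shows "integrable M (\<lambda>\<omega>. X \<omega> * Y \<omega>)"
proof (rule Bochner_Integration.integrable_bound[OF Bochner_Integration.integrable_add[OF int]])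
  have "\<bar>x * y\<bar> \<le> x\<^sup>2 + y\<^sup>2" for x y :: real
  proof -
    have "0 \<le> (\<bar>x\<bar> - \<bar>y\<bar>)\<^sup>2" by simp
    then have "2 * \<bar>x * y\<bar> \<le> x\<^sup>2 + y\<^sup>2" by (simp add: power2_diff abs_mult)
    then show ?thesis by linarith
  qed
  then show "AE \<omega> in M. norm (X \<omega> * Y \<omega>) \<le> norm ((X \<omega>)\<^sup>2 + (Y \<omega>)\<^sup>2)" by (auto intro!: AE_I2)
qed measurable

text \<open>The expectation of \<open>quadratic_step_bound\<close>: the multiplier
  \<open>1 - l \<bullet> dW\<close> contributes \<open>1 + h\<close> and the absorbed cross term
  another \<open>h\<close>, which gives \<open>1 + 2 * h\<close>.\<close>

lemma euler_step_bound:
  fixes l :: "real^'m"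
  assumes st: "0 \<le> s" "s < t" and e: "e \<in> borel_measurable (F s)" "integrable M (\<lambda>\<omega>. (e \<omega>)\<^sup>2)"
    and P: "P \<in> borel_measurable M" "integrable M (\<lambda>\<omega>. (P \<omega>)\<^sup>2)" "expectation (\<lambda>\<omega>. e \<omega> * P \<omega>) = 0"
    and D: "D \<in> borel_measurable M" "\<And>\<omega>. \<bar>D \<omega>\<bar> \<le> d" and c: "c > 0"
  defines "h \<equiv> (norm l)\<^sup>2 * (t - s)"
  defines "Z \<equiv> \<lambda>\<omega>. e \<omega> * (1 - l \<bullet> (W t \<omega> - W s \<omega>)) + P \<omega> + D \<omega>"
  shows "integrable M (\<lambda>\<omega>. (Z \<omega>)\<^sup>2)"
    and "expectation (\<lambda>\<omega>. (Z \<omega>)\<^sup>2) \<le> (1 + c) * ((1 + 2 * h) * expectation (\<lambda>\<omega>. (e \<omega>)\<^sup>2) + 2 * expectation (\<lambda>\<omega>. (P \<omega>)\<^sup>2)) + (1 + 1 / c) * d\<^sup>2"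
proof -
  let ?n = "\<lambda>\<omega>. l \<bullet> (W t \<omega> - W s \<omega>)"
  have eM [measurable]: "e \<in> borel_measurable M" using e measurable_F_M by blast
  have [measurable]: "W s \<in> borel_measurable M" "W t \<in> borel_measurable M" using st by (auto intro: W_measurable_M)
  note [measurable] = P(1) D(1)
  have h0: "0 \<le> (norm l)\<^sup>2 * (t - s)" using st by simp
  have eF: "(\<lambda>\<omega>. (e \<omega>)\<^sup>2) \<in> borel_measurable (F s)" using e(1) by measurable
  have 1: "has_bochner_integral M (\<lambda>\<omega>. (e \<omega>)\<^sup>2 * (1 - ?n \<omega>)\<^sup>2) (expectation (\<lambda>\<omega>. (e \<omega>)\<^sup>2) * (1 + h))"
    unfolding h_def by (rule has_bochner_integral_mult_incr[OF st eF e(2) gauss_moments(6)[OF h0]])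
  have 2: "has_bochner_integral M (\<lambda>\<omega>. (e \<omega>)\<^sup>2 * (?n \<omega>)\<^sup>2) (expectation (\<lambda>\<omega>. (e \<omega>)\<^sup>2) * h)"
    unfolding h_def by (rule has_bochner_integral_mult_incr[OF st eF e(2) gauss_moments(2)[OF h0]])
  have 3: "has_bochner_integral M (\<lambda>\<omega>. e \<omega> * P \<omega>) 0"
    using integrable_mult_of_squares[OF eM P(1) e(2) P(2)] P(3) by (simp add: has_bochner_integral_iff)
  have 4: "has_bochner_integral M (\<lambda>\<omega>. (P \<omega>)\<^sup>2) (expectation (\<lambda>\<omega>. (P \<omega>)\<^sup>2))"
    using P by (simp add: has_bochner_integral_iff)
  have 5: "has_bochner_integral M (\<lambda>_. (1 + 1 / c) * d\<^sup>2) ((1 + 1 / c) * d\<^sup>2)"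
    by (simp add: has_bochner_integral_iff prob_space)
  let ?B = "\<lambda>\<omega>. (1 + c) * ((e \<omega>)\<^sup>2 * (1 - ?n \<omega>)\<^sup>2 + 2 * (e \<omega> * P \<omega>) + (e \<omega>)\<^sup>2 * (?n \<omega>)\<^sup>2 + 2 * (P \<omega>)\<^sup>2) + (1 + 1 / c) * d\<^sup>2"
  have B: "has_bochner_integral M ?B ((1 + c) * (expectation (\<lambda>\<omega>. (e \<omega>)\<^sup>2) * (1 + h) + 2 * 0 + expectation (\<lambda>\<omega>. (e \<omega>)\<^sup>2) * h
     + 2 * expectation (\<lambda>\<omega>. (P \<omega>)\<^sup>2)) + (1 + 1 / c) * d\<^sup>2)"
    by (intro has_bochner_integral_add has_bochner_integral_mult_right 1 2 3 4 5)
  have le: "(Z \<omega>)\<^sup>2 \<le> ?B \<omega>" for \<omega> unfolding Z_def by (rule quadratic_step_bound[OF c D(2)])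
  have [measurable]: "Z \<in> borel_measurable M" unfolding Z_def by measurable
  have Bi: "integrable M ?B" using B by (rule integrable.intros)
  show Zi: "integrable M (\<lambda>\<omega>. (Z \<omega>)\<^sup>2)"
    by (rule Bochner_Integration.integrable_bound[OF Bi]) (use le in \<open>auto intro!: AE_I2 intro: order_trans[OF _ abs_ge_self]\<close>)
  have "expectation (\<lambda>\<omega>. (Z \<omega>)\<^sup>2) \<le> expectation ?B" by (rule integral_mono[OF Zi Bi le])
  also have "\<dots> = (1 + c) * ((1 + 2 * h) * expectation (\<lambda>\<omega>. (e \<omega>)\<^sup>2) + 2 * expectation (\<lambda>\<omega>. (P \<omega>)\<^sup>2)) + (1 + 1 / c) * d\<^sup>2"
    unfolding has_bochner_integral_integral_eq[OF B] by (simp add: algebra_simps)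
  finally show "expectation (\<lambda>\<omega>. (Z \<omega>)\<^sup>2) \<le> (1 + c) * ((1 + 2 * h) * expectation (\<lambda>\<omega>. (e \<omega>)\<^sup>2) + 2 * expectation (\<lambda>\<omega>. (P \<omega>)\<^sup>2)) + (1 + 1 / c) * d\<^sup>2" .
qed

text \<open>Ito isometry for a sum over cells: of two different cells the earlier contribution is
  known when the later cell begins, so mixed products have mean 0. The index set \<open>B\<close>
  allows the cells of a single Euler step to be treated separately.\<close>

lemma martingale_block:
  fixes \<eta> :: "nat \<Rightarrow> 'a \<Rightarrow> real^'m" and g :: "nat \<Rightarrow> real"
  assumes g: "\<And>i j. i < j \<Longrightarrow> j \<le> L \<Longrightarrow> g i < g j" "0 \<le> g 0" and B: "B \<subseteq> {..<L}"
    and \<eta>: "\<And>i. i \<in> B \<Longrightarrow> \<eta> i \<in> borel_measurable (F (g i))" "\<And>i \<omega>. i \<in> B \<Longrightarrow> norm (\<eta> i \<omega>) \<le> C i"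
  defines "R \<equiv> \<lambda>\<omega>. \<Sum>i\<in>B. \<eta> i \<omega> \<bullet> (W (g (Suc i)) \<omega> - W (g i) \<omega>)"
  shows "has_bochner_integral M (\<lambda>\<omega>. (R \<omega>)\<^sup>2) (\<Sum>i\<in>B. expectation (\<lambda>\<omega>. (norm (\<eta> i \<omega>))\<^sup>2) * (g (Suc i) - g i))"
    and "\<And>X s. X \<in> borel_measurable (F s) \<Longrightarrow> integrable M (\<lambda>\<omega>. (X \<omega>)\<^sup>2) \<Longrightarrow> (\<And>i. i \<in> B \<Longrightarrow> s \<le> g i) \<Longrightarrow>
      has_bochner_integral M (\<lambda>\<omega>. X \<omega> * R \<omega>) 0"
    and "\<And>t. (\<And>i. i \<in> B \<Longrightarrow> g (Suc i) \<le> t) \<Longrightarrow> R \<in> borel_measurable (F t)"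
proof -
  let ?d = "\<lambda>i \<omega>. \<eta> i \<omega> \<bullet> (W (g (Suc i)) \<omega> - W (g i) \<omega>)"
  let ?v = "\<lambda>i. expectation (\<lambda>\<omega>. (norm (\<eta> i \<omega>))\<^sup>2) * (g (Suc i) - g i)"
  have finB: "finite B" using B finite_subset by blast
  have le: "g i \<le> g j" if "i \<le> j" "j \<le> L" for i j using g(1)[of i j] that by (cases "i = j") auto
  have g0: "0 \<le> g i" if "i \<le> L" for i using le[of 0 i] that g(2) by auto
  have lt: "g i < g (Suc i)" if "i \<in> B" for i using g(1)[of i "Suc i"] that B by auto
  have dF: "?d i \<in> borel_measurable (F t)" if "i \<in> B" "g (Suc i) \<le> t" for i t
  proof -
    have i: "i < L" using that B by auto
    have "\<eta> i \<in> borel_measurable (F t)" using measurable_F_mono[OF \<eta>(1)[OF that(1)]] lt[OF that(1)] that by auto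
    moreover have "W (g i) \<in> borel_measurable (F t)" "W (g (Suc i)) \<in> borel_measurable (F t)"
      using W_measurable g0[of i] g0[of "Suc i"] lt[OF that(1)] that i by auto
    ultimately show ?thesis by (intro borel_measurable_inner borel_measurable_diff)
  qed
  have d2: "has_bochner_integral M (\<lambda>\<omega>. (?d i \<omega>)\<^sup>2) (?v i)" if "i \<in> B" for i
    using martingale_increment(1)[OF _ lt[OF that] \<eta>(1)[OF that] \<eta>(2)[OF that]] g0[of i] that B by auto
  have dX: "has_bochner_integral M (\<lambda>\<omega>. X \<omega> * ?d i \<omega>) 0"
    if "i \<in> B" "X \<in> borel_measurable (F s)" "integrable M (\<lambda>\<omega>. (X \<omega>)\<^sup>2)" "s \<le> g i" for i X s
    using martingale_increment(2)[OF _ lt[OF that(1)] \<eta>(1)[OF that(1)] \<eta>(2)[OF that(1)], of X] g0[of i] that B measurable_F_mono[OF that(2,4)] by auto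
  have dd: "has_bochner_integral M (\<lambda>\<omega>. ?d i \<omega> * ?d j \<omega>) (if i = j then ?v i else 0)" if ij: "i \<in> B" "j \<in> B" for i j
  proof (cases i j rule: linorder_cases)
    case less
    then have "g (Suc i) \<le> g j" using le[of "Suc i" j] ij B by auto
    then show ?thesis using dX[OF ij(2) dF[OF ij(1)], of "g j"] d2[OF ij(1)] less by (auto simp: has_bochner_integral_iff)
  next
    case equal
    then show ?thesis using d2[OF ij(1)] by (simp add: power2_eq_square)
  next
    case greater
    then have "g (Suc j) \<le> g i" using le[of "Suc j" i] ij B by auto
    then show ?thesis using dX[OF ij(1) dF[OF ij(2)], of "g i"] d2[OF ij(2)] greater
      by (auto simp: has_bochner_integral_iff mult.commute)
  qed
  have "has_bochner_integral M (\<lambda>\<omega>. \<Sum>i\<in>B. \<Sum>j\<in>B. ?d i \<omega> * ?d j \<omega>) (\<Sum>i\<in>B. \<Sum>j\<in>B. if i = j then ?v i else 0)"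
    by (intro has_bochner_integral_sum dd)
  then show "has_bochner_integral M (\<lambda>\<omega>. (R \<omega>)\<^sup>2) (\<Sum>i\<in>B. ?v i)"
    using finB by (simp add: R_def power2_eq_square sum_product)
  show "has_bochner_integral M (\<lambda>\<omega>. X \<omega> * R \<omega>) 0"
    if "X \<in> borel_measurable (F s)" "integrable M (\<lambda>\<omega>. (X \<omega>)\<^sup>2)" "\<And>i. i \<in> B \<Longrightarrow> s \<le> g i" for X s
  proof -
    have "has_bochner_integral M (\<lambda>\<omega>. \<Sum>i\<in>B. X \<omega> * ?d i \<omega>) (\<Sum>i\<in>B. 0)"
      by (intro has_bochner_integral_sum dX[OF _ that(1,2)] that(3))
    then show ?thesis by (simp add: R_def sum_distrib_left)
  qed
  show "R \<in> borel_measurable (F t)" if "\<And>i. i \<in> B \<Longrightarrow> g (Suc i) \<le> t" for t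
    unfolding R_def by (intro borel_measurable_sum dF that)
qed

end

section \<open>The Euler scheme of a linear stochastic equation\<close>

locale linear_sde = brownian M F W
  for M :: "'a measure" and F :: "real \<Rightarrow> 'a measure" and W :: "real \<Rightarrow> 'a \<Rightarrow> real^'m" +
  fixes T y0 :: real and q :: "real \<Rightarrow> real" and \<theta> :: "real \<Rightarrow> real^'m"
    and y :: "real \<Rightarrow> 'a \<Rightarrow> real" and I :: "real \<Rightarrow> 'a \<Rightarrow> real"
  assumes T_pos: "T > 0"
    and q_int: "q absolutely_integrable_on {0..T}"
    and \<theta>_meas: "\<theta> \<in> borel_measurable (lebesgue_on {0..T})"
    and \<theta>_int: "(\<lambda>s. (norm (\<theta> s))\<^sup>2) integrable_on {0..T}"
    and y_adapted: "\<And>t. t \<in> {0..T} \<Longrightarrow> y t \<in> borel_measurable (F t)"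
    and y_cont: "\<And>\<omega>. \<omega> \<in> space M \<Longrightarrow> continuous_on {0..T} (\<lambda>t. y t \<omega>)"
    and y_ito: "ito_integral M F W T (\<lambda>t \<omega>. - (y t \<omega> *\<^sub>R \<theta> t)) I"
    and y_eq: "\<And>t. t \<in> {0..T} \<Longrightarrow> AE \<omega> in M. y t \<omega> = y0 + integral {0..t} (\<lambda>s. q s * y s \<omega>) + I t \<omega>"
begin

definition "a t = integral {0..t} q"

text \<open>The drift is removed by an integrating factor: formally
  \<open>du = - u \<theta> dW\<close>, solved by a stochastic exponential, which is what
  \<open>E\<close> approximates below.\<close>

definition "u t \<omega> = exp (- a t) * y t \<omega>"

lemma y_measurable_M: "t \<in> {0..T} \<Longrightarrow> y t \<in> borel_measurable M"
  using y_adapted measurable_F_M by blast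

lemma q_integrable: "q integrable_on {0..T}" "(\<lambda>s. 1 + \<bar>q s\<bar>) integrable_on {0..T}"
  using q_int by (auto simp: absolutely_integrable_on_def intro!: integrable_add integrable_const_ivl)

lemma a_cont: "continuous_on {0..T} a"
  unfolding a_def by (rule indefinite_integral_continuous_1[OF q_integrable(1)])

lemma u_adapted: "t \<in> {0..T} \<Longrightarrow> u t \<in> borel_measurable (F t)"
  unfolding u_def using y_adapted[of t] by measurable

end

locale euler = linear_sde M F W T y0 q \<theta> y I
  for M :: "'a measure" and F :: "real \<Rightarrow> 'a measure" and W :: "real \<Rightarrow> 'a \<Rightarrow> real^'m"
    and T y0 q \<theta> y I +
  fixes N :: nat and l :: "nat \<Rightarrow> real^'m"
  assumes N_pos: "N > 0"
begin

text \<open>\<open>E\<close> is the exact solution with \<open>\<theta>\<close> replaced by the step function \<open>l\<close>, and \<open>S k\<close> is the defect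
  of \<open>E\<close> in the Euler step from \<open>t k\<close> to \<open>t (Suc k)\<close>.\<close>

definition "t k = real k * T / real N"
definition "h k = (norm (l k))\<^sup>2 * (t (Suc k) - t k)"
definition "dN k \<omega> = l k \<bullet> (W (t (Suc k)) \<omega> - W (t k) \<omega>)"
definition "E k \<omega> = y0 * (\<Prod>i<k. exp (- dN i \<omega> - h i / 2))"
text \<open>A common yardstick for the errors of one step: it dominates both the step length and the
  variation of \<open>a\<close>, and its sum over the grid does not depend on the grid.\<close>

definition "w k = integral {t k..t (Suc k)} (\<lambda>s. 1 + \<bar>q s\<bar>)"
definition "S k \<omega> = - (E k \<omega> * (exp (- dN k \<omega> - h k / 2) - 1 + dN k \<omega>))"
text \<open>The Ito integrand is \<open>- y \<theta>\<close>, and this approximates its negative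
  with coefficients frozen at left endpoints. Hence the integrand error of a step process appears as
  the sum \<open>step_proc + hold\<close>.\<close>

definition "hold s \<omega> = (\<Sum>k<N. indicator {t k..<t (Suc k)} s *\<^sub>R (y (t k) \<omega> *\<^sub>R l k))"
text \<open>What remains of an increment of \<open>u\<close> after the discounted increment of the
  step integral; it is small because \<open>u\<close> has no drift.\<close>

definition "drift_error ts \<xi> k \<omega> = u (t (Suc k)) \<omega> - u (t k) \<omega>
  - exp (- a (t k)) * (step_int ts \<xi> W (t (Suc k)) \<omega> - step_int ts \<xi> W (t k) \<omega>)"

lemma t_Suc: "t (Suc k) - t k = T / N"
  by (simp only: t_def of_nat_Suc distrib_right add_divide_distrib)

lemma TN: "0 < T / N" using T_pos N_pos by simp

lemma t_less: "t k < t (Suc k)" using t_Suc[of k] TN by linarith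

lemma t_mono: "i \<le> j \<Longrightarrow> t i \<le> t j"
  by (rule lift_Suc_mono_le[of t]) (simp_all add: t_less less_imp_le)

lemma t0: "t 0 = 0" and tN: "t N = T" using N_pos by (auto simp: t_def)

lemma t_nonneg: "0 \<le> t k" using t_mono[of 0 k] t0 by simp

lemma t_in: "k \<le> N \<Longrightarrow> t k \<in> {0..T}" using t_mono[of k N] t_nonneg tN by auto

lemma h_nonneg: "0 \<le> h k" unfolding h_def using t_less[of k] by simp

lemma w_lower: "k < N \<Longrightarrow> T / N \<le> w k" and w_pos: "k < N \<Longrightarrow> 0 < w k" and w_nonneg: "0 \<le> w k"
proof -
  show 1: "T / N \<le> w k" if "k < N" for k
  proof -
    have "integral {t k..t (Suc k)} (\<lambda>_. 1) \<le> w k"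
      unfolding w_def using t_in[of k] t_in[of "Suc k"] that
      by (intro integral_le integrable_const_ivl integrable_subinterval_real[OF q_integrable(2)]) auto
    then show ?thesis using t_less[of k] by (simp add: t_Suc)
  qed
  show "0 < w k" if "k < N" using 1[OF that] TN by linarith
  show "0 \<le> w k" unfolding w_def
    by (cases "(\<lambda>s. 1 + \<bar>q s\<bar>) integrable_on {t k..t (Suc k)}")
      (auto intro: integral_nonneg simp: not_integrable_integral)
qed

lemma dN_measurable: "t (Suc k) \<le> s \<Longrightarrow> dN k \<in> borel_measurable (F s)"
  unfolding dN_def using W_measurable[of "t k" s] W_measurable[of "t (Suc k)" s] t_nonneg t_less[of k]
  by (intro borel_measurable_inner borel_measurable_diff) auto

lemma E_measurable: "E k \<in> borel_measurable (F (t k))"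
proof -
  have "(\<lambda>\<omega>. exp (- dN i \<omega> - h i / 2)) \<in> borel_measurable (F (t k))" if "i < k" for i
  proof -
    have [measurable]: "dN i \<in> borel_measurable (F (t k))" using dN_measurable[of i "t k"] t_mono[of "Suc i" k] that by auto
    show ?thesis by measurable
  qed
  then show ?thesis unfolding E_def by (intro borel_measurable_times borel_measurable_prod) auto
qed

lemma E_Suc: "E (Suc k) \<omega> = E k \<omega> * exp (- dN k \<omega> - h k / 2)"
  by (simp add: E_def)

lemma mult_dN:
  fixes f :: "real \<Rightarrow> real"
  assumes "X \<in> borel_measurable (F (t k))" "integrable M X" "has_bochner_integral (gauss (h k)) f J"
  shows "has_bochner_integral M (\<lambda>\<omega>. X \<omega> * f (dN k \<omega>)) (expectation X * J)"
  unfolding dN_def using assms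
  by (intro has_bochner_integral_mult_incr t_nonneg t_less) (auto simp: h_def)

lemma E_square: "has_bochner_integral M (\<lambda>\<omega>. (E k \<omega>)\<^sup>2) (y0\<^sup>2 * exp (\<Sum>i<k. h i))"
proof (induction k)
  case 0
  show ?case by (simp add: E_def has_bochner_integral_iff prob_space)
next
  case (Suc k)
  have "(\<lambda>\<omega>. (E k \<omega>)\<^sup>2) \<in> borel_measurable (F (t k))" using E_measurable[of k] by measurable
  from mult_dN[OF this _ gauss_moments(4)[OF h_nonneg]] Suc
  have "has_bochner_integral M (\<lambda>\<omega>. (E k \<omega>)\<^sup>2 * (exp (- dN k \<omega> - h k / 2))\<^sup>2) (expectation (\<lambda>\<omega>. (E k \<omega>)\<^sup>2) * exp (h k))"
    by (simp add: has_bochner_integral_iff)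
  then show ?case using has_bochner_integral_integral_eq[OF Suc] by (simp add: E_Suc power_mult_distrib exp_add mult_ac)
qed

lemma S_measurable: "S k \<in> borel_measurable (F (t (Suc k)))"
proof -
  have [measurable]: "dN k \<in> borel_measurable (F (t (Suc k)))" by (rule dN_measurable) simp
  have [measurable]: "E k \<in> borel_measurable (F (t (Suc k)))"
    using measurable_F_mono[OF E_measurable] t_less[of k] by auto
  show ?thesis unfolding S_def by measurable
qed

lemma S_square: "has_bochner_integral M (\<lambda>\<omega>. (S k \<omega>)\<^sup>2) (y0\<^sup>2 * exp (\<Sum>i<k. h i) * (exp (h k) - 1 - h k))"
proof -
  have "(\<lambda>\<omega>. (E k \<omega>)\<^sup>2) \<in> borel_measurable (F (t k))" using E_measurable[of k] by measurable
  from mult_dN[OF this _ gauss_moments(5)[OF h_nonneg]] E_square[of k]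
  show ?thesis by (simp add: has_bochner_integral_iff S_def power_mult_distrib)
qed

text \<open>The lognormal factor has mean 1 and the increment mean 0, so the defect is a martingale
  difference. Its orthogonality makes the squared defects add up, not the defects
  themselves.\<close>

lemma S_orthogonal:
  assumes X: "X \<in> borel_measurable (F (t k))" "integrable M (\<lambda>\<omega>. (X \<omega>)\<^sup>2)"
  shows "has_bochner_integral M (\<lambda>\<omega>. X \<omega> * S k \<omega>) 0"
proof -
  have "has_bochner_integral (gauss (h k)) (\<lambda>x. exp (- x - h k / 2) + (- 1) * 1 + x) (1 + (- 1) * 1 + 0)"
    by (intro has_bochner_integral_add has_bochner_integral_mult_right gauss_moments h_nonneg)
  then have f: "has_bochner_integral (gauss (h k)) (\<lambda>x. exp (- x - h k / 2) - 1 + x) 0" by simp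
  have XE: "integrable M (\<lambda>\<omega>. X \<omega> * E k \<omega>)"
    using measurable_F_M[OF X(1)] measurable_F_M[OF E_measurable] X(2) E_square[of k]
    by (intro integrable_mult_of_squares) (auto simp: has_bochner_integral_iff)
  have XEm: "(\<lambda>\<omega>. X \<omega> * E k \<omega>) \<in> borel_measurable (F (t k))" using X(1) E_measurable[of k] by measurable
  have "has_bochner_integral M (\<lambda>\<omega>. - ((X \<omega> * E k \<omega>) * (exp (- dN k \<omega> - h k / 2) - 1 + dN k \<omega>))) (- (expectation (\<lambda>\<omega>. X \<omega> * E k \<omega>) * 0))"
    by (intro has_bochner_integral_minus mult_dN[OF XEm XE f])
  then show ?thesis by (simp add: S_def mult_ac)
qed

lemma hold_eq:
  assumes "k < N" "t k \<le> s" "s < t (Suc k)"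
  shows "hold s \<omega> = y (t k) \<omega> *\<^sub>R l k"
proof -
  have "indicator {t j..<t (Suc j)} s = (if j = k then 1 else 0 :: real)" for j
    using assms t_mono[of "Suc j" k] t_mono[of "Suc k" j] by (cases j k rule: linorder_cases) (auto simp: indicator_def)
  then have "hold s \<omega> = (\<Sum>j<N. if j = k then y (t j) \<omega> *\<^sub>R l j else 0)"
    unfolding hold_def by (intro sum.cong) auto
  then show ?thesis using assms by simp
qed

text \<open>A Gronwall factor times the sum of three sources: the integrand error \<open>dR\<close>,
  the Euler defects of \<open>E\<close>, and drift errors up to \<open>dD * w k\<close>. The 4 is
  one factor 2 from \<open>quadratic_step_bound\<close> and one from separating the first two
  sources.\<close>

definition "err_bound Ca dR dD =
  exp ((\<Sum>k<N. w k) + 2 * (\<Sum>k<N. h k)) * (1 + (\<Sum>k<N. w k)) *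
  (4 * (Ca\<^sup>2 * dR + y0\<^sup>2 * exp (\<Sum>k<N. h k) * (\<Sum>k<N. exp (h k) - 1 - h k)) + dD\<^sup>2 * (\<Sum>k<N. w k))"

text \<open>Both \<open>u\<close> and \<open>E\<close> follow the Euler recursion with multiplier
  \<open>1 - dN k\<close>, up to remainders \<open>R k + D k\<close> and \<open>- S k\<close>. Their
  difference thus obeys a linear recursion whose noise \<open>R k + S k\<close> is orthogonal to the
  past and whose \<open>D k\<close> is small; discrete Gronwall then bounds its mean square.\<close>

lemma euler_approx:
  assumes simple: "simple_adapted M F T ts \<xi>" and dR: "0 \<le> dR" and dD: "0 \<le> dD"
    and Ca: "\<And>k. k \<le> N \<Longrightarrow> exp (- a (t k)) \<le> Ca"
  obtains e where
    "\<And>k. k \<le> N \<Longrightarrow> e k \<in> borel_measurable M"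
    "\<And>k. k \<le> N \<Longrightarrow> integrable M (\<lambda>\<omega>. (e k \<omega>)\<^sup>2)"
    "\<And>k. k \<le> N \<Longrightarrow> expectation (\<lambda>\<omega>. (e k \<omega>)\<^sup>2) \<le> err_bound Ca dR dD"
    "\<And>\<omega> k. \<omega> \<in> space M \<Longrightarrow> y 0 \<omega> = y0 \<Longrightarrow> integral {0..T} (\<lambda>s. (norm (step_proc ts \<xi> s \<omega> + hold s \<omega>))\<^sup>2) \<le> dR \<Longrightarrow>
       (\<And>k. k < N \<Longrightarrow> \<bar>drift_error ts \<xi> k \<omega>\<bar> \<le> dD * w k) \<Longrightarrow> k \<le> N \<Longrightarrow> e k \<omega> = u (t k) \<omega> - E k \<omega>"
proof -
  obtain L g where g: "\<And>i j. i < j \<Longrightarrow> j \<le> L \<Longrightarrow> g i < g j" "g 0 = 0" "g L = T" "t ` {..N} \<subseteq> g ` {..L}"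
    "\<And>i. i \<le> L \<Longrightarrow> g i \<in> {0..T}"
    "\<And>i. i < L \<Longrightarrow> step_proc ts \<xi> (g i) \<in> borel_measurable (F (g i))"
    "\<And>i s \<omega>. i < L \<Longrightarrow> g i \<le> s \<Longrightarrow> s < g (Suc i) \<Longrightarrow> step_proc ts \<xi> s \<omega> = step_proc ts \<xi> (g i) \<omega>"
    "\<And>v \<omega>. v \<in> g ` {..L} \<Longrightarrow> step_int ts \<xi> W v \<omega> =
       (\<Sum>i<L. if g i < v then step_proc ts \<xi> (g i) \<omega> \<bullet> (W (g (Suc i)) \<omega> - W (g i) \<omega>) else 0)"
  proof -
    have "finite (t ` {..N})" "t ` {..N} \<subseteq> {0..T}" using t_in by auto
    then show ?thesis
    proof (rule step_common_refinement[OF simple], goal_cases)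
      case (1 L g)
      show ?thesis by (rule that[of L g]) (rule 1; assumption)+
    qed
  qed
  have tg: "\<exists>p\<le>L. t k = g p" if "k \<le> N" for k using g(4) that by auto
  have g_le: "g i \<le> g j \<longleftrightarrow> i \<le> j" if "i \<le> L" "j \<le> L" for i j
    using g(1)[of i j] g(1)[of j i] that by (cases i j rule: linorder_cases) auto
  have t_nogap: "t k \<le> g i \<longleftrightarrow> t k \<le> s" if "k \<le> N" "i < L" "g i \<le> s" "s < g (Suc i)" for k i s
    using tg[OF that(1)] g_le[of _ i] g_le[of "Suc i"] that by (metis Suc_le_eq dual_order.trans leD leI less_imp_le_nat nat_less_le)
  have g_next: "g (Suc i) \<le> t k" if "k \<le> N" "i < L" "g i < t k" for i k
    using tg[OF that(1)] g_le[of _ i] g_le[of "Suc i"] that by (metis Suc_le_eq leD leI less_imp_le_nat)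
  let ?d = "\<lambda>i \<omega>. W (g (Suc i)) \<omega> - W (g i) \<omega>"
  have g0: "0 \<le> g i" if "i \<le> L" for i using g(5)[OF that] by auto
  have dF: "?d i \<in> borel_measurable (F s)" if "i < L" "g (Suc i) \<le> s" for i s
    using W_measurable[of "g i" s] W_measurable[of "g (Suc i)" s] g0[of i] g0[of "Suc i"] g(1)[of i "Suc i"] that
    by (intro borel_measurable_diff) auto
  have hold_const: "hold s \<omega> = hold (g i) \<omega>" if "i < L" "g i \<le> s" "s < g (Suc i)" for i s \<omega>
    unfolding hold_def
  proof (intro sum.cong refl)
    fix k assume "k \<in> {..<N}"
    then have "indicator {t k..<t (Suc k)} s = (indicator {t k..<t (Suc k)} (g i) :: real)"
      using t_nogap[of k, OF _ that] t_nogap[of "Suc k", OF _ that] by (auto simp: indicator_def not_le[symmetric])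
    then show "indicator {t k..<t (Suc k)} s *\<^sub>R y (t k) \<omega> *\<^sub>R l k =
      indicator {t k..<t (Suc k)} (g i) *\<^sub>R y (t k) \<omega> *\<^sub>R l k" by simp
  qed
  have holdF: "hold (g i) \<in> borel_measurable (F (g i))" for i
  proof -
    have "(\<lambda>\<omega>. indicator {t k..<t (Suc k)} (g i) *\<^sub>R (y (t k) \<omega> *\<^sub>R l k)) \<in> borel_measurable (F (g i))"
      if k: "k < N" for k
    proof (cases "t k \<le> g i")
      case True
      then have "y (t k) \<in> borel_measurable (F (g i))" using measurable_F_mono[OF y_adapted[OF t_in[of k]]] k by auto
      then show ?thesis by measurable
    qed (simp add: indicator_def)
    then show ?thesis unfolding hold_def by (intro borel_measurable_sum) auto
  qed
  txt \<open>Neither \<open>y\<close> nor the Ito integrand need be square integrable on \<open>\<Omega>\<close>. Therefore the error of the integrand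
    is stopped when its squared norm exceeds \<open>dR\<close> and the drift error is truncated at \<open>dD * w k\<close>; the resulting
    \<open>e\<close> has second moments and agrees with the actual error where both bounds hold.\<close>
  define \<eta> where "\<eta> i \<omega> = step_proc ts \<xi> (g i) \<omega> + hold (g i) \<omega>" for i \<omega>
  have \<eta>F: "\<eta> i \<in> borel_measurable (F (g i))" if "i < L" for i
    unfolding \<eta>_def using g(6)[OF that] holdF[of i] by measurable
  define v where "v i \<omega> = (norm (\<eta> i \<omega>))\<^sup>2 * \<bar>g (Suc i) - g i\<bar>" for i \<omega>
  define \<eta>' where "\<eta>' i \<omega> = (if (\<Sum>j\<le>i. v j \<omega>) \<le> dR then \<eta> i \<omega> else 0)" for i \<omega>
  have gd: "\<bar>g (Suc i) - g i\<bar> = g (Suc i) - g i" "0 < g (Suc i) - g i" if "i < L" for i using g(1)[of i "Suc i"] that by auto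
  have vF: "v j \<in> borel_measurable (F (g i))" if "j \<le> i" "i < L" for i j
  proof -
    have "\<eta> j \<in> borel_measurable (F (g i))" using measurable_F_mono[OF \<eta>F] g_le[of j i] that by auto
    then show ?thesis unfolding v_def by measurable
  qed
  have \<eta>'F: "\<eta>' i \<in> borel_measurable (F (g i))" if "i < L" for i
  proof -
    have [measurable]: "(\<lambda>\<omega>. \<Sum>j\<le>i. v j \<omega>) \<in> borel_measurable (F (g i))"
      using vF that by (intro borel_measurable_sum) auto
    show ?thesis unfolding \<eta>'_def using \<eta>F[OF that] by measurable
  qed
  have stop: "(\<Sum>i<L. (norm (\<eta>' i \<omega>))\<^sup>2 * (g (Suc i) - g i)) \<le> dR" for \<omega>
  proof -
    have "(\<Sum>i<L. (norm (\<eta>' i \<omega>))\<^sup>2 * (g (Suc i) - g i)) = (\<Sum>i<L. if (\<Sum>j\<le>i. v j \<omega>) \<le> dR then v i \<omega> else 0)"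
      using gd by (intro sum.cong) (auto simp: \<eta>'_def v_def)
    also have "\<dots> \<le> dR" by (rule sum_stopped_le) (auto simp: v_def dR)
    finally show ?thesis .
  qed
  have bd: "norm (\<eta>' i \<omega>) \<le> sqrt (dR / (g (Suc i) - g i))" if "i < L" for i \<omega>
  proof (rule real_le_rsqrt)
    have "(norm (\<eta>' i \<omega>))\<^sup>2 * (g (Suc i) - g i) \<le> (\<Sum>i<L. (norm (\<eta>' i \<omega>))\<^sup>2 * (g (Suc i) - g i))"
    proof (rule member_le_sum)
      show "0 \<le> (norm (\<eta>' j \<omega>))\<^sup>2 * (g (Suc j) - g j)" if "j \<in> {..<L} - {i}" for j
        using gd(2)[of j] that by simp
    qed (use that in auto)
    then show "(norm (\<eta>' i \<omega>))\<^sup>2 \<le> dR / (g (Suc i) - g i)" using stop[of \<omega>] gd[OF that] by (simp add: field_simps)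
  qed
  define B where "B k = {i. i < L \<and> t k \<le> g i \<and> g i < t (Suc k)}" for k
  have BL: "B k \<subseteq> {..<L}" for k by (auto simp: B_def)
  have finB: "finite (B k)" for k using BL finite_subset by blast
  define r where "r k \<omega> = (\<Sum>i\<in>B k. \<eta>' i \<omega> \<bullet> ?d i \<omega>)" for k \<omega>
  define x where "x k = exp (- a (t k))" for k
  define R where "R k \<omega> = x k * r k \<omega>" for k \<omega>
  have blk: "i < L" if "i \<in> B k" for i k using that by (simp add: B_def)
  have r2: "has_bochner_integral M (\<lambda>\<omega>. (r k \<omega>)\<^sup>2) (\<Sum>i\<in>B k. expectation (\<lambda>\<omega>. (norm (\<eta>' i \<omega>))\<^sup>2) * (g (Suc i) - g i))" for k
    unfolding r_def
    by (rule martingale_block(1)[of L g "B k" \<eta>', OF g(1) _ BL \<eta>'F[OF blk] bd[OF blk]]) (auto simp: g(2))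
  have r0: "has_bochner_integral M (\<lambda>\<omega>. X \<omega> * r k \<omega>) 0"
    if "X \<in> borel_measurable (F (t k))" "integrable M (\<lambda>\<omega>. (X \<omega>)\<^sup>2)" for X k
    unfolding r_def
    by (rule martingale_block(2)[of L g "B k" \<eta>', OF g(1) _ BL \<eta>'F[OF blk] bd[OF blk] that]) (auto simp: g(2) B_def)
  have rF: "r k \<in> borel_measurable (F (t (Suc k)))" if "k < N" for k
    unfolding r_def
    by (rule martingale_block(3)[of L g "B k" \<eta>', OF g(1) _ BL \<eta>'F[OF blk] bd[OF blk]])
      (use g_next[of "Suc k"] that in \<open>auto simp: g(2) B_def\<close>)
  have stepF: "step_int ts \<xi> W (t k) \<in> borel_measurable (F s)" if "k \<le> N" "t k \<le> s" for k s
  proof -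
    have m: "(\<lambda>\<omega>. if g i < t k then step_proc ts \<xi> (g i) \<omega> \<bullet> ?d i \<omega> else 0) \<in> borel_measurable (F s)" if i: "i < L" for i
    proof (cases "g i < t k")
      case True
      have "step_proc ts \<xi> (g i) \<in> borel_measurable (F s)"
        using measurable_F_mono[OF g(6)[OF i]] True \<open>t k \<le> s\<close> by auto
      then show ?thesis using dF[OF i, of s] g_next[OF \<open>k \<le> N\<close> i True] \<open>t k \<le> s\<close> True by auto
    qed simp
    have "t k \<in> g ` {..L}" using g(4) that by auto
    from g(8)[OF this] have "step_int ts \<xi> W (t k) = (\<lambda>\<omega>. \<Sum>i<L. if g i < t k then step_proc ts \<xi> (g i) \<omega> \<bullet> ?d i \<omega> else 0)"
      by (rule ext)
    then show ?thesis by (simp only:) (intro borel_measurable_sum m, simp)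
  qed
  define D where "D k \<omega> = max (- (dD * w k)) (min (dD * w k) (drift_error ts \<xi> k \<omega>))" for k \<omega>
  have DF: "D k \<in> borel_measurable (F (t (Suc k)))" if "k < N" for k
  proof -
    have "u (t k) \<in> borel_measurable (F (t (Suc k)))" "u (t (Suc k)) \<in> borel_measurable (F (t (Suc k)))"
      using measurable_F_mono[OF u_adapted[OF t_in]] t_less[of k] that by (auto simp: less_imp_le)
    moreover have "step_int ts \<xi> W (t k) \<in> borel_measurable (F (t (Suc k)))"
       "step_int ts \<xi> W (t (Suc k)) \<in> borel_measurable (F (t (Suc k)))"
      using stepF that t_less[of k] by (auto simp: less_imp_le)
    ultimately show ?thesis unfolding D_def drift_error_def by measurable
  qed
  have Db: "\<bar>D k \<omega>\<bar> \<le> dD * w k" for k \<omega>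
    unfolding D_def using dD w_nonneg[of k] by (auto simp: max_def min_def abs_le_iff)
  define e where "e = rec_nat (\<lambda>_. 0) (\<lambda>k f \<omega>. f \<omega> * (1 - dN k \<omega>) + (R k \<omega> + S k \<omega>) + D k \<omega>)"
  have e0: "e 0 \<omega> = 0" and eS: "e (Suc k) \<omega> = e k \<omega> * (1 - dN k \<omega>) + (R k \<omega> + S k \<omega>) + D k \<omega>" for k \<omega>
    by (simp_all add: e_def)
  have eF: "e k \<in> borel_measurable (F (t k))" if "k \<le> N" for k
    using that
  proof (induction k)
    case (Suc k)
    have [measurable]: "e k \<in> borel_measurable (F (t (Suc k)))"
      by (rule measurable_F_mono[OF Suc.IH]) (use Suc.prems t_less[of k] in simp_all)
    have [measurable]: "dN k \<in> borel_measurable (F (t (Suc k)))" by (rule dN_measurable) simp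
    have kN: "k < N" using Suc.prems by simp
    note [measurable] = rF[OF kN] S_measurable[of k] DF[OF kN]
    have eq: "e (Suc k) = (\<lambda>\<omega>. e k \<omega> * (1 - dN k \<omega>) + (x k * r k \<omega> + S k \<omega>) + D k \<omega>)"
      unfolding eS[abs_def] R_def ..
    show ?case unfolding eq by measurable
  qed (simp add: e_def)
  let ?Er = "\<lambda>k. (x k)\<^sup>2 * (\<Sum>i\<in>B k. expectation (\<lambda>\<omega>. (norm (\<eta>' i \<omega>))\<^sup>2) * (g (Suc i) - g i))"
  let ?Es = "\<lambda>k. y0\<^sup>2 * exp (\<Sum>i<k. h i) * (exp (h k) - 1 - h k)"
  have R2: "has_bochner_integral M (\<lambda>\<omega>. (R k \<omega>)\<^sup>2) (?Er k)" for k
    unfolding R_def power_mult_distrib by (intro has_bochner_integral_mult_right r2)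
  have Er0: "0 \<le> ?Er k" for k
  proof (intro mult_nonneg_nonneg sum_nonneg)
    show "0 \<le> g (Suc i) - g i" if "i \<in> B k" for i using gd(2)[OF blk[OF that]] by simp
  qed simp_all
  have eh: "0 \<le> exp (h k) - 1 - h k" for k using exp_ge_add_one_self[of "h k"] by linarith
  have Es0: "0 \<le> ?Es k" for k
    by (intro mult_nonneg_nonneg eh) auto
  have RM: "R k \<in> borel_measurable M" "S k \<in> borel_measurable M" if "k < N" for k
    using measurable_F_M[OF rF[OF that]] measurable_F_M[OF S_measurable] by (simp_all add: R_def[abs_def])
  have P2: "integrable M (\<lambda>\<omega>. (R k \<omega> + S k \<omega>)\<^sup>2) \<and> expectation (\<lambda>\<omega>. (R k \<omega> + S k \<omega>)\<^sup>2) \<le> 2 * (?Er k + ?Es k)" if "k < N" for k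
  proof -
    have B: "has_bochner_integral M (\<lambda>\<omega>. 2 * ((R k \<omega>)\<^sup>2 + (S k \<omega>)\<^sup>2)) (2 * (?Er k + ?Es k))"
      by (intro has_bochner_integral_mult_right has_bochner_integral_add R2 S_square)
    have le: "(R k \<omega> + S k \<omega>)\<^sup>2 \<le> 2 * ((R k \<omega>)\<^sup>2 + (S k \<omega>)\<^sup>2)" for \<omega>
      using sum_squares_bound[of "R k \<omega>" "S k \<omega>"] by (simp add: power2_sum)
    have Bi: "integrable M (\<lambda>\<omega>. 2 * ((R k \<omega>)\<^sup>2 + (S k \<omega>)\<^sup>2))" using B by (rule integrable.intros)
    have i: "integrable M (\<lambda>\<omega>. (R k \<omega> + S k \<omega>)\<^sup>2)"
      by (rule Bochner_Integration.integrable_bound[OF Bi])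
        (use le RM[OF that] in \<open>auto intro!: AE_I2 intro: order_trans[OF _ abs_ge_self]\<close>)
    from integral_mono[OF i Bi le] i show ?thesis using has_bochner_integral_integral_eq[OF B] by simp
  qed
  have step: "integrable M (\<lambda>\<omega>. (e (Suc k) \<omega>)\<^sup>2) \<and> expectation (\<lambda>\<omega>. (e (Suc k) \<omega>)\<^sup>2) \<le>
     (1 + w k) * ((1 + 2 * h k) * expectation (\<lambda>\<omega>. (e k \<omega>)\<^sup>2) + 2 * expectation (\<lambda>\<omega>. (R k \<omega> + S k \<omega>)\<^sup>2)) + (1 + 1 / w k) * (dD * w k)\<^sup>2"
    if k: "k < N" and ei: "integrable M (\<lambda>\<omega>. (e k \<omega>)\<^sup>2)" for k
  proof -
    have eFk: "e k \<in> borel_measurable (F (t k))" using eF k by simp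
    have "has_bochner_integral M (\<lambda>\<omega>. x k * (e k \<omega> * r k \<omega>) + e k \<omega> * S k \<omega>) (x k * 0 + 0)"
      by (intro has_bochner_integral_add has_bochner_integral_mult_right r0 S_orthogonal eFk ei)
    then have orth: "expectation (\<lambda>\<omega>. e k \<omega> * (R k \<omega> + S k \<omega>)) = 0"
      by (simp add: R_def has_bochner_integral_iff algebra_simps)
    have Pm: "(\<lambda>\<omega>. R k \<omega> + S k \<omega>) \<in> borel_measurable M" using RM[OF k] by measurable
    \<comment> \<open>Taking \<open>w k\<close> as the Young weight makes a drift error of size
      \<open>dD * w k\<close> cost only order \<open>w k\<close>, and inflates the old error by
      \<open>1 + w k\<close>; both are summable over the grid.\<close>
    from euler_step_bound[OF t_nonneg t_less eFk ei Pm conjunct1[OF P2[OF k]] orth measurable_F_M[OF DF[OF k]] Db w_pos[OF k], of "l k"]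
    show ?thesis by (simp add: eS dN_def h_def)
  qed
  have ei: "integrable M (\<lambda>\<omega>. (e k \<omega>)\<^sup>2)" if "k \<le> N" for k
    using that by (induction k) (use step in \<open>auto simp: e0\<close>)
  let ?Wt = "\<Sum>k<N. w k" and ?H = "\<Sum>k<N. h k"
  define b where "b k = (1 + ?Wt) * (4 * (?Er k + ?Es k) + dD\<^sup>2 * w k)" for k
  have Wt0: "0 \<le> ?Wt" by (intro sum_nonneg w_nonneg)
  have b0: "0 \<le> b k" for k
    unfolding b_def by (intro mult_nonneg_nonneg[of "1 + ?Wt"] mult_nonneg_nonneg[of 4] mult_nonneg_nonneg[of "dD\<^sup>2"]
      add_nonneg_nonneg Er0 Es0 w_nonneg Wt0) simp_all
  have gron: "expectation (\<lambda>\<omega>. (e (Suc k) \<omega>)\<^sup>2) \<le> exp (w k + 2 * h k) * expectation (\<lambda>\<omega>. (e k \<omega>)\<^sup>2) + b k" if k: "k < N" for k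
  proof -
    let ?ee = "expectation (\<lambda>\<omega>. (e k \<omega>)\<^sup>2)"
    have wW: "w k \<le> ?Wt" using k by (intro member_le_sum w_nonneg) auto
    have ee0: "0 \<le> ?ee" by simp
    have "(1 + w k) * (1 + 2 * h k) \<le> exp (w k) * exp (2 * h k)"
      using w_nonneg[of k] h_nonneg[of k] exp_ge_add_one_self[of "w k"] exp_ge_add_one_self[of "2 * h k"]
      by (intro mult_mono) (auto simp: add.commute)
    then have 1: "(1 + w k) * ((1 + 2 * h k) * ?ee) \<le> exp (w k + 2 * h k) * ?ee"
      using ee0 by (simp add: exp_add mult.assoc[symmetric] mult_right_mono)
    have "(1 + w k) * (2 * expectation (\<lambda>\<omega>. (R k \<omega> + S k \<omega>)\<^sup>2)) \<le> (1 + ?Wt) * (2 * (2 * (?Er k + ?Es k)))"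
      using P2[OF k] wW w_nonneg[of k] by (intro mult_mono) auto
    moreover have "(1 + 1 / w k) * (dD * w k)\<^sup>2 = (1 + w k) * (dD\<^sup>2 * w k)"
      using w_pos[OF k] by (simp add: power2_eq_square field_simps)
    moreover have "\<dots> \<le> (1 + ?Wt) * (dD\<^sup>2 * w k)"
      using wW w_nonneg[of k] by (intro mult_right_mono) auto
    ultimately have "(1 + w k) * (2 * expectation (\<lambda>\<omega>. (R k \<omega> + S k \<omega>)\<^sup>2)) + (1 + 1 / w k) * (dD * w k)\<^sup>2 \<le> b k"
      unfolding b_def distrib_left by simp
    then show ?thesis using step[OF k ei] k 1 by (simp add: distrib_left)
  qed
  have bnd: "expectation (\<lambda>\<omega>. (e k \<omega>)\<^sup>2) \<le> err_bound Ca dR dD" if k: "k \<le> N" for k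
  proof -
    have "expectation (\<lambda>\<omega>. (e k \<omega>)\<^sup>2) \<le> exp (\<Sum>j<k. w j + 2 * h j) * (\<Sum>j<k. b j)"
      by (rule discrete_gronwall) (use gron k b0 in \<open>auto simp: e0 w_nonneg h_nonneg\<close>)
    also have "\<dots> \<le> exp (\<Sum>j<N. w j + 2 * h j) * (\<Sum>j<N. b j)"
      using k b0 by (intro mult_mono sum_mono2 sum_nonneg) (auto intro!: sum_mono2 simp: w_nonneg h_nonneg)
    also have "(\<Sum>j<N. w j + 2 * h j) = ?Wt + 2 * ?H" by (simp add: sum.distrib sum_distrib_left)
    also have "(\<Sum>j<N. b j) \<le> (1 + ?Wt) * (4 * (Ca\<^sup>2 * dR + y0\<^sup>2 * exp ?H * (\<Sum>k<N. exp (h k) - 1 - h k)) + dD\<^sup>2 * ?Wt)"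
    proof -
      have "(\<Sum>k<N. ?Er k) \<le> Ca\<^sup>2 * dR"
      proof -
        let ?z = "\<lambda>i. expectation (\<lambda>\<omega>. (norm (\<eta>' i \<omega>))\<^sup>2) * (g (Suc i) - g i)"
        have z0: "0 \<le> ?z i" if "i < L" for i using gd[OF that] by (intro mult_nonneg_nonneg) auto
        have "?Er k \<le> Ca\<^sup>2 * (\<Sum>i\<in>B k. ?z i)" if "k < N" for k
          using Ca[of k] that z0 blk by (intro mult_right_mono power_mono sum_nonneg) (auto simp: x_def)
        then have "(\<Sum>k<N. ?Er k) \<le> Ca\<^sup>2 * (\<Sum>k<N. \<Sum>i\<in>B k. ?z i)"
          unfolding sum_distrib_left[of "Ca\<^sup>2" _ "{..<N}"] by (intro sum_mono) auto
        also have "(\<Sum>k<N. \<Sum>i\<in>B k. ?z i) = (\<Sum>i\<in>(\<Union>k<N. B k). ?z i)"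
        proof (rule sum.UNION_disjoint[symmetric])
          show "\<forall>k\<in>{..<N}. \<forall>j\<in>{..<N}. k \<noteq> j \<longrightarrow> B k \<inter> B j = {}"
          proof (intro ballI impI)
            fix k j :: nat assume "k \<noteq> j"
            then show "B k \<inter> B j = {}"
              using t_mono[of "Suc k" j] t_mono[of "Suc j" k] by (cases k j rule: linorder_cases) (auto simp: B_def)
          qed
        qed (auto simp: finB)
        also have "\<dots> \<le> (\<Sum>i<L. ?z i)" by (intro sum_mono2) (use z0 blk in auto)
        also have "\<dots> = expectation (\<lambda>\<omega>. \<Sum>i<L. (norm (\<eta>' i \<omega>))\<^sup>2 * (g (Suc i) - g i))"
        proof -
          have "integrable M (\<lambda>\<omega>. (norm (\<eta>' i \<omega>))\<^sup>2)" if "i < L" for i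
          proof (rule integrable_const_bound[where B="(sqrt (dR / (g (Suc i) - g i)))\<^sup>2"])
            show "AE \<omega> in M. norm ((norm (\<eta>' i \<omega>))\<^sup>2) \<le> (sqrt (dR / (g (Suc i) - g i)))\<^sup>2"
              using power_mono[OF bd[OF that] norm_ge_zero, where n=2] by (intro AE_I2) simp
            show "(\<lambda>\<omega>. (norm (\<eta>' i \<omega>))\<^sup>2) \<in> borel_measurable M"
              using measurable_F_M[OF \<eta>'F[OF that]] by measurable
          qed
          then show ?thesis by (subst Bochner_Integration.integral_sum) auto
        qed
        also have "\<dots> \<le> dR"
        \<comment> \<open>In the other case the integral has the default value 0, which also
          respects the bound.\<close>
        proof (cases "integrable M (\<lambda>\<omega>. \<Sum>i<L. (norm (\<eta>' i \<omega>))\<^sup>2 * (g (Suc i) - g i))")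
          case True
          from integral_mono[OF True integrable_const stop] show ?thesis by (simp add: prob_space)
        qed (simp add: not_integrable_integral_eq dR)
        finally show ?thesis by (simp add: mult_left_mono)
      qed
      moreover have "(\<Sum>k<N. ?Es k) \<le> y0\<^sup>2 * exp ?H * (\<Sum>k<N. exp (h k) - 1 - h k)"
        unfolding sum_distrib_left
      proof (intro sum_mono mult_right_mono mult_left_mono)
        fix k assume "k \<in> {..<N}"
        then show "exp (\<Sum>i<k. h i) \<le> exp ?H" by (auto intro!: sum_mono2 simp: h_nonneg)
        show "0 \<le> exp (h k) - 1 - h k" by (rule eh)
      qed simp
      moreover have "(\<Sum>j<N. b j) = (1 + ?Wt) * (4 * ((\<Sum>k<N. ?Er k) + (\<Sum>k<N. ?Es k)) + dD\<^sup>2 * ?Wt)"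
        by (simp add: b_def sum_distrib_left sum.distrib distrib_left)
      ultimately show ?thesis using Wt0 by (simp add: mult_left_mono)
    qed
    finally show ?thesis unfolding err_bound_def by (simp add: mult.assoc)
  qed
  have exact: "e k \<omega> = u (t k) \<omega> - E k \<omega>"
    if \<omega>: "\<omega> \<in> space M" "y 0 \<omega> = y0" and int: "integral {0..T} (\<lambda>s. (norm (step_proc ts \<xi> s \<omega> + hold s \<omega>))\<^sup>2) \<le> dR"
      and dr: "\<And>k. k < N \<Longrightarrow> \<bar>drift_error ts \<xi> k \<omega>\<bar> \<le> dD * w k" and k: "k \<le> N" for \<omega> k
    using k
  proof (induction k)
    case 0
    then show ?case using \<omega> by (simp add: e0 u_def a_def E_def t0)
  next
    case (Suc k)
    have kN: "k < N" using Suc by simp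
    have "((\<lambda>s. (norm (step_proc ts \<xi> s \<omega> + hold s \<omega>))\<^sup>2) has_integral (\<Sum>i<L. (norm (\<eta> i \<omega>))\<^sup>2 * (g (Suc i) - g i))) {g 0..g L}"
    proof (rule conjunct1[OF has_integral_step])
      show "g i < g (Suc i)" if "i < L" for i using gd(2)[OF that] by simp
      show "(norm (step_proc ts \<xi> s \<omega> + hold s \<omega>))\<^sup>2 = (norm (\<eta> i \<omega>))\<^sup>2"
        if "i < L" "g i \<le> s" "s < g (Suc i)" for i s
        unfolding \<eta>_def g(7)[OF that] hold_const[OF that] ..
    qed
    then have "(\<Sum>i<L. (norm (\<eta> i \<omega>))\<^sup>2 * (g (Suc i) - g i)) \<le> dR"
      using int g(2,3) by (simp add: integral_unique)
    then have vsum: "(\<Sum>i<L. v i \<omega>) \<le> dR" using gd by (simp add: v_def)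
    have \<eta>eq: "\<eta>' i \<omega> = \<eta> i \<omega>" if "i < L" for i
    proof -
      have "(\<Sum>j\<le>i. v j \<omega>) \<le> (\<Sum>i<L. v i \<omega>)" using that by (intro sum_mono2) (auto simp: v_def)
      then show ?thesis using vsum by (simp add: \<eta>'_def)
    qed
    let ?s = "\<lambda>i. step_proc ts \<xi> (g i) \<omega> \<bullet> ?d i \<omega>"
    have tg1: "t k \<in> g ` {..L}" "t (Suc k) \<in> g ` {..L}" using g(4) kN by auto
    \<comment> \<open>With the stopping inactive, the integrand on the block is the step process
      plus \<open>y (t k) * l k\<close>. The second part integrates to
      \<open>y (t k) * dN k\<close>, which after discounting accounts for the term
      \<open>- u * dN\<close> of the recursion.\<close>
    have "r k \<omega> = (\<Sum>i\<in>B k. ?s i + (y (t k) \<omega> *\<^sub>R l k) \<bullet> ?d i \<omega>)"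
      unfolding r_def using blk kN hold_eq[of k]
      by (intro sum.cong refl) (auto simp: \<eta>eq \<eta>_def inner_add_left B_def)
    also have "\<dots> = (\<Sum>i\<in>B k. ?s i) + y (t k) \<omega> * (l k \<bullet> (\<Sum>i\<in>B k. ?d i \<omega>))"
      by (simp add: sum.distrib inner_sum_right sum_distrib_left)
    also have "(\<Sum>i\<in>B k. ?d i \<omega>) = W (t (Suc k)) \<omega> - W (t k) \<omega>"
    proof -
      obtain p p' where p: "p \<le> L" "t k = g p" "p' \<le> L" "t (Suc k) = g p'" using tg kN by (metis Suc_leI less_imp_le_nat)
      have pp: "p \<le> p'" using g_le[of p p'] p t_less[of k] by simp
      have "(\<Sum>i\<in>B k. ?d i \<omega>) = (\<Sum>i<L. if g p \<le> g i \<and> g i < g p' then ?d i \<omega> else 0)"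
        unfolding B_def p(2,4)[symmetric] by (simp add: sum.inter_filter[symmetric])
      also have "\<dots> = W (g p') \<omega> - W (g p) \<omega>"
        by (rule sum_if_between[of L g p p' "\<lambda>i. W (g i) \<omega>", OF g(1) pp p(3)])
      finally show ?thesis unfolding p(2,4) .
    qed
    also have "(\<Sum>i\<in>B k. ?s i) = step_int ts \<xi> W (t (Suc k)) \<omega> - step_int ts \<xi> W (t k) \<omega>"
    proof -
      have "(\<Sum>i\<in>B k. ?s i) = (\<Sum>i<L. if t k \<le> g i \<and> g i < t (Suc k) then ?s i else 0)"
        unfolding B_def by (simp add: sum.inter_filter[symmetric])
      also have "\<dots> = (\<Sum>i<L. (if g i < t (Suc k) then ?s i else 0) - (if g i < t k then ?s i else 0))"
        using t_less[of k] by (intro sum.cong) auto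
      also have "\<dots> = step_int ts \<xi> W (t (Suc k)) \<omega> - step_int ts \<xi> W (t k) \<omega>"
        using g(8)[OF tg1(1), of \<omega>] g(8)[OF tg1(2), of \<omega>] by (simp add: sum_subtractf)
      finally show ?thesis .
    qed
    finally have r_eq: "r k \<omega> = (step_int ts \<xi> W (t (Suc k)) \<omega> - step_int ts \<xi> W (t k) \<omega>) + y (t k) \<omega> * dN k \<omega>"
      by (simp add: dN_def)
    have D_eq: "D k \<omega> = drift_error ts \<xi> k \<omega>" using dr[OF kN] by (auto simp: D_def abs_le_iff max_def min_def)
    have IH: "e k \<omega> = u (t k) \<omega> - E k \<omega>" using Suc by simp
    show ?case unfolding eS IH D_eq drift_error_def R_def r_eq S_def E_Suc x_def
      by (simp add: u_def algebra_simps)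
  qed
  show ?thesis by (rule that[of e]) (use measurable_F_M[OF eF] ei bnd exact in blast)+
qed

end

section \<open>Error estimates along a path and in probability\<close>

lemma square_integrable_step:
  fixes A :: "nat \<Rightarrow> real set" and v :: "nat \<Rightarrow> 'b::euclidean_space"
  assumes A: "\<And>j. A j \<in> sets borel"
  shows "(\<lambda>s. \<Sum>j<n. indicator (A j) s *\<^sub>R v j) \<in> borel_measurable (lebesgue_on {a..b})"
    and "(\<lambda>s. (norm (\<Sum>j<n. indicator (A j) s *\<^sub>R v j))\<^sup>2) integrable_on {a..b}"
proof -
  let ?f = "\<lambda>s. \<Sum>j<n. indicator (A j) s *\<^sub>R v j"
  have "?f \<in> borel_measurable borel" using A by measurable
  then have "?f \<in> borel_measurable lborel" by simp
  then have "?f \<in> borel_measurable lebesgue" by (rule measurable_completion)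
  then show m: "?f \<in> borel_measurable (lebesgue_on {a..b})" by (rule measurable_restrict_space1)
  show "(\<lambda>s. (norm (?f s))\<^sup>2) integrable_on {a..b}"
  proof (rule measurable_bounded_by_integrable_imp_integrable[of _ _ "\<lambda>_. (\<Sum>j<n. norm (v j))\<^sup>2"])
    show "(\<lambda>s. (norm (?f s))\<^sup>2) \<in> borel_measurable (lebesgue_on {a..b})" using m by measurable
    fix s
    have "norm (?f s) \<le> (\<Sum>j<n. norm (v j))"
      by (rule sum_norm_le) (simp add: indicator_def)
    then show "norm ((norm (?f s))\<^sup>2) \<le> (\<Sum>j<n. norm (v j))\<^sup>2" by (simp add: power_mono)
  qed (auto intro: integrable_const_ivl)
qed

text \<open>\<open>ito_integral\<close> does not state that \<open>I 0\<close> vanishes. It follows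
  because the step integrals at time 0 are identically 0 and converge to \<open>I 0\<close> in
  probability, so \<open>I 0 = 0\<close> almost surely.\<close>

lemma (in linear_sde) y_initial: "AE \<omega> in M. y 0 \<omega> = y0"
proof -
  have 0: "0 \<in> {0..T}" using T_pos by simp
  from y_ito obtain ts \<xi> where simple: "\<And>n. simple_adapted M F T (ts n) (\<xi> n)"
    and conv: "\<And>t. t \<in> {0..T} \<Longrightarrow> conv_in_prob M (\<lambda>n. step_int (ts n) (\<xi> n) W t) (I t)"
    unfolding ito_integral_def by blast
  have "step_int (ts n) (\<xi> n) W 0 = (\<lambda>_. 0)" for n
  proof -
    have "finite {0}" "{0} \<subseteq> {0..T}" using T_pos by auto
    then show ?thesis
    proof (rule step_common_refinement[OF simple[of n]], goal_cases)
      case (1 L g)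
      from 1(5) have "0 \<le> g i" if "i \<le> L" for i using that by auto
      moreover have "0 \<in> g ` {..L}" using 1(4) by auto
      ultimately show ?case using 1(8)[of 0] by (intro ext) (auto simp: not_less[symmetric] intro!: sum.neutral)
    qed
  qed
  with conv[OF 0] have I0: "conv_in_prob M (\<lambda>n _. 0) (I 0)" by simp
  then have [measurable]: "I 0 \<in> borel_measurable M" by (simp add: conv_in_prob_def)
  have "prob {\<omega>\<in>space M. e < \<bar>I 0 \<omega>\<bar>} = 0" if "e > 0" for e
    using I0 that unfolding conv_in_prob_def by (auto simp: LIMSEQ_const_iff)
  then have "AE \<omega> in M. \<not> e < \<bar>I 0 \<omega>\<bar>" if "e > 0" for e
    using that by (subst AE_iff_measurable[OF _ refl]) (auto simp: emeasure_eq_measure)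
  then have "AE \<omega> in M. \<forall>n. \<not> 1 / real (Suc n) < \<bar>I 0 \<omega>\<bar>" by (simp add: AE_all_countable)
  moreover have "AE \<omega> in M. y 0 \<omega> = y0 + integral {0..0} (\<lambda>s. q s * y s \<omega>) + I 0 \<omega>" by (rule y_eq[OF 0])
  ultimately show ?thesis
  proof eventually_elim
    case (elim \<omega>)
    have "I 0 \<omega> = 0"
    proof (rule ccontr)
      assume "I 0 \<omega> \<noteq> 0"
      then obtain n where "inverse (real (Suc n)) < \<bar>I 0 \<omega>\<bar>" using reals_Archimedean[of "\<bar>I 0 \<omega>\<bar>"] by auto
      then show False using elim(1) by (simp add: inverse_eq_divide)
    qed
    then show ?case using elim(2) by simp
  qed
qed

context euler
begin

text \<open>Freezing the coefficient replaces \<open>y \<theta>\<close> by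
  \<open>y (t k) * l k\<close>. The discrepancy is \<open>y * (\<theta> - l k)\<close>, controlled
  by the bound \<open>K\<close>, plus \<open>(y - y (t k)) * l k\<close>, controlled by the
  oscillation \<kappa>.\<close>

lemma hold_error:
  assumes \<omega>: "\<omega> \<in> space M" and K: "\<And>s. s \<in> {0..T} \<Longrightarrow> \<bar>y s \<omega>\<bar> \<le> K"
    and osc: "\<And>s r. s \<in> {0..T} \<Longrightarrow> r \<in> {0..T} \<Longrightarrow> \<bar>s - r\<bar> \<le> T / N \<Longrightarrow> \<bar>y s \<omega> - y r \<omega>\<bar> \<le> \<kappa>"
    and simple: "simple_adapted M F T ts \<xi>"
  shows "integral {0..T} (\<lambda>s. (norm (step_proc ts \<xi> s \<omega> + hold s \<omega>))\<^sup>2) \<le>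
    2 * integral {0..T} (\<lambda>s. (norm (step_proc ts \<xi> s \<omega> - - (y s \<omega> *\<^sub>R \<theta> s)))\<^sup>2) +
    4 * (K\<^sup>2 * (\<Sum>k<N. integral {t k..t (Suc k)} (\<lambda>s. (norm (\<theta> s - l k))\<^sup>2)) + \<kappa>\<^sup>2 * (\<Sum>k<N. h k))"
proof -
  define \<phi> where "\<phi> s = - (y s \<omega> *\<^sub>R \<theta> s)" for s
  have ym: "(\<lambda>s. y s \<omega>) \<in> borel_measurable (lebesgue_on {0..T})"
    by (rule continuous_imp_measurable_on_sets_lebesgue[OF y_cont[OF \<omega>]]) simp
  have \<phi>m: "\<phi> \<in> borel_measurable (lebesgue_on {0..T})" unfolding \<phi>_def using ym \<theta>_meas by measurable
  have \<phi>i: "(\<lambda>s. (norm (\<phi> s))\<^sup>2) integrable_on {0..T}"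
  proof (rule measurable_bounded_by_integrable_imp_integrable[of _ _ "\<lambda>s. K\<^sup>2 * (norm (\<theta> s))\<^sup>2"])
    show "(\<lambda>s. (norm (\<phi> s))\<^sup>2) \<in> borel_measurable (lebesgue_on {0..T})" using \<phi>m by measurable
    fix s assume "s \<in> {0..T}"
    then have "\<bar>y s \<omega>\<bar>\<^sup>2 \<le> K\<^sup>2" using K by (intro power_mono) auto
    then show "norm ((norm (\<phi> s))\<^sup>2) \<le> K\<^sup>2 * (norm (\<theta> s))\<^sup>2"
      by (simp add: \<phi>_def power_mult_distrib mult_right_mono)
  qed (auto intro: integrable_on_mult_right \<theta>_int)
  have sm: "(\<lambda>s. step_proc ts \<xi> s \<omega>) \<in> borel_measurable (lebesgue_on {0..T})"
    "(\<lambda>s. (norm (step_proc ts \<xi> s \<omega>))\<^sup>2) integrable_on {0..T}"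
    unfolding step_proc_def by (rule square_integrable_step; simp)+
  have hm: "(\<lambda>s. hold s \<omega>) \<in> borel_measurable (lebesgue_on {0..T})"
    "(\<lambda>s. (norm (hold s \<omega>))\<^sup>2) integrable_on {0..T}"
    unfolding hold_def by (rule square_integrable_step; simp)+
  have m1: "(\<lambda>s. step_proc ts \<xi> s \<omega> - \<phi> s) \<in> borel_measurable (lebesgue_on {0..T})"
    and m2: "(\<lambda>s. - \<phi> s) \<in> borel_measurable (lebesgue_on {0..T})"
    and m3: "(\<lambda>s. - \<phi> s - hold s \<omega>) \<in> borel_measurable (lebesgue_on {0..T})" using sm(1) hm(1) \<phi>m by measurable
  have i1: "(\<lambda>s. (norm (step_proc ts \<xi> s \<omega> - \<phi> s))\<^sup>2) integrable_on {0..T}"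
    by (rule integrable_norm_diff_square(1)[OF sm \<phi>m \<phi>i])
  have i2: "(\<lambda>s. (norm (- \<phi> s))\<^sup>2) integrable_on {0..T}" using \<phi>i by simp
  have i3: "(\<lambda>s. (norm (- \<phi> s - hold s \<omega>))\<^sup>2) integrable_on {0..T}"
    by (rule integrable_norm_diff_square(1)[OF m2 i2 hm])
  have "step_proc ts \<xi> s \<omega> + hold s \<omega> = (step_proc ts \<xi> s \<omega> - \<phi> s) - (- \<phi> s - hold s \<omega>)" for s by simp
  then have "integral {0..T} (\<lambda>s. (norm (step_proc ts \<xi> s \<omega> + hold s \<omega>))\<^sup>2) \<le>
     2 * integral {0..T} (\<lambda>s. (norm (step_proc ts \<xi> s \<omega> - \<phi> s))\<^sup>2) + 2 * integral {0..T} (\<lambda>s. (norm (- \<phi> s - hold s \<omega>))\<^sup>2)"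
    using integrable_norm_diff_square(2)[OF m1 i1 m3 i3] by simp
  moreover have "integral {0..T} (\<lambda>s. (norm (- \<phi> s - hold s \<omega>))\<^sup>2) \<le>
     2 * (K\<^sup>2 * (\<Sum>k<N. integral {t k..t (Suc k)} (\<lambda>s. (norm (\<theta> s - l k))\<^sup>2)) + \<kappa>\<^sup>2 * (\<Sum>k<N. h k))"
  proof -
    have "integral {0..T} (\<lambda>s. (norm (- \<phi> s - hold s \<omega>))\<^sup>2) =
       (\<Sum>k<N. integral {t k..t (Suc k)} (\<lambda>s. (norm (- \<phi> s - hold s \<omega>))\<^sup>2))"
      using sum_integral_grid[of t "\<lambda>s. (norm (- \<phi> s - hold s \<omega>))\<^sup>2" N] i3 t_less by (simp add: t0 tN less_imp_le)
    also have "\<dots> \<le> (\<Sum>k<N. 2 * (K\<^sup>2 * integral {t k..t (Suc k)} (\<lambda>s. (norm (\<theta> s - l k))\<^sup>2) + \<kappa>\<^sup>2 * h k))"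
    proof (rule sum_mono)
      fix k assume "k \<in> {..<N}"
      then have k: "k < N" by simp
      have sub: "{t k..t (Suc k)} \<subseteq> {0..T}" using t_in[of k] t_in[of "Suc k"] k by auto
      have \<theta>k: "\<theta> \<in> borel_measurable (lebesgue_on {t k..t (Suc k)})"
        using \<theta>_meas sub by (rule measurable_restrict_mono)
      have di: "(\<lambda>s. (norm (\<theta> s - l k))\<^sup>2) integrable_on {t k..t (Suc k)}"
      proof (rule integrable_norm_diff_square(1)[where f=\<theta> and g="\<lambda>_. l k"])
        show "(\<lambda>s. (norm (\<theta> s))\<^sup>2) integrable_on {t k..t (Suc k)}"
          using \<theta>_int sub by (rule integrable_subinterval_real)
      qed (auto intro: integrable_const_ivl \<theta>k)
      let ?B = "\<lambda>s. 2 * K\<^sup>2 * (norm (\<theta> s - l k))\<^sup>2 + 2 * \<kappa>\<^sup>2 * (norm (l k))\<^sup>2"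
      have Bi: "?B integrable_on {t k..t (Suc k)}"
        by (intro integrable_add integrable_on_mult_right di integrable_const_ivl)
      \<comment> \<open>At the right endpoint \<open>hold\<close> already has the value of the next
        cell; this single point is altered without changing the integral.\<close>
      have "integral {t k..t (Suc k)} (\<lambda>s. (norm (- \<phi> s - hold s \<omega>))\<^sup>2) =
         integral {t k..t (Suc k)} (\<lambda>s. if s = t (Suc k) then 0 else (norm (- \<phi> s - hold s \<omega>))\<^sup>2)"
        by (rule integral_spike[of "{t (Suc k)}"]) auto
      also have "\<dots> \<le> integral {t k..t (Suc k)} ?B"
      proof (rule integral_le[OF _ Bi])
        show "(\<lambda>s. if s = t (Suc k) then 0 else (norm (- \<phi> s - hold s \<omega>))\<^sup>2) integrable_on {t k..t (Suc k)}"
          by (rule integrable_spike[OF integrable_subinterval_real[OF i3 sub], of "{t (Suc k)}"]) auto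
        fix s assume s: "s \<in> {t k..t (Suc k)}"
        show "(if s = t (Suc k) then 0 else (norm (- \<phi> s - hold s \<omega>))\<^sup>2) \<le> ?B s"
        proof (cases "s = t (Suc k)")
          case False
          let ?A = "y s \<omega> *\<^sub>R (\<theta> s - l k)" and ?C = "(y s \<omega> - y (t k) \<omega>) *\<^sub>R l k"
          have sT: "s \<in> {0..T}" "t k \<in> {0..T}" using s sub t_in[of k] k by auto
          have "- \<phi> s - hold s \<omega> = ?A + ?C"
            using hold_eq[OF k, of s \<omega>] s False by (simp add: \<phi>_def algebra_simps)
          then have "(norm (- \<phi> s - hold s \<omega>))\<^sup>2 \<le> (norm ?A + norm ?C)\<^sup>2"
            by (metis norm_ge_zero norm_triangle_ineq power_mono)
          also have "\<dots> \<le> 2 * (norm ?A)\<^sup>2 + 2 * (norm ?C)\<^sup>2"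
            using sum_squares_bound[of "norm ?A" "norm ?C"] by (simp add: power2_sum)
          also have "\<dots> \<le> 2 * (K\<^sup>2 * (norm (\<theta> s - l k))\<^sup>2) + 2 * (\<kappa>\<^sup>2 * (norm (l k))\<^sup>2)"
          proof (intro add_mono mult_left_mono)
            have "\<bar>y s \<omega>\<bar>\<^sup>2 \<le> K\<^sup>2" using K[OF sT(1)] by (intro power_mono) auto
            then show "(norm ?A)\<^sup>2 \<le> K\<^sup>2 * (norm (\<theta> s - l k))\<^sup>2" by (simp add: power_mult_distrib mult_right_mono)
            have "\<bar>y s \<omega> - y (t k) \<omega>\<bar> \<le> \<kappa>" using osc[OF sT] s t_Suc[of k] by auto
            then have "\<bar>y s \<omega> - y (t k) \<omega>\<bar>\<^sup>2 \<le> \<kappa>\<^sup>2" by (intro power_mono) auto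
            then show "(norm ?C)\<^sup>2 \<le> \<kappa>\<^sup>2 * (norm (l k))\<^sup>2" by (simp add: power_mult_distrib mult_right_mono)
          qed auto
          finally show ?thesis using False by simp
        qed simp
      qed
      also have "\<dots> = 2 * (K\<^sup>2 * integral {t k..t (Suc k)} (\<lambda>s. (norm (\<theta> s - l k))\<^sup>2) + \<kappa>\<^sup>2 * h k)"
        using di t_less[of k] by (subst Henstock_Kurzweil_Integration.integral_add)
          (auto intro!: integrable_on_mult_right integrable_const_ivl simp: h_def algebra_simps)
      finally show "integral {t k..t (Suc k)} (\<lambda>s. (norm (- \<phi> s - hold s \<omega>))\<^sup>2) \<le>
        2 * (K\<^sup>2 * integral {t k..t (Suc k)} (\<lambda>s. (norm (\<theta> s - l k))\<^sup>2) + \<kappa>\<^sup>2 * h k)" .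
    qed
    also have "\<dots> = 2 * (K\<^sup>2 * (\<Sum>k<N. integral {t k..t (Suc k)} (\<lambda>s. (norm (\<theta> s - l k))\<^sup>2)) + \<kappa>\<^sup>2 * (\<Sum>k<N. h k))"
      by (simp add: sum_distrib_left sum.distrib)
    finally show ?thesis .
  qed
  ultimately show ?thesis unfolding \<phi>_def by linarith
qed

text \<open>Writing the drift integral around the right endpoint value makes it cancel
  \<open>exp (- \<Delta>) - 1\<close> to first order. There remain a quadratic Taylor term, the
  oscillation of \<open>y\<close> within the step, and the error \<open>J\<close> of the step
  integral.\<close>

lemma drift_error_bound:
  assumes \<omega>: "\<omega> \<in> space M" and K: "\<And>s. s \<in> {0..T} \<Longrightarrow> \<bar>y s \<omega>\<bar> \<le> K"
    and osc: "\<And>s r. s \<in> {0..T} \<Longrightarrow> r \<in> {0..T} \<Longrightarrow> \<bar>s - r\<bar> \<le> T / N \<Longrightarrow> \<bar>y s \<omega> - y r \<omega>\<bar> \<le> \<kappa>"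
    and \<alpha>: "\<bar>a (t (Suc k)) - a (t k)\<bar> \<le> \<alpha>" "\<alpha> \<le> 1"
    and Ca: "exp (- a (t k)) \<le> Ca" and k: "k < N"
    and eq: "\<And>j. j \<le> N \<Longrightarrow> y (t j) \<omega> = y0 + integral {0..t j} (\<lambda>s. q s * y s \<omega>) + I (t j) \<omega>"
    and close: "\<And>j. j \<le> N \<Longrightarrow> \<bar>step_int ts \<xi> W (t j) \<omega> - I (t j) \<omega>\<bar> \<le> \<kappa> * (T / N) / (2 * Ca)"
  shows "\<bar>drift_error ts \<xi> k \<omega>\<bar> \<le> (Ca * (\<alpha> * K + \<kappa>) + \<kappa>) * w k"
proof -
  let ?b = "{t k..t (Suc k)}"
  let ?y' = "y (t (Suc k)) \<omega>"
  have Ca0: "0 < Ca" using Ca exp_gt_zero[of "- a (t k)"] by linarith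
  have tk: "t k \<in> {0..T}" "t (Suc k) \<in> {0..T}" using t_in k by auto
  have \<kappa>0: "0 \<le> \<kappa>" using osc[OF tk(1) tk(1)] TN by simp
  have sub: "?b \<subseteq> {0..T}" using tk by auto
  have qy: "(\<lambda>s. q s * y s \<omega>) integrable_on {0..T}"
    using absolutely_integrable_mult_continuous[OF q_int y_cont[OF \<omega>]]
    by (simp add: absolutely_integrable_on_def mult.commute)
  have split: "integral {0..t (Suc k)} f - integral {0..t k} f = integral ?b f" if "f integrable_on {0..T}" for f :: "real \<Rightarrow> real"
    using Henstock_Kurzweil_Integration.integral_combine[of 0 "t k" "t (Suc k)" f]
      integrable_subinterval_real[OF that, of 0 "t (Suc k)"] tk t_less[of k] by auto
  define \<Delta> where "\<Delta> = a (t (Suc k)) - a (t k)"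
  define J where "J = (I (t (Suc k)) \<omega> - I (t k) \<omega>) - (step_int ts \<xi> W (t (Suc k)) \<omega> - step_int ts \<xi> W (t k) \<omega>)"
  have qb: "q integrable_on ?b" "(\<lambda>s. \<bar>q s\<bar>) integrable_on ?b" "(\<lambda>s. q s * y s \<omega>) integrable_on ?b"
    using integrable_subinterval_real[OF _ sub] q_int qy by (auto simp: absolutely_integrable_on_def)
  have \<Delta>: "\<Delta> = integral ?b q" unfolding \<Delta>_def a_def by (rule split[OF q_integrable(1)])
  have Qw: "integral ?b (\<lambda>s. \<bar>q s\<bar>) \<le> w k" unfolding w_def
    by (intro integral_le qb integrable_subinterval_real[OF q_integrable(2) sub]) auto
  have \<Delta>w: "\<bar>\<Delta>\<bar> \<le> w k"
    using integral_norm_bound_integral[OF qb(1,2)] Qw by (simp add: \<Delta>)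
  define X where "X = integral ?b (\<lambda>s. q s * (y s \<omega> - ?y'))"
  have "integral ?b (\<lambda>s. q s * y s \<omega> - q s * ?y') = integral ?b (\<lambda>s. q s * y s \<omega>) - integral ?b (\<lambda>s. q s * ?y')"
    by (intro Henstock_Kurzweil_Integration.integral_diff qb integrable_on_mult_left)
  then have "integral ?b (\<lambda>s. q s * y s \<omega>) = X + \<Delta> * ?y'"
    by (simp add: \<Delta> X_def right_diff_distrib)
  then have yk: "y (t k) \<omega> = ?y' - (X + \<Delta> * ?y') - (I (t (Suc k)) \<omega> - I (t k) \<omega>)"
    using eq[of k] eq[of "Suc k"] k split[OF qy] by simp
  have "exp (- a (t (Suc k))) = exp (- a (t k)) * exp (- \<Delta>)"
    by (simp add: \<Delta>_def exp_add[symmetric])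
  then have eq: "drift_error ts \<xi> k \<omega> =
     exp (- a (t k)) * ((exp (- \<Delta>) - 1 - (- \<Delta>)) * ?y' + X + J)"
    unfolding drift_error_def u_def J_def yk by (simp add: algebra_simps)
  have "\<bar>exp (- \<Delta>) - 1 - (- \<Delta>)\<bar> \<le> (- \<Delta>)\<^sup>2" using \<alpha> by (intro abs_exp_minus_linear_le) (simp add: \<Delta>_def)
  also have "\<dots> = \<bar>\<Delta>\<bar> * \<bar>\<Delta>\<bar>" by (simp add: power2_eq_square)
  also have "\<dots> \<le> \<alpha> * w k" using \<alpha> \<Delta>w by (intro mult_mono) (auto simp: \<Delta>_def)
  finally have "\<bar>(exp (- \<Delta>) - 1 - (- \<Delta>)) * ?y'\<bar> \<le> (\<alpha> * w k) * K"
    unfolding abs_mult using K[OF tk(2)] by (intro mult_mono) auto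
  moreover have "\<bar>X\<bar> \<le> \<kappa> * w k"
  proof -
    have "norm (integral ?b (\<lambda>s. q s * (y s \<omega> - ?y'))) \<le> integral ?b (\<lambda>s. \<kappa> * \<bar>q s\<bar>)"
    proof (rule integral_norm_bound_integral)
      show "(\<lambda>s. q s * (y s \<omega> - ?y')) integrable_on ?b"
        unfolding right_diff_distrib by (intro integrable_diff qb integrable_on_mult_left)
      show "(\<lambda>s. \<kappa> * \<bar>q s\<bar>) integrable_on ?b" by (intro integrable_on_mult_right qb)
      fix s assume s: "s \<in> ?b"
      then have "\<bar>y s \<omega> - ?y'\<bar> \<le> \<kappa>" using osc[of s "t (Suc k)"] tk sub t_Suc[of k] by auto
      then have "\<bar>q s\<bar> * \<bar>y s \<omega> - ?y'\<bar> \<le> \<bar>q s\<bar> * \<kappa>" by (intro mult_left_mono) auto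
      then show "norm (q s * (y s \<omega> - ?y')) \<le> \<kappa> * \<bar>q s\<bar>" by (simp add: abs_mult mult.commute)
    qed
    also have "\<dots> \<le> \<kappa> * w k" using Qw \<kappa>0 by (simp add: mult_left_mono)
    finally show ?thesis by (simp add: X_def)
  qed
  \<comment> \<open>The assumed closeness is scaled for this: the 2 counts the two endpoints,
    \<open>Ca\<close> compensates the discount factor, and \<open>T / N \<le> w k\<close>.\<close>
  moreover have "\<bar>J\<bar> \<le> \<kappa> * w k / Ca"
  proof -
    have "\<bar>J\<bar> \<le> 2 * (\<kappa> * (T / N) / (2 * Ca))" unfolding J_def using close[of k] close[of "Suc k"] k by linarith
    also have "\<dots> = \<kappa> * (T / N) / Ca" by simp
    also have "\<dots> \<le> \<kappa> * w k / Ca" using w_lower[OF k] \<kappa>0 Ca0 by (intro divide_right_mono mult_left_mono) auto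
    finally show ?thesis .
  qed
  ultimately have "\<bar>(exp (- \<Delta>) - 1 - (- \<Delta>)) * ?y' + X + J\<bar>
     \<le> (\<alpha> * w k) * K + \<kappa> * w k + \<kappa> * w k / Ca" by linarith
  then have "\<bar>drift_error ts \<xi> k \<omega>\<bar> \<le> Ca * ((\<alpha> * w k) * K + \<kappa> * w k + \<kappa> * w k / Ca)"
    unfolding eq abs_mult using Ca Ca0 by (intro mult_mono) auto
  also have "\<dots> = (Ca * (\<alpha> * K + \<kappa>) + \<kappa>) * w k" using Ca0 by (simp add: field_simps)
  finally show ?thesis .
qed

text \<open>On \<open>G\<close>, and where the step approximations are close, the truncations of
  \<open>euler_approx\<close> are inactive, so \<open>e\<close> is the true error and Markov's
  inequality for its square applies. The step processes are refined while the Euler grid stays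
  fixed, so finitely many failure probabilities tend to 0.\<close>

lemma euler_estimate:
  assumes G: "G \<in> sets M" and GK: "\<And>\<omega> s. \<omega> \<in> G \<Longrightarrow> s \<in> {0..T} \<Longrightarrow> \<bar>y s \<omega>\<bar> \<le> K"
    and Gosc: "\<And>\<omega> s r. \<omega> \<in> G \<Longrightarrow> s \<in> {0..T} \<Longrightarrow> r \<in> {0..T} \<Longrightarrow> \<bar>s - r\<bar> \<le> T / N \<Longrightarrow> \<bar>y s \<omega> - y r \<omega>\<bar> \<le> \<kappa>"
    and \<kappa>: "\<kappa> > 0" and \<epsilon>: "\<epsilon> > 0" and K: "0 \<le> K" and k: "k \<le> N"
    and \<alpha>: "\<And>j. j < N \<Longrightarrow> \<bar>a (t (Suc j)) - a (t j)\<bar> \<le> \<alpha>" "0 \<le> \<alpha>" "\<alpha> \<le> 1"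
    and Ca: "\<And>s. s \<in> {0..T} \<Longrightarrow> exp (- a s) \<le> Ca"
  defines "dR \<equiv> 2 * \<kappa> + 4 * (K\<^sup>2 * (\<Sum>k<N. integral {t k..t (Suc k)} (\<lambda>s. (norm (\<theta> s - l k))\<^sup>2)) + \<kappa>\<^sup>2 * (\<Sum>k<N. h k))"
    and "dD \<equiv> Ca * (\<alpha> * K + \<kappa>) + \<kappa>"
  shows "prob {\<omega>\<in>space M. \<epsilon> < \<bar>u (t k) \<omega> - E k \<omega>\<bar>} \<le> prob (space M - G) + err_bound Ca dR dD / \<epsilon>\<^sup>2"
proof -
  from y_ito obtain ts \<xi> where simple: "\<And>n. simple_adapted M F T (ts n) (\<xi> n)"
    and c1: "conv_in_prob M (\<lambda>n \<omega>. integral {0..T} (\<lambda>s. (norm (step_proc (ts n) (\<xi> n) s \<omega> - - (y s \<omega> *\<^sub>R \<theta> s)))\<^sup>2)) (\<lambda>_. 0)"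
    and c2: "\<And>s. s \<in> {0..T} \<Longrightarrow> conv_in_prob M (\<lambda>n. step_int (ts n) (\<xi> n) W s) (I s)"
    unfolding ito_integral_def by blast
  have Ca0: "0 < Ca" using Ca[of 0] exp_gt_zero[of "- a 0"] T_pos by (smt (verit) atLeastAtMost_iff)
  have dD0: "0 \<le> dD" unfolding dD_def using Ca0 \<alpha>(2) K \<kappa> by (intro add_nonneg_nonneg mult_nonneg_nonneg) auto
  have dR0: "0 \<le> dR"
  proof -
    have "0 \<le> integral {t k..t (Suc k)} (\<lambda>s. (norm (\<theta> s - l k))\<^sup>2)" for k
      by (cases "(\<lambda>s. (norm (\<theta> s - l k))\<^sup>2) integrable_on {t k..t (Suc k)}")
        (auto intro: integral_nonneg simp: not_integrable_integral)
    then show ?thesis unfolding dR_def using \<kappa>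
      by (intro add_nonneg_nonneg mult_nonneg_nonneg sum_nonneg) (auto intro: h_nonneg)
  qed
  define X where "X n \<omega> = integral {0..T} (\<lambda>s. (norm (step_proc (ts n) (\<xi> n) s \<omega> - - (y s \<omega> *\<^sub>R \<theta> s)))\<^sup>2)" for n \<omega>
  define Y where "Y n j \<omega> = step_int (ts n) (\<xi> n) W (t j) \<omega> - I (t j) \<omega>" for n j \<omega>
  define \<kappa>' where "\<kappa>' = \<kappa> * (T / N) / (2 * Ca)"
  have \<kappa>': "\<kappa>' > 0" unfolding \<kappa>'_def using \<kappa> T_pos N_pos Ca0 by (intro divide_pos_pos mult_pos_pos) auto
  define B1 where "B1 n = {\<omega>\<in>space M. \<kappa> < \<bar>X n \<omega> - 0\<bar>}" for n
  define B2 where "B2 n j = {\<omega>\<in>space M. \<kappa>' < \<bar>step_int (ts n) (\<xi> n) W (t j) \<omega> - I (t j) \<omega>\<bar>}" for n j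
  have X_meas: "X n \<in> borel_measurable M" for n using c1 unfolding conv_in_prob_def X_def[abs_def] by blast
  have si_meas: "step_int (ts n) (\<xi> n) W (t j) \<in> borel_measurable M" "I (t j) \<in> borel_measurable M" if "j \<le> N" for n j
    using c2[OF t_in[OF that]] unfolding conv_in_prob_def by auto
  have B1m: "B1 n \<in> sets M" for n unfolding B1_def using X_meas[of n] by measurable
  have B2m: "B2 n j \<in> sets M" if "j \<le> N" for n j unfolding B2_def using si_meas(1)[OF that, of n] si_meas(2)[OF that] by measurable
  have B1c: "(\<lambda>n. prob (B1 n)) \<longlonglongrightarrow> 0"
    using c1 \<kappa> unfolding conv_in_prob_def B1_def X_def by auto
  have B2c: "(\<lambda>n. prob (B2 n j)) \<longlonglongrightarrow> 0" if "j \<le> N" for j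
    using c2[OF t_in[OF that]] \<kappa>' unfolding conv_in_prob_def B2_def by auto
  have AE: "AE \<omega> in M. y 0 \<omega> = y0 \<and> (\<forall>j\<in>{..N}. y (t j) \<omega> = y0 + integral {0..t j} (\<lambda>s. q s * y s \<omega>) + I (t j) \<omega>)"
    using y_initial by (intro AE_conjI AE_finite_allI y_eq t_in) auto
  have bound: "prob {\<omega>\<in>space M. \<epsilon> < \<bar>u (t k) \<omega> - E k \<omega>\<bar>} \<le>
    prob (space M - G) + (prob (B1 n) + (\<Sum>j\<le>N. prob (B2 n j))) + err_bound Ca dR dD / \<epsilon>\<^sup>2" for n
  proof -
    obtain e where e: "\<And>k. k \<le> N \<Longrightarrow> e k \<in> borel_measurable M"
      "\<And>k. k \<le> N \<Longrightarrow> integrable M (\<lambda>\<omega>. (e k \<omega>)\<^sup>2)"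
      "\<And>k. k \<le> N \<Longrightarrow> expectation (\<lambda>\<omega>. (e k \<omega>)\<^sup>2) \<le> err_bound Ca dR dD"
      "\<And>\<omega> k. \<omega> \<in> space M \<Longrightarrow> y 0 \<omega> = y0 \<Longrightarrow> integral {0..T} (\<lambda>s. (norm (step_proc (ts n) (\<xi> n) s \<omega> + hold s \<omega>))\<^sup>2) \<le> dR \<Longrightarrow>
       (\<And>k. k < N \<Longrightarrow> \<bar>drift_error (ts n) (\<xi> n) k \<omega>\<bar> \<le> dD * w k) \<Longrightarrow> k \<le> N \<Longrightarrow> e k \<omega> = u (t k) \<omega> - E k \<omega>"
      using euler_approx[OF simple[of n] dR0 dD0 Ca[OF t_in]] by blast
    let ?B = "(space M - G) \<union> (B1 n \<union> (\<Union>j\<le>N. B2 n j)) \<union> {\<omega>\<in>space M. \<epsilon>\<^sup>2 \<le> (e k \<omega>)\<^sup>2}"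
    note [measurable] = e(1)[OF k]
    have m: "space M - G \<in> sets M" "B1 n \<in> sets M" "(\<Union>j\<le>N. B2 n j) \<in> sets M" "{\<omega>\<in>space M. \<epsilon>\<^sup>2 \<le> (e k \<omega>)\<^sup>2} \<in> sets M"
      using G B1m B2m by auto
    have "prob {\<omega>\<in>space M. \<epsilon> < \<bar>u (t k) \<omega> - E k \<omega>\<bar>} \<le> prob ?B"
    proof (rule finite_measure_mono_AE)
      show "AE \<omega> in M. \<omega> \<in> {\<omega>\<in>space M. \<epsilon> < \<bar>u (t k) \<omega> - E k \<omega>\<bar>} \<longrightarrow> \<omega> \<in> ?B"
        using AE
      proof eventually_elim
        case (elim \<omega>)
        show ?case
        proof (intro impI, rule ccontr)
          assume A: "\<omega> \<in> {\<omega>\<in>space M. \<epsilon> < \<bar>u (t k) \<omega> - E k \<omega>\<bar>}" and nB: "\<omega> \<notin> ?B"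
          have \<omega>: "\<omega> \<in> space M" "\<omega> \<in> G" and nB1: "\<bar>X n \<omega>\<bar> \<le> \<kappa>" and nB2: "\<And>j. j \<le> N \<Longrightarrow> \<bar>step_int (ts n) (\<xi> n) W (t j) \<omega> - I (t j) \<omega>\<bar> \<le> \<kappa>'"
            and ne: "(e k \<omega>)\<^sup>2 < \<epsilon>\<^sup>2"
            using A nB by (auto simp: B1_def B2_def not_less not_le)
          note GK' = GK[OF \<omega>(2)] and Gosc' = Gosc[OF \<omega>(2)]
          have "e k \<omega> = u (t k) \<omega> - E k \<omega>"
          proof (rule e(4)[OF \<omega>(1) _ _ _ k])
            show "y 0 \<omega> = y0" using elim by simp
            show "integral {0..T} (\<lambda>s. (norm (step_proc (ts n) (\<xi> n) s \<omega> + hold s \<omega>))\<^sup>2) \<le> dR"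
              using hold_error[OF \<omega>(1) GK' Gosc' simple[of n]] nB1 unfolding dR_def X_def by linarith
            show "\<bar>drift_error (ts n) (\<xi> n) k \<omega>\<bar> \<le> dD * w k" if "k < N" for k
              unfolding dD_def
              by (rule drift_error_bound[OF \<omega>(1) GK' Gosc' \<alpha>(1)[OF that] \<alpha>(3) Ca[OF t_in] that _ nB2[unfolded \<kappa>'_def]])
                (use elim that in auto)
          qed
          then have "\<epsilon> < \<bar>e k \<omega>\<bar>" using A by simp
          then have "\<epsilon>\<^sup>2 \<le> \<bar>e k \<omega>\<bar>\<^sup>2" using \<epsilon> by (intro power_mono) auto
          then show False using ne by simp
        qed
      qed
      show "?B \<in> sets M" using m by auto
    qed
    also have "\<dots> \<le> prob (space M - G) + (prob (B1 n) + prob (\<Union>j\<le>N. B2 n j)) + prob {\<omega>\<in>space M. \<epsilon>\<^sup>2 \<le> (e k \<omega>)\<^sup>2}"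
      using measure_Un_le[of "(space M - G) \<union> (B1 n \<union> (\<Union>j\<le>N. B2 n j))" M "{\<omega>\<in>space M. \<epsilon>\<^sup>2 \<le> (e k \<omega>)\<^sup>2}"]
        measure_Un_le[of "space M - G" M "B1 n \<union> (\<Union>j\<le>N. B2 n j)"] measure_Un_le[of "B1 n" M "\<Union>j\<le>N. B2 n j"] m
      by (auto simp del: UN_simps)
    also have "prob (\<Union>j\<le>N. B2 n j) \<le> (\<Sum>j\<le>N. prob (B2 n j))"
      by (rule finite_measure_subadditive_finite) (use B2m in auto)
    also have "prob {\<omega>\<in>space M. \<epsilon>\<^sup>2 \<le> (e k \<omega>)\<^sup>2} \<le> expectation (\<lambda>\<omega>. (e k \<omega>)\<^sup>2) / \<epsilon>\<^sup>2"
      by (rule integral_Markov_inequality_measure[OF e(2)[OF k], where A="{}"]) (use \<epsilon> in auto)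
    also have "\<dots> \<le> err_bound Ca dR dD / \<epsilon>\<^sup>2" using e(3)[OF k] by (intro divide_right_mono) auto
    finally show ?thesis by simp
  qed
  have "(\<lambda>n. prob (space M - G) + (prob (B1 n) + (\<Sum>j\<le>N. prob (B2 n j))) + err_bound Ca dR dD / \<epsilon>\<^sup>2) \<longlonglongrightarrow>
     prob (space M - G) + (0 + (\<Sum>j\<le>N. 0)) + err_bound Ca dR dD / \<epsilon>\<^sup>2"
    by (intro tendsto_intros B1c B2c) auto
  then show ?thesis using bound by (intro LIMSEQ_le_const[of _ _ _]) auto
qed

text \<open>Quantities that depend on the grid are replaced by bounds that can be fixed before it.
  The Euler defects become \<open>\<eta> * H\<close> because
  \<open>exp h - 1 - h \<le> h\<^sup>2 \<le> \<eta> * h\<close>.\<close>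

lemma err_bound_le:
  assumes H: "(\<Sum>k<N. h k) \<le> H" and \<eta>: "\<And>k. k < N \<Longrightarrow> h k \<le> \<eta>" "\<eta> \<le> 1" and dR: "0 \<le> dR" "dR \<le> dR'"
    and dD: "0 \<le> dD" "dD \<le> dD'"
  defines "V \<equiv> integral {0..T} (\<lambda>s. 1 + \<bar>q s\<bar>)"
  shows "err_bound Ca dR dD \<le> exp (V + 2 * H) * (1 + V) * (4 * (Ca\<^sup>2 * dR' + y0\<^sup>2 * exp H * (\<eta> * H)) + dD'\<^sup>2 * V)"
proof -
  have V: "(\<Sum>k<N. w k) = V" unfolding w_def V_def
    using sum_integral_grid[of t "\<lambda>s. 1 + \<bar>q s\<bar>" N] q_integrable(2) t_less by (simp add: t0 tN less_imp_le)
  have V0: "0 \<le> V" unfolding V[symmetric] by (intro sum_nonneg w_nonneg)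
  have "\<eta> \<ge> 0" using \<eta>(1)[of 0] h_nonneg[of 0] N_pos by linarith
  have s: "(\<Sum>k<N. exp (h k) - 1 - h k) \<le> \<eta> * H"
  proof -
    have "exp (h k) - 1 - h k \<le> \<eta> * h k" if "k < N" for k
    proof -
      have "exp (h k) - 1 - h k \<le> (h k)\<^sup>2" using abs_exp_minus_linear_le[of "h k"] \<eta>(1)[OF that] \<eta>(2) h_nonneg[of k] by simp
      also have "\<dots> = h k * h k" by (simp add: power2_eq_square)
      also have "\<dots> \<le> \<eta> * h k" using \<eta>(1)[OF that] h_nonneg[of k] by (intro mult_right_mono)
      finally show ?thesis .
    qed
    then have "(\<Sum>k<N. exp (h k) - 1 - h k) \<le> (\<Sum>k<N. \<eta> * h k)" by (intro sum_mono) auto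
    also have "\<dots> \<le> \<eta> * H" unfolding sum_distrib_left[symmetric] using H \<open>\<eta> \<ge> 0\<close> by (intro mult_left_mono)
    finally show ?thesis .
  qed
  have s0: "0 \<le> (\<Sum>k<N. exp (h k) - 1 - h k)"
    by (intro sum_nonneg) (use exp_ge_add_one_self in \<open>simp add: algebra_simps\<close>)
  have e2: "exp (V + 2 * (\<Sum>k<N. h k)) \<le> exp (V + 2 * H)" using H by simp
  have e1: "exp (\<Sum>k<N. h k) \<le> exp H" using H by simp
  have i1: "y0\<^sup>2 * exp (\<Sum>k<N. h k) * (\<Sum>k<N. exp (h k) - 1 - h k) \<le> y0\<^sup>2 * exp H * (\<eta> * H)"
    using e1 s s0 by (intro mult_mono) auto
  have i2: "Ca\<^sup>2 * dR \<le> Ca\<^sup>2 * dR'" using dR by (intro mult_left_mono) auto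
  have i3: "dD\<^sup>2 * V \<le> dD'\<^sup>2 * V" using dD V0 by (intro mult_right_mono power_mono) auto
  have i4: "0 \<le> 4 * (Ca\<^sup>2 * dR + y0\<^sup>2 * exp (\<Sum>k<N. h k) * (\<Sum>k<N. exp (h k) - 1 - h k)) + dD\<^sup>2 * V"
    using dR s0 V0 by (intro add_nonneg_nonneg mult_nonneg_nonneg) auto
  show ?thesis unfolding err_bound_def V
    by (rule mult_mono[OF mult_right_mono[OF e2]]) (use i1 i2 i3 i4 V0 in auto)
qed

text \<open>The difference of the squared norms of \<open>l k\<close> and \<theta> is at most
  \<open>x * (x + 2 * norm (\<theta> s))\<close> with \<open>x = norm (\<theta> s - l k)\<close>,
  and Young's inequality with weight \<open>c\<close> splits the product. Since \<open>c\<close> is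
  free, it can be fixed small before the grid is refined.\<close>

lemma sum_h_error:
  assumes c: "c > 0" and ij: "i \<le> j" "j \<le> N"
  shows "\<bar>(\<Sum>k=i..<j. h k) - integral {t i..t j} (\<lambda>s. (norm (\<theta> s))\<^sup>2)\<bar> \<le>
    (1 + 1 / c) * (\<Sum>k<N. integral {t k..t (Suc k)} (\<lambda>s. (norm (\<theta> s - l k))\<^sup>2)) + c * integral {0..T} (\<lambda>s. (norm (\<theta> s))\<^sup>2)"
proof -
  let ?\<theta> = "\<lambda>s. (norm (\<theta> s))\<^sup>2" and ?d = "\<lambda>k s. (norm (\<theta> s - l k))\<^sup>2"
  let ?\<Theta> = "\<lambda>k. integral {t k..t (Suc k)} ?\<theta>" and ?D = "\<lambda>k. integral {t k..t (Suc k)} (?d k)"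
  have int: "?\<theta> integrable_on {t k..t (Suc k)}" "?d k integrable_on {t k..t (Suc k)}" if k: "k < N" for k
  proof -
    have sub: "{t k..t (Suc k)} \<subseteq> {0..T}" using t_in[of k] t_in[of "Suc k"] k by auto
    show 1: "?\<theta> integrable_on {t k..t (Suc k)}" using \<theta>_int sub by (rule integrable_subinterval_real)
    have "\<theta> \<in> borel_measurable (lebesgue_on {t k..t (Suc k)})" using \<theta>_meas sub by (rule measurable_restrict_mono)
    then show "?d k integrable_on {t k..t (Suc k)}"
      by (intro integrable_norm_diff_square(1)[where f=\<theta> and g="\<lambda>_. l k"] 1) (auto intro: integrable_const_ivl)
  qed
  have blk: "\<bar>h k - ?\<Theta> k\<bar> \<le> (1 + 1 / c) * ?D k + c * ?\<Theta> k" if k: "k < N" for k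
  proof -
    have hk: "h k = integral {t k..t (Suc k)} (\<lambda>_. (norm (l k))\<^sup>2)" using t_less[of k] by (simp add: h_def)
    have "h k - ?\<Theta> k = integral {t k..t (Suc k)} (\<lambda>s. (norm (l k))\<^sup>2 - ?\<theta> s)"
      unfolding hk by (intro Henstock_Kurzweil_Integration.integral_diff[symmetric] int(1)[OF k] integrable_const_ivl)
    moreover have "norm (integral {t k..t (Suc k)} (\<lambda>s. (norm (l k))\<^sup>2 - ?\<theta> s)) \<le>
       integral {t k..t (Suc k)} (\<lambda>s. (1 + 1 / c) * ?d k s + c * ?\<theta> s)"
    proof (rule integral_norm_bound_integral)
      show "(\<lambda>s. (norm (l k))\<^sup>2 - ?\<theta> s) integrable_on {t k..t (Suc k)}"
        by (intro integrable_diff int(1)[OF k] integrable_const_ivl)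
      show "(\<lambda>s. (1 + 1 / c) * ?d k s + c * ?\<theta> s) integrable_on {t k..t (Suc k)}"
        by (intro integrable_add integrable_on_mult_right int[OF k])
      fix s
      define A B x where "A = norm (l k)" and "B = norm (\<theta> s)" and "x = norm (\<theta> s - l k)"
      have x: "\<bar>A - B\<bar> \<le> x" unfolding A_def B_def x_def by (metis abs_minus_commute norm_triangle_ineq3)
      have AB: "0 \<le> A" "0 \<le> B" by (auto simp: A_def B_def)
      have x0: "0 \<le> x" by (simp add: x_def)
      have "\<bar>A\<^sup>2 - B\<^sup>2\<bar> = \<bar>A - B\<bar> * (A + B)"
        using AB by (simp add: power2_eq_square square_diff_square_factored abs_mult mult.commute)
      also have "\<dots> \<le> x * (x + 2 * B)" using x AB x0 by (intro mult_mono) auto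
      also have "\<dots> = x\<^sup>2 + 2 * (x * B)" by (simp add: power2_eq_square algebra_simps)
      also have "2 * (x * B) \<le> (1 / c) * x\<^sup>2 + c * B\<^sup>2"
      proof -
        have "0 \<le> (x - c * B)\<^sup>2 / c" using c by simp
        also have "(x - c * B)\<^sup>2 / c = (1 / c) * x\<^sup>2 + c * B\<^sup>2 - 2 * (x * B)"
          using c by (simp add: power2_eq_square field_simps)
        finally show ?thesis by simp
      qed
      finally show "norm ((norm (l k))\<^sup>2 - ?\<theta> s) \<le> (1 + 1 / c) * ?d k s + c * ?\<theta> s"
        by (simp add: A_def B_def x_def distrib_right)
    qed
    moreover have "integral {t k..t (Suc k)} (\<lambda>s. (1 + 1 / c) * ?d k s + c * ?\<theta> s) = (1 + 1 / c) * ?D k + c * ?\<Theta> k"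
      using int[OF k] by (subst Henstock_Kurzweil_Integration.integral_add) (auto intro!: integrable_on_mult_right)
    ultimately show ?thesis by simp
  qed
  have D0: "0 \<le> ?D k" "0 \<le> ?\<Theta> k" if "k < N" for k using int[OF that] by (auto intro: integral_nonneg)
  have sub: "{t i..t j} \<subseteq> {0..T}" using t_in[of i] t_in[of j] ij by auto
  have "integral {t i..t j} ?\<theta> = (\<Sum>k=i..<j. ?\<Theta> k)"
  proof -
    have "(\<Sum>k<j - i. integral {t (i + k)..t (Suc (i + k))} ?\<theta>) = integral {t (i + 0)..t (i + (j - i))} ?\<theta>"
      using sum_integral_grid[of "\<lambda>k. t (i + k)" ?\<theta> "j - i"] t_less ij integrable_subinterval_real[OF \<theta>_int sub]
      by (simp add: less_imp_le)
    moreover have "(\<Sum>k=i..<j. ?\<Theta> k) = (\<Sum>k<j - i. integral {t (i + k)..t (Suc (i + k))} ?\<theta>)"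
      using ij sum.shift_bounds_nat_ivl[of ?\<Theta> 0 i "j - i"] by (simp add: atLeast0LessThan add.commute)
    ultimately show ?thesis using ij by simp
  qed
  then have "\<bar>(\<Sum>k=i..<j. h k) - integral {t i..t j} ?\<theta>\<bar> = \<bar>\<Sum>k=i..<j. h k - ?\<Theta> k\<bar>" by (simp add: sum_subtractf)
  also have "\<dots> \<le> (\<Sum>k=i..<j. \<bar>h k - ?\<Theta> k\<bar>)" by (rule sum_abs)
  also have "\<dots> \<le> (\<Sum>k=i..<j. (1 + 1 / c) * ?D k + c * ?\<Theta> k)" using blk ij by (intro sum_mono) auto
  also have "\<dots> \<le> (\<Sum>k<N. (1 + 1 / c) * ?D k + c * ?\<Theta> k)"
    using ij c D0 by (intro sum_mono2) (auto intro!: add_nonneg_nonneg mult_nonneg_nonneg)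
  also have "\<dots> = (1 + 1 / c) * (\<Sum>k<N. ?D k) + c * (\<Sum>k<N. ?\<Theta> k)"
    by (simp add: sum.distrib sum_distrib_left)
  also have "(\<Sum>k<N. ?\<Theta> k) = integral {0..T} ?\<theta>"
    using sum_integral_grid[of t ?\<theta> N] \<theta>_int t_less by (simp add: t0 tN less_imp_le)
  finally show ?thesis .
qed

end

section \<open>Tightness of the paths and convergence of the scheme\<close>

lemma sets_Collect_Ball_countable:
  assumes X: "countable X" and P: "\<And>i. i \<in> X \<Longrightarrow> {x\<in>space M. P i x} \<in> sets M"
  shows "{x\<in>space M. \<forall>i\<in>X. P i x} \<in> sets M"
proof (cases "X = {}")
  case False
  then have "{x\<in>space M. \<forall>i\<in>X. P i x} = (\<Inter>i\<in>X. {x\<in>space M. P i x})" by auto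
  also have "\<dots> \<in> sets M" using X False P by (intro sets.countable_INT') auto
  finally show ?thesis .
qed simp

context linear_sde
begin

lemma rational_sequence:
  assumes "s \<in> {0..T}"
  obtains f where "\<And>n::nat. f n \<in> \<rat> \<inter> {0..T}" "f \<longlonglongrightarrow> s"
proof -
  have "\<exists>x\<in>\<rat>. max 0 (s - 1 / real (Suc n)) < x \<and> x < min T (s + 1 / real (Suc n))" for n
  proof (rule Rats_dense_in_real)
    define d where "d = 1 / real (Suc n)"
    have "0 < d" by (simp add: d_def)
    then have "max 0 (s - d) < min T (s + d)" using assms T_pos by (auto simp: min_def max_def)
    then show "max 0 (s - 1 / real (Suc n)) < min T (s + 1 / real (Suc n))" by (simp only: d_def)
  qed
  then obtain f where f: "\<And>n. f n \<in> \<rat>" "\<And>n. max 0 (s - 1 / real (Suc n)) < f n" "\<And>n. f n < min T (s + 1 / real (Suc n))"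
    by metis
  have "f \<longlonglongrightarrow> s"
  proof (rule tendsto_sandwich)
    show "\<forall>\<^sub>F n in sequentially. s - 1 / real (Suc n) \<le> f n" "\<forall>\<^sub>F n in sequentially. f n \<le> s + 1 / real (Suc n)"
      using f(2,3) by (auto intro!: always_eventually less_imp_le)
    show "(\<lambda>n. s - 1 / real (Suc n)) \<longlonglongrightarrow> s" "(\<lambda>n. s + 1 / real (Suc n)) \<longlonglongrightarrow> s" by real_asymp+
  qed
  moreover have "f n \<in> \<rat> \<inter> {0..T}" for n using f(1)[of n] f(2)[of n] f(3)[of n] by auto
  ultimately show ?thesis using that by blast
qed

text \<open>\<open>K\<close> is chosen before \<kappa>, since later \<kappa> has to be taken small
  in terms of \<open>K\<close>. The events are formed over rational times to be measurable, and
  continuity of the paths extends the bounds to all times.\<close>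

lemma good_event:
  assumes \<eta>: "\<eta> > 0"
  obtains K where "0 \<le> K" "\<And>\<kappa>. \<kappa> > 0 \<Longrightarrow> \<exists>d>0. \<exists>G\<in>sets M. prob (space M - G) < \<eta> \<and>
    (\<forall>\<omega>\<in>G. \<forall>s\<in>{0..T}. \<bar>y s \<omega>\<bar> \<le> K) \<and>
    (\<forall>\<omega>\<in>G. \<forall>s\<in>{0..T}. \<forall>r\<in>{0..T}. \<bar>s - r\<bar> \<le> d \<longrightarrow> \<bar>y s \<omega> - y r \<omega>\<bar> \<le> \<kappa>)"
proof -
  define Q where "Q = \<rat> \<inter> {0..T}"
  have cQ: "countable Q" unfolding Q_def using countable_rat by (rule countable_subset[rotated]) auto
  have [measurable]: "y s \<in> borel_measurable M" if "s \<in> Q" for s using that y_measurable_M by (auto simp: Q_def)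
  have ylim: "(\<lambda>n. y (f n) \<omega>) \<longlonglongrightarrow> y s \<omega>"
    if "\<omega> \<in> space M" "s \<in> {0..T}" "\<And>n. f n \<in> Q" "f \<longlonglongrightarrow> s" for \<omega> s f
    by (rule continuous_on_tendsto_compose[OF y_cont[OF that(1)] that(4,2)])
      (use that(3) in \<open>auto simp: Q_def intro!: always_eventually\<close>)
  define A where "A K = {\<omega>\<in>space M. \<forall>s\<in>Q. \<bar>y s \<omega>\<bar> \<le> real K}" for K :: nat
  have A: "A K \<in> sets M" for K unfolding A_def
    by (intro sets_Collect_Ball_countable cQ) measurable
  have limit: "(\<lambda>n. prob (X n)) \<longlonglongrightarrow> 1" if "\<And>n. X n \<in> sets M" "incseq X" "\<And>\<omega>. \<omega> \<in> space M \<Longrightarrow> \<exists>n. \<omega> \<in> X n" for X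
  proof -
    have "(\<Union>n. X n) \<subseteq> space M" by (intro UN_least sets.sets_into_space that(1))
    moreover have "space M \<subseteq> (\<Union>n. X n)" using that(3) by blast
    ultimately have "(\<Union>n. X n) = space M" by (rule antisym)
    then show ?thesis using finite_Lim_measure_incseq[of X] that(1,2) prob_space by auto
  qed
  have "(\<lambda>K. prob (A K)) \<longlonglongrightarrow> 1"
  proof (rule limit[OF A])
    show "incseq A"
    proof (rule incseq_SucI, rule subsetI)
      fix K \<omega> assume "\<omega> \<in> A K"
      then show "\<omega> \<in> A (Suc K)" by (force simp: A_def)
    qed
    fix \<omega> assume \<omega>: "\<omega> \<in> space M"
    have "bounded ((\<lambda>t. y t \<omega>) ` {0..T})"
      by (intro compact_imp_bounded compact_continuous_image y_cont \<omega>) simp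
    then obtain b where b: "\<forall>s\<in>{0..T}. \<bar>y s \<omega>\<bar> \<le> b" unfolding bounded_iff by auto
    obtain n :: nat where "b \<le> real n" using real_arch_simple by blast
    then have "\<omega> \<in> A n" using b \<omega> by (auto simp: A_def Q_def intro: order_trans)
    then show "\<exists>n. \<omega> \<in> A n" ..
  qed
  then have "\<forall>\<^sub>F K in sequentially. 1 - \<eta> / 2 < prob (A K)" using \<eta> by (intro order_tendstoD(1)) auto
  then obtain K where K: "1 - \<eta> / 2 < prob (A K)" using eventually_happens' by force
  have AK: "\<bar>y s \<omega>\<bar> \<le> real K" if \<omega>: "\<omega> \<in> A K" and s: "s \<in> {0..T}" for \<omega> s
  proof -
    obtain f where f: "\<And>n::nat. f n \<in> Q" "f \<longlonglongrightarrow> s" using rational_sequence[OF s] unfolding Q_def by blast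
    have "(\<lambda>n. \<bar>y (f n) \<omega>\<bar>) \<longlonglongrightarrow> \<bar>y s \<omega>\<bar>" using \<omega> s f by (intro tendsto_rabs ylim) (auto simp: A_def)
    then show ?thesis by (rule LIMSEQ_le_const2) (use \<omega> f(1) in \<open>auto simp: A_def\<close>)
  qed
  show ?thesis
  proof (rule that[of "real K"])
    fix \<kappa> :: real assume \<kappa>: "\<kappa> > 0"
    define B where "B n = {\<omega>\<in>space M. \<forall>s\<in>Q. \<forall>r\<in>Q. \<bar>s - r\<bar> < 1 / real (Suc n) \<longrightarrow> \<bar>y s \<omega> - y r \<omega>\<bar> \<le> \<kappa>}" for n
    have B: "B n \<in> sets M" for n unfolding B_def
      by (intro sets_Collect_Ball_countable cQ) measurable
    have "(\<lambda>n. prob (B n)) \<longlonglongrightarrow> 1"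
    proof (rule limit[OF B])
      show "incseq B"
      proof (rule incseq_SucI, rule subsetI)
        fix n \<omega> assume \<omega>: "\<omega> \<in> B n"
        have "1 / real (Suc (Suc n)) \<le> 1 / real (Suc n)" by (simp add: frac_le)
        then show "\<omega> \<in> B (Suc n)" using \<omega> unfolding B_def by (auto dest: less_le_trans)
      qed
      fix \<omega> assume \<omega>: "\<omega> \<in> space M"
      have "uniformly_continuous_on {0..T} (\<lambda>t. y t \<omega>)"
        by (rule compact_uniformly_continuous[OF y_cont[OF \<omega>]]) simp
      then obtain d where d: "d > 0" "\<And>s r. s \<in> {0..T} \<Longrightarrow> r \<in> {0..T} \<Longrightarrow> dist r s < d \<Longrightarrow> dist (y r \<omega>) (y s \<omega>) < \<kappa>"
        unfolding uniformly_continuous_on_def using \<kappa> by metis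
      obtain n where n: "inverse (real (Suc n)) < d" using reals_Archimedean[OF d(1)] by auto
      have "\<omega> \<in> B n" unfolding B_def
      proof (intro CollectI conjI ballI impI \<omega>)
        fix s r assume sr: "s \<in> Q" "r \<in> Q" "\<bar>s - r\<bar> < 1 / real (Suc n)"
        then have "dist s r < d" using n by (simp add: dist_real_def inverse_eq_divide)
        then show "\<bar>y s \<omega> - y r \<omega>\<bar> \<le> \<kappa>" using d(2)[of r s] sr by (auto simp: Q_def dist_real_def)
      qed
      then show "\<exists>n. \<omega> \<in> B n" by blast
    qed
    then have "\<forall>\<^sub>F n in sequentially. 1 - \<eta> / 2 < prob (B n)" using \<eta> by (intro order_tendstoD(1)) auto
    then obtain n where n: "1 - \<eta> / 2 < prob (B n)" using eventually_happens' by force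
    \<comment> \<open>Strictly below the modulus valid for rational times, so that rationals tending
      to \<open>s\<close> and \<open>r\<close> with distance at most \<open>d\<close> eventually
      satisfy the strict inequality in \<open>B n\<close>.\<close>
    define d where "d = 1 / (2 * real (Suc n))"
    have d: "d > 0" "d < 1 / real (Suc n)" by (auto simp: d_def field_simps)
    have BK: "\<bar>y s \<omega> - y r \<omega>\<bar> \<le> \<kappa>" if \<omega>: "\<omega> \<in> B n" and s: "s \<in> {0..T}" and r: "r \<in> {0..T}" and sr: "\<bar>s - r\<bar> \<le> d" for \<omega> s r
    proof -
      obtain f where f: "\<And>n::nat. f n \<in> Q" "f \<longlonglongrightarrow> s" using rational_sequence[OF s] unfolding Q_def by blast
      obtain g where g: "\<And>n::nat. g n \<in> Q" "g \<longlonglongrightarrow> r" using rational_sequence[OF r] unfolding Q_def by blast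
      have "(\<lambda>n. \<bar>y (f n) \<omega> - y (g n) \<omega>\<bar>) \<longlonglongrightarrow> \<bar>y s \<omega> - y r \<omega>\<bar>"
        using \<omega> s r f g by (intro tendsto_rabs tendsto_diff ylim) (auto simp: B_def)
      moreover have fg: "(\<lambda>n. \<bar>f n - g n\<bar>) \<longlonglongrightarrow> \<bar>s - r\<bar>" by (intro tendsto_rabs tendsto_diff f g)
      have "\<bar>s - r\<bar> < 1 / real (Suc n)" using sr d(2) by linarith
      from order_tendstoD(2)[OF fg this] have "\<forall>\<^sub>F m in sequentially. \<bar>f m - g m\<bar> < 1 / real (Suc n)" .
      then have "\<forall>\<^sub>F m in sequentially. \<bar>y (f m) \<omega> - y (g m) \<omega>\<bar> \<le> \<kappa>"
        by eventually_elim (use \<omega> f(1) g(1) in \<open>auto simp: B_def\<close>)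
      ultimately show ?thesis by (intro tendsto_upperbound[where F=sequentially]) auto
    qed
    have "prob (space M - (A K \<inter> B n)) \<le> prob (space M - A K) + prob (space M - B n)"
      using measure_Un_le[of "space M - A K" M "space M - B n"] A B by (simp add: Diff_Int)
    also have "\<dots> < \<eta>" using K n A[of K] B[of n] by (simp add: prob_compl)
    finally show "\<exists>d>0. \<exists>G\<in>sets M. prob (space M - G) < \<eta> \<and>
      (\<forall>\<omega>\<in>G. \<forall>s\<in>{0..T}. \<bar>y s \<omega>\<bar> \<le> real K) \<and>
      (\<forall>\<omega>\<in>G. \<forall>s\<in>{0..T}. \<forall>r\<in>{0..T}. \<bar>s - r\<bar> \<le> d \<longrightarrow> \<bar>y s \<omega> - y r \<omega>\<bar> \<le> \<kappa>)"
      using d(1) A[of K] B[of n] AK BK by (intro exI[of _ d] conjI bexI[of _ "A K \<inter> B n"]) auto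
  qed simp
qed

text \<open>The order of the choices matters: \<open>K\<close> from tightness, then \<kappa> in
  terms of \<open>K\<close>, then a grid finer than the resulting moduli of \<open>y\<close> and
  \<open>a\<close>. Since \<open>p\<close> divides \<open>N m\<close>, the times
  \<open>j * T / p\<close> belong to every grid.\<close>

lemma euler_converges:
  assumes p: "p > 0"
  obtains N l where "\<And>m. N m > 0" "\<And>m. p dvd N m"
    "\<And>\<epsilon> j. \<epsilon> > 0 \<Longrightarrow> j \<le> p \<Longrightarrow>
      (\<lambda>m. prob {\<omega>\<in>space M. \<epsilon> < \<bar>u (real j * T / real p) \<omega> - euler.E W T y0 (N m) (l m) (j * (N m div p)) \<omega>\<bar>}) \<longlonglongrightarrow> 0"
    "(\<lambda>m. \<Sum>k<N m. integral {euler.t T (N m) k..euler.t T (N m) (Suc k)} (\<lambda>s. (norm (\<theta> s - l m k))\<^sup>2)) \<longlonglongrightarrow> 0"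
proof -
  let ?e = "\<lambda>m. 1 / real (Suc m)"
  define P where "P m L l \<longleftrightarrow> L > 0 \<and> 1 / ?e m \<le> real (p * L) \<and>
    (\<Sum>k<p * L. integral {real k * T / real (p * L)..real (Suc k) * T / real (p * L)} (\<lambda>s. (norm (\<theta> s - l k))\<^sup>2)) < ?e m \<and>
    (\<forall>k<p * L. (norm (l k))\<^sup>2 * (T / real (p * L)) < ?e m)" for m L and l :: "nat \<Rightarrow> real^'m"
  have "\<exists>L l. P m L l" for m
  proof -
    have "0 < ?e m" by simp
    then show ?thesis
      by (rule L2_step_approx[OF T_pos p \<theta>_meas \<theta>_int]) (unfold P_def, blast)
  qed
  then obtain L l where P: "\<And>m. P m (L m) (l m)" by metis
  have L: "\<And>m. L m > 0" "\<And>m. 1 / ?e m \<le> real (p * L m)"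
    and D: "\<And>m. (\<Sum>k<p * L m. integral {real k * T / real (p * L m)..real (Suc k) * T / real (p * L m)} (\<lambda>s. (norm (\<theta> s - l m k))\<^sup>2)) < ?e m"
    and hh: "\<And>m k. k < p * L m \<Longrightarrow> (norm (l m k))\<^sup>2 * (T / real (p * L m)) < ?e m"
    using P unfolding P_def by blast+
  define N where "N m = p * L m" for m
  have N0: "N m > 0" for m using p L(1)[of m] by (simp add: N_def)
  have eu: "euler M F W T y0 q \<theta> y I (N m)" for m by unfold_locales (rule N0)
  have tdef: "euler.t T (N m) k = real k * T / real (N m)" for m k by (rule euler.t_def[OF eu])
  define \<Delta> where "\<Delta> m = (\<Sum>k<N m. integral {euler.t T (N m) k..euler.t T (N m) (Suc k)} (\<lambda>s. (norm (\<theta> s - l m k))\<^sup>2))" for m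
  have \<Delta>lt: "\<Delta> m < ?e m" for m using D[of m] unfolding \<Delta>_def tdef unfolding N_def .
  have \<Delta>0: "0 \<le> \<Delta> m" for m
  proof -
    have "0 \<le> integral S (\<lambda>s. (norm (\<theta> s - l m k))\<^sup>2)" for S k
      by (cases "(\<lambda>s. (norm (\<theta> s - l m k))\<^sup>2) integrable_on S") (auto intro: integral_nonneg simp: not_integrable_integral)
    then show ?thesis unfolding \<Delta>_def by (intro sum_nonneg)
  qed
  have e0: "?e \<longlonglongrightarrow> 0" by real_asymp
  have \<Delta>lim: "\<Delta> \<longlonglongrightarrow> 0"
    by (rule tendsto_sandwich[OF _ _ tendsto_const e0]) (use \<Delta>0 \<Delta>lt in \<open>auto intro!: always_eventually less_imp_le\<close>)
  have Nlim: "(\<lambda>m. T / real (N m)) \<longlonglongrightarrow> 0"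
  proof (rule tendsto_sandwich[OF _ _ tendsto_const])
    show "\<forall>\<^sub>F m in sequentially. 0 \<le> T / real (N m)" using T_pos by simp
    have "T / real (N m) \<le> T * ?e m" for m
    proof -
      have "real (Suc m) \<le> real (N m)" using L(2)[of m] by (simp add: N_def)
      then show ?thesis using T_pos by (simp add: divide_left_mono)
    qed
    then show "\<forall>\<^sub>F m in sequentially. T / real (N m) \<le> T * ?e m" by simp
    show "(\<lambda>m. T * ?e m) \<longlonglongrightarrow> 0" using tendsto_mult_left[OF e0, of T] by simp
  qed
  define \<Theta> where "\<Theta> = integral {0..T} (\<lambda>s. (norm (\<theta> s))\<^sup>2)"
  \<comment> \<open>\<open>sum_h_error\<close> with \<open>c = 1\<close> bounds the sum of the
    \<open>h k\<close> by \<open>\<Theta> + 2 * \<Delta> m + \<Theta>\<close>, and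
    \<open>\<Delta> m \<le> 1\<close>.\<close>
  define H where "H = 2 * \<Theta> + 2"
  define V where "V = integral {0..T} (\<lambda>s. 1 + \<bar>q s\<bar>)"
  have H: "(\<Sum>k<N m. euler.h T (N m) (l m) k) \<le> H" for m
  proof -
    interpret euler M F W T y0 q \<theta> y I "N m" "l m" by (rule eu)
    have "\<Delta> m \<le> 1" using \<Delta>lt[of m] by (smt (verit) divide_le_eq_1 of_nat_0_less_iff of_nat_Suc of_nat_0_le_iff zero_less_Suc)
    then show ?thesis using sum_h_error[of 1 0 "N m"] unfolding H_def \<Delta>_def \<Theta>_def t0 tN by (simp add: atLeast0LessThan)
  qed
  obtain Ca where Ca: "\<And>s. s \<in> {0..T} \<Longrightarrow> exp (- a s) \<le> Ca"
  proof -
    have "bounded ((\<lambda>s. exp (- a s)) ` {0..T})"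
      by (intro compact_imp_bounded compact_continuous_image continuous_intros a_cont) simp
    then obtain b where "\<forall>x\<in>(\<lambda>s. exp (- a s)) ` {0..T}. norm x \<le> b" unfolding bounded_iff by blast
    then show ?thesis by (intro that[of b]) auto
  qed
  have Ca0: "0 \<le> Ca" using Ca[of 0] T_pos exp_ge_zero[of "- a 0"] by (smt (verit) atLeastAtMost_iff)
  have conv: "(\<lambda>m. prob {\<omega>\<in>space M. \<epsilon> < \<bar>u (real j * T / real p) \<omega> - euler.E W T y0 (N m) (l m) (j * (N m div p)) \<omega>\<bar>}) \<longlonglongrightarrow> 0"
    if \<epsilon>: "\<epsilon> > 0" and j: "j \<le> p" for \<epsilon> j
  proof (rule order_tendstoI)
    fix \<eta> :: real assume \<eta>: "0 < \<eta>"
    obtain K where K: "0 \<le> K" "\<And>\<kappa>. \<kappa> > 0 \<Longrightarrow> \<exists>d>0. \<exists>G\<in>sets M. prob (space M - G) < \<eta> / 2 \<and>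
       (\<forall>\<omega>\<in>G. \<forall>s\<in>{0..T}. \<bar>y s \<omega>\<bar> \<le> K) \<and>
       (\<forall>\<omega>\<in>G. \<forall>s\<in>{0..T}. \<forall>r\<in>{0..T}. \<bar>s - r\<bar> \<le> d \<longrightarrow> \<bar>y s \<omega> - y r \<omega>\<bar> \<le> \<kappa>)"
      using good_event[of "\<eta> / 2"] \<eta> by auto
    \<comment> \<open>The bound of \<open>err_bound_le\<close> with every tolerance set to \<kappa>,
      divided by the square of \<epsilon>; it is continuous in \<kappa> and vanishes at 0.\<close>
    define \<Psi> where "\<Psi> \<kappa> = exp (V + 2 * H) * (1 + V) * (4 * (Ca\<^sup>2 * (2 * \<kappa> + 4 * (K\<^sup>2 * \<kappa> + \<kappa>\<^sup>2 * H)) + y0\<^sup>2 * exp H * (\<kappa> * H))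
        + (Ca * (\<kappa> * K + \<kappa>) + \<kappa>)\<^sup>2 * V) / \<epsilon>\<^sup>2" for \<kappa>
    have "(\<Psi> \<longlongrightarrow> \<Psi> 0) (at_right 0)" unfolding \<Psi>_def using \<epsilon> by (intro tendsto_intros) auto
    then have "(\<Psi> \<longlongrightarrow> 0) (at_right 0)" by (simp add: \<Psi>_def)
    then have "\<forall>\<^sub>F \<kappa> in at_right 0. \<Psi> \<kappa> < \<eta> / 2" using \<eta> by (intro order_tendstoD(2)) auto
    moreover have "\<forall>\<^sub>F \<kappa> in at_right (0::real). 0 < \<kappa> \<and> \<kappa> \<le> 1"
      using eventually_at_right_real[of 0 1] by (auto elim: eventually_mono)
    ultimately have "\<forall>\<^sub>F \<kappa> in at_right 0. \<Psi> \<kappa> < \<eta> / 2 \<and> 0 < \<kappa> \<and> \<kappa> \<le> 1" by eventually_elim auto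
    then obtain \<kappa> where \<kappa>: "\<Psi> \<kappa> < \<eta> / 2" "0 < \<kappa>" "\<kappa> \<le> 1"
      using eventually_happens'[of "at_right (0::real)"] by auto
    obtain d G where d: "d > 0" and G: "G \<in> sets M" "prob (space M - G) < \<eta> / 2"
      "\<And>\<omega> s. \<omega> \<in> G \<Longrightarrow> s \<in> {0..T} \<Longrightarrow> \<bar>y s \<omega>\<bar> \<le> K"
      "\<And>\<omega> s r. \<omega> \<in> G \<Longrightarrow> s \<in> {0..T} \<Longrightarrow> r \<in> {0..T} \<Longrightarrow> \<bar>s - r\<bar> \<le> d \<Longrightarrow> \<bar>y s \<omega> - y r \<omega>\<bar> \<le> \<kappa>"
      using K(2)[OF \<kappa>(2)] by metis
    obtain d' where d': "d' > 0" "\<And>s r. s \<in> {0..T} \<Longrightarrow> r \<in> {0..T} \<Longrightarrow> dist r s < d' \<Longrightarrow> dist (a r) (a s) < \<kappa>"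
      using compact_uniformly_continuous[OF a_cont] \<kappa>(2) unfolding uniformly_continuous_on_def by (metis compact_Icc)
    have "0 < min d d'" using d d'(1) by simp
    from eventually_conj[OF order_tendstoD(2)[OF Nlim this] order_tendstoD(2)[OF e0 \<kappa>(2)]]
    show "\<forall>\<^sub>F m in sequentially. prob {\<omega>\<in>space M. \<epsilon> < \<bar>u (real j * T / real p) \<omega> - euler.E W T y0 (N m) (l m) (j * (N m div p)) \<omega>\<bar>} < \<eta>"
    proof eventually_elim
      case (elim m)
      interpret euler M F W T y0 q \<theta> y I "N m" "l m" by (rule eu)
      let ?k = "j * (N m div p)"
      have Np: "N m div p = L m" using p by (simp add: N_def)
      have kN: "?k \<le> N m" unfolding Np unfolding N_def using j by (rule mult_right_mono) simp
      have tk: "t ?k = real j * T / real p" unfolding Np unfolding t_def unfolding N_def using p L(1)[of m] by simp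
      have TNd: "T / real (N m) < d" "T / real (N m) < d'" and em: "?e m < \<kappa>" using elim by auto
      have "\<bar>a (t (Suc i)) - a (t i)\<bar> \<le> \<kappa>" if "i < N m" for i
        using d'(2)[OF t_in[of i] t_in[of "Suc i"]] that t_Suc[of i] TNd TN T_pos by (simp add: dist_real_def)
      moreover have "\<bar>y s \<omega> - y r \<omega>\<bar> \<le> \<kappa>" if "\<omega> \<in> G" "s \<in> {0..T}" "r \<in> {0..T}" "\<bar>s - r\<bar> \<le> T / real (N m)" for \<omega> s r
        using G(4)[OF that(1-3)] that(4) TNd by linarith
      ultimately have "prob {\<omega>\<in>space M. \<epsilon> < \<bar>u (t ?k) \<omega> - E ?k \<omega>\<bar>} \<le> prob (space M - G) +
         err_bound Ca (2 * \<kappa> + 4 * (K\<^sup>2 * \<Delta> m + \<kappa>\<^sup>2 * (\<Sum>k<N m. h k))) (Ca * (\<kappa> * K + \<kappa>) + \<kappa>) / \<epsilon>\<^sup>2"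
        unfolding \<Delta>_def using \<kappa> \<epsilon> by (intro euler_estimate G(1,3) K(1) kN Ca) auto
      also have "err_bound Ca (2 * \<kappa> + 4 * (K\<^sup>2 * \<Delta> m + \<kappa>\<^sup>2 * (\<Sum>k<N m. h k))) (Ca * (\<kappa> * K + \<kappa>) + \<kappa>) / \<epsilon>\<^sup>2 \<le> \<Psi> \<kappa>"
        unfolding \<Psi>_def V_def
      proof (intro divide_right_mono err_bound_le H)
        show "h k \<le> \<kappa>" if "k < N m" for k
        proof -
          have "h k = (norm (l m k))\<^sup>2 * (T / real (N m))" unfolding h_def t_Suc ..
          then show ?thesis using hh[folded N_def, OF that] em by linarith
        qed
        have "0 \<le> (\<Sum>k<N m. h k)" by (intro sum_nonneg h_nonneg)
        then show "0 \<le> 2 * \<kappa> + 4 * (K\<^sup>2 * \<Delta> m + \<kappa>\<^sup>2 * (\<Sum>k<N m. h k))"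
          using \<kappa> \<Delta>0[of m] by (intro add_nonneg_nonneg mult_nonneg_nonneg) auto
        have "\<Delta> m \<le> \<kappa>" using \<Delta>lt[of m] em by linarith
        then show "2 * \<kappa> + 4 * (K\<^sup>2 * \<Delta> m + \<kappa>\<^sup>2 * (\<Sum>k<N m. h k)) \<le> 2 * \<kappa> + 4 * (K\<^sup>2 * \<kappa> + \<kappa>\<^sup>2 * H)"
          using H[of m] by (intro add_mono mult_left_mono order_refl) auto
        show "0 \<le> Ca * (\<kappa> * K + \<kappa>) + \<kappa>" using \<kappa> K(1) Ca0 by (intro add_nonneg_nonneg mult_nonneg_nonneg) auto
      qed (use \<kappa> in auto)
      finally show ?case using \<kappa>(1) G(2) unfolding tk by linarith
    qed
  qed (auto intro!: always_eventually intro: less_le_trans[OF _ measure_nonneg])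
  show ?thesis
    by (rule that[of N l]) (use N0 conv \<Delta>lim in \<open>auto simp: N_def[of _] \<Delta>_def[abs_def]\<close>)
qed

end

section \<open>The conditional law of the solution\<close>

text \<open>By independence the joint law is a product measure, and Fubini applies to it.\<close>

lemma (in prob_space) expectation_indep_iterated:
  fixes X Y :: "'a \<Rightarrow> real" and f :: "real \<times> real \<Rightarrow> real"
  assumes ind: "indep_var borel X borel Y" and [measurable]: "f \<in> borel_measurable (borel \<Otimes>\<^sub>M borel)"
    and bd: "\<And>z. \<bar>f z\<bar> \<le> C"
  shows "expectation (\<lambda>\<omega>. f (X \<omega>, Y \<omega>)) = expectation (\<lambda>\<omega>. \<integral>r. f (X \<omega>, r) \<partial>distr M borel Y)"
proof -
  have [measurable]: "X \<in> borel_measurable M" "Y \<in> borel_measurable M"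
    using indep_var_rv1[OF ind] indep_var_rv2[OF ind] by auto
  interpret X: prob_space "distr M borel X" by (rule prob_space_distr) simp
  interpret Y: prob_space "distr M borel Y" by (rule prob_space_distr) simp
  interpret XY: pair_prob_space "distr M borel X" "distr M borel Y" ..
  have "expectation (\<lambda>\<omega>. f (X \<omega>, Y \<omega>)) = (\<integral>z. f z \<partial>distr M (borel \<Otimes>\<^sub>M borel) (\<lambda>\<omega>. (X \<omega>, Y \<omega>)))"
    by (subst integral_distr) auto
  also have "distr M (borel \<Otimes>\<^sub>M borel) (\<lambda>\<omega>. (X \<omega>, Y \<omega>)) = distr M borel X \<Otimes>\<^sub>M distr M borel Y"
    using ind by (simp add: indep_var_distribution_eq)
  also have "(\<integral>z. f z \<partial>(distr M borel X \<Otimes>\<^sub>M distr M borel Y)) = (\<integral>x. \<integral>r. f (x, r) \<partial>distr M borel Y \<partial>distr M borel X)"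
  proof (rule XY.integral_fst'[symmetric])
    have "f \<in> borel_measurable (distr M borel X \<Otimes>\<^sub>M distr M borel Y)" by simp
    then show "integrable (distr M borel X \<Otimes>\<^sub>M distr M borel Y) f"
      by (rule XY.P.integrable_const_bound[where B=C, rotated]) (use bd in auto)
  qed
  also have "\<dots> = expectation (\<lambda>\<omega>. \<integral>r. f (X \<omega>, r) \<partial>distr M borel Y)"
    by (subst integral_distr) (auto intro!: Y.borel_measurable_lebesgue_integral)
  finally show ?thesis .
qed

text \<open>Transition operator of the driftless \<open>u\<close> over an amount \<open>v\<close> of
  the clock: started at \<open>x\<close>, the process is multiplied by a lognormal variable of mean
  1.\<close>

definition lognormal_mean :: "(real \<Rightarrow> real) \<Rightarrow> real \<Rightarrow> real \<Rightarrow> real" where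
  "lognormal_mean g v x = (\<integral>r. g (x * exp (- (sqrt v * r) - v / 2)) \<partial>std_normal_distribution)"

lemma lognormal_mean_measurable [measurable]:
  assumes [measurable]: "g \<in> borel_measurable borel"
  shows "lognormal_mean g v \<in> borel_measurable borel"
proof -
  interpret N: prob_space std_normal_distribution by (rule prob_space_std_normal_distribution)
  show ?thesis unfolding lognormal_mean_def
    by (intro N.borel_measurable_lebesgue_integral) (simp add: split_beta')
qed

lemma lognormal_mean_bound:
  assumes [measurable]: "g \<in> borel_measurable borel" and bd: "\<And>x. \<bar>g x\<bar> \<le> C"
  shows "\<bar>lognormal_mean g v x\<bar> \<le> C"
proof -
  interpret N: prob_space std_normal_distribution by (rule prob_space_std_normal_distribution)
  have "0 \<le> C" using bd[of 0] by linarith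
  then have "\<bar>lognormal_mean g v x\<bar> \<le> (\<integral>r. C \<partial>std_normal_distribution)"
    unfolding lognormal_mean_def using bd by (intro integral_abs_bound_integral N.integrable_const_bound[where B=C]) auto
  then show ?thesis using N.prob_space by simp
qed

lemma lognormal_mean_tendsto:
  assumes [measurable]: "\<And>n. g n \<in> borel_measurable borel" "g' \<in> borel_measurable borel"
    and bd: "\<And>n x. \<bar>g n x\<bar> \<le> C" and lim: "\<And>x. (\<lambda>n. g n x) \<longlonglongrightarrow> g' x"
  shows "(\<lambda>n. lognormal_mean (g n) v x) \<longlonglongrightarrow> lognormal_mean g' v x"
proof -
  interpret N: prob_space std_normal_distribution by (rule prob_space_std_normal_distribution)
  show ?thesis unfolding lognormal_mean_def
    by (rule integral_dominated_convergence[where w="\<lambda>_. C"]) (use bd lim in auto)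
qed

lemma lognormal_mean_tendsto_variance:
  assumes g: "continuous_on UNIV g" and bd: "\<And>x. \<bar>g x\<bar> \<le> C" and v: "v \<longlonglongrightarrow> v'"
  shows "(\<lambda>n. lognormal_mean g (v n) x) \<longlonglongrightarrow> lognormal_mean g v' x"
proof -
  interpret N: prob_space std_normal_distribution by (rule prob_space_std_normal_distribution)
  have [measurable]: "g \<in> borel_measurable borel" by (rule borel_measurable_continuous_onI[OF g])
  have "isCont g r" for r using g by (simp add: continuous_on_eq_continuous_at)
  then show ?thesis unfolding lognormal_mean_def using v
    by (intro integral_dominated_convergence[where w="\<lambda>_. C"])
      (use bd in \<open>auto intro!: AE_I2 isCont_tendsto_compose[of _ g] tendsto_intros\<close>)
qed

lemma lipschitz_imp_continuous:
  fixes g :: "real \<Rightarrow> real"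
  assumes "\<And>x y. \<bar>g x - g y\<bar> \<le> L * \<bar>x - y\<bar>"
  shows "continuous_on UNIV g"
proof (rule lipschitz_on_continuous_on[of "\<bar>L\<bar>"])
  show "\<bar>L\<bar>-lipschitz_on UNIV g"
  proof (rule lipschitz_onI)
    fix x y
    have "L * \<bar>x - y\<bar> \<le> \<bar>L\<bar> * \<bar>x - y\<bar>" by (intro mult_right_mono) auto
    then show "dist (g x) (g y) \<le> \<bar>L\<bar> * dist x y" using assms[of x y] by (simp add: dist_real_def)
  qed simp
qed

context euler
begin

text \<open>The factor carrying \<open>E k\<close> to \<open>E N\<close> involves increments after
  \<open>t k\<close> only, hence is independent of \<open>F (t k)\<close>. The conditional law of
  the solution comes from here.\<close>

lemma E_ratio:
  assumes k: "k \<le> N"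
  shows "E N \<omega> = E k \<omega> * exp (- (\<Sum>i=k..<N. dN i \<omega>) - (\<Sum>i=k..<N. h i) / 2)"
proof -
  have "{..<N} = {..<k} \<union> {k..<N}" "{..<k} \<inter> {k..<N} = {}" using k by auto
  then have "(\<Prod>i<N. exp (- dN i \<omega> - h i / 2)) = (\<Prod>i<k. exp (- dN i \<omega> - h i / 2)) * (\<Prod>i=k..<N. exp (- dN i \<omega> - h i / 2))"
    by (simp add: prod.union_disjoint)
  also have "(\<Prod>i=k..<N. exp (- dN i \<omega> - h i / 2)) = exp (\<Sum>i=k..<N. - dN i \<omega> - h i / 2)"
    by (simp add: exp_sum)
  finally show ?thesis unfolding E_def by (simp add: sum_subtractf sum_negf sum_divide_distrib)
qed

lemma increments_law:
  assumes k: "k \<le> N"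
  shows "distr M borel (\<lambda>\<omega>. \<Sum>i=k..<N. dN i \<omega>) = gauss (\<Sum>i=k..<N. h i)"
    and "X \<in> borel_measurable (F (t k)) \<Longrightarrow> indep_var borel X borel (\<lambda>\<omega>. \<Sum>i=k..<N. dN i \<omega>)"
  using incr_sum_law[where t=t and p=k and q=N and l=l, OF t_nonneg t_less k] unfolding dN_def h_def by auto

lemma increments_measurable: "k \<le> N \<Longrightarrow> (\<lambda>\<omega>. \<Sum>i=k..<N. dN i \<omega>) \<in> borel_measurable M"
  by (intro borel_measurable_sum measurable_F_M[OF dN_measurable]) auto

text \<open>The event is moved into the variable: \<open>Z\<close> is \<open>X\<close> on
  \<open>A\<close> and 0 elsewhere, still known at \<open>t k\<close> and so independent of the
  later increments. Off \<open>A\<close> both sides contribute \<open>g 0\<close>, because a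
  lognormal factor leaves 0 fixed, and this part cancels.\<close>

lemma expectation_lognormal_increment:
  assumes k: "k \<le> N" and X: "X \<in> borel_measurable (F (t k))"
    and g [measurable]: "g \<in> borel_measurable borel" and bd: "\<And>x. \<bar>g x\<bar> \<le> C" and A: "A \<in> sets (F (t k))"
  defines "H \<equiv> \<Sum>i=k..<N. h i"
  shows "expectation (\<lambda>\<omega>. indicator A \<omega> * g (X \<omega> * exp (- (\<Sum>i=k..<N. dN i \<omega>) - H / 2))) =
    expectation (\<lambda>\<omega>. indicator A \<omega> * lognormal_mean g H (X \<omega>))"
proof -
  let ?S = "\<lambda>\<omega>. \<Sum>i=k..<N. dN i \<omega>"
  have AM [measurable]: "A \<in> sets M" using A sets_F by blast
  have [measurable]: "?S \<in> borel_measurable M" by (rule increments_measurable[OF k])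
  have [measurable]: "X \<in> borel_measurable M" by (rule measurable_F_M[OF X])
  define Z where "Z \<omega> = indicator A \<omega> * X \<omega>" for \<omega>
  have Z: "Z \<in> borel_measurable (F (t k))" unfolding Z_def[abs_def] using A X by measurable
  have [measurable]: "Z \<in> borel_measurable M" by (rule measurable_F_M[OF Z])
  have mean: "(\<integral>r. g (x * exp (- r - H / 2)) \<partial>distr M borel ?S) = lognormal_mean g H x" for x
    unfolding increments_law(1)[OF k] gauss_def lognormal_mean_def H_def by (subst integral_distr) auto
  have bd1: "integrable M (\<lambda>\<omega>. indicator B \<omega> * f \<omega>)" if "f \<in> borel_measurable M" "\<And>\<omega>. \<bar>f \<omega>\<bar> \<le> C" "B \<in> sets M" for f B
    using that by (intro integrable_const_bound[where B=C])
      (auto simp: indicator_def intro!: AE_I2 order_trans[OF abs_ge_zero that(2)])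
  have int0: "integrable M (\<lambda>\<omega>. indicator (space M - A) \<omega> * g 0)" using bd by (intro bd1) auto
  have "expectation (\<lambda>\<omega>. g (Z \<omega> * exp (- ?S \<omega> - H / 2))) = expectation (\<lambda>\<omega>. lognormal_mean g H (Z \<omega>))"
    using expectation_indep_iterated[OF increments_law(2)[OF k Z], of "\<lambda>(x, r). g (x * exp (- r - H / 2))" C] bd
    by (simp add: mean split_beta')
  moreover have "expectation (\<lambda>\<omega>. g (Z \<omega> * exp (- ?S \<omega> - H / 2))) =
    expectation (\<lambda>\<omega>. indicator A \<omega> * g (X \<omega> * exp (- ?S \<omega> - H / 2)) + indicator (space M - A) \<omega> * g 0)"
    by (intro Bochner_Integration.integral_cong) (auto simp: Z_def indicator_def)
  moreover have "\<dots> = expectation (\<lambda>\<omega>. indicator A \<omega> * g (X \<omega> * exp (- ?S \<omega> - H / 2))) + expectation (\<lambda>\<omega>. indicator (space M - A) \<omega> * g 0)"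
    by (intro Bochner_Integration.integral_add bd1 int0 bd) auto
  moreover have "expectation (\<lambda>\<omega>. lognormal_mean g H (Z \<omega>)) =
    expectation (\<lambda>\<omega>. indicator A \<omega> * lognormal_mean g H (X \<omega>) + indicator (space M - A) \<omega> * g 0)"
  proof (intro Bochner_Integration.integral_cong refl)
    fix \<omega> assume "\<omega> \<in> space M"
    interpret N: prob_space std_normal_distribution by (rule prob_space_std_normal_distribution)
    have "lognormal_mean g H 0 = g 0" unfolding lognormal_mean_def using N.prob_space by simp
    then show "lognormal_mean g H (Z \<omega>) = indicator A \<omega> * lognormal_mean g H (X \<omega>) + indicator (space M - A) \<omega> * g 0"
      using \<open>\<omega> \<in> space M\<close> by (auto simp: Z_def indicator_def)
  qed
  moreover have "\<dots> = expectation (\<lambda>\<omega>. indicator A \<omega> * lognormal_mean g H (X \<omega>)) + expectation (\<lambda>\<omega>. indicator (space M - A) \<omega> * g 0)"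
    by (intro Bochner_Integration.integral_add bd1 int0 lognormal_mean_bound bd) auto
  ultimately show ?thesis by linarith
qed

lemma lognormal_increment_mean:
  assumes k: "k \<le> N"
  shows "has_bochner_integral M (\<lambda>\<omega>. exp (- (\<Sum>i=k..<N. dN i \<omega>) - (\<Sum>i=k..<N. h i) / 2)) 1"
proof -
  let ?H = "\<Sum>i=k..<N. h i"
  note [measurable] = increments_measurable[OF k]
  have "0 \<le> ?H" by (intro sum_nonneg h_nonneg)
  then have "has_bochner_integral (distr M borel (\<lambda>\<omega>. \<Sum>i=k..<N. dN i \<omega>)) (\<lambda>x. exp (- x - ?H / 2)) 1"
    unfolding increments_law(1)[OF k] by (rule gauss_moments(3))
  then show ?thesis unfolding has_bochner_integral_iff by (auto simp: integral_distr integrable_distr_eq)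
qed

text \<open>With \<open>J\<close> the factor carrying \<open>E k\<close> to \<open>E N\<close>, the
  difference \<open>u T - u (t k) * J\<close> is the error at \<open>T\<close> minus
  \<open>J\<close> times the error at \<open>t k\<close>. Where both errors are at most \<epsilon>
  it is at most \<open>\<epsilon> + \<epsilon> * J\<close>, and \<open>J\<close> has mean 1;
  elsewhere the bound on \<open>g\<close> is used.\<close>

lemma ratio_error:
  assumes k: "k \<le> N" and g [measurable]: "g \<in> borel_measurable borel" and bd: "\<And>x. \<bar>g x\<bar> \<le> C"
    and lip: "\<And>x y. \<bar>g x - g y\<bar> \<le> L * \<bar>x - y\<bar>" and L: "0 \<le> L" and \<epsilon>: "0 < \<epsilon>" and A [measurable]: "A \<in> sets M"
  shows "\<bar>expectation (\<lambda>\<omega>. indicator A \<omega> * g (u T \<omega>)) -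
     expectation (\<lambda>\<omega>. indicator A \<omega> * g (u (t k) \<omega> * exp (- (\<Sum>i=k..<N. dN i \<omega>) - (\<Sum>i=k..<N. h i) / 2)))\<bar> \<le>
    2 * C * (prob {\<omega>\<in>space M. \<epsilon> < \<bar>u T \<omega> - E N \<omega>\<bar>} + prob {\<omega>\<in>space M. \<epsilon> < \<bar>u (t k) \<omega> - E k \<omega>\<bar>}) + 2 * L * \<epsilon>"
proof -
  let ?J = "\<lambda>\<omega>. exp (- (\<Sum>i=k..<N. dN i \<omega>) - (\<Sum>i=k..<N. h i) / 2)"
  let ?B1 = "{\<omega>\<in>space M. \<epsilon> < \<bar>u T \<omega> - E N \<omega>\<bar>}" and ?B2 = "{\<omega>\<in>space M. \<epsilon> < \<bar>u (t k) \<omega> - E k \<omega>\<bar>}"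
  have C: "0 \<le> C" using bd[of 0] by linarith
  note [measurable] = increments_measurable[OF k] measurable_F_M[OF E_measurable] measurable_F_M[OF u_adapted[OF t_in[OF k]]]
  have [measurable]: "u T \<in> borel_measurable M" using measurable_F_M[OF u_adapted[of T]] T_pos by simp
  have J: "integrable M ?J" "expectation ?J = 1"
    using lognormal_increment_mean[OF k] by (auto simp: has_bochner_integral_iff)
  have i: "integrable M (\<lambda>\<omega>. indicator A \<omega> * g (f \<omega>))" if [measurable]: "f \<in> borel_measurable M" for f
    by (rule integrable_const_bound[where B=C]) (use bd C in \<open>auto simp: indicator_def intro!: AE_I2\<close>)
  let ?R = "\<lambda>\<omega>. 2 * C * (indicator ?B1 \<omega> + indicator ?B2 \<omega>) + (L * \<epsilon> + L * \<epsilon> * ?J \<omega>)"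
  have R: "integrable M ?R" "expectation ?R = 2 * C * (prob ?B1 + prob ?B2) + 2 * L * \<epsilon>"
  proof -
    have ind: "integrable M (indicat_real B)" if "B \<in> sets M" for B
      by (rule integrable_const_bound[where B=1]) (use that in auto)
    have "?B1 \<in> sets M" "?B2 \<in> sets M" by measurable
    then have "has_bochner_integral M ?R (2 * C * (prob ?B1 + prob ?B2) + (L * \<epsilon> + L * \<epsilon> * 1))"
      using J by (intro has_bochner_integral_add has_bochner_integral_mult_right)
        (auto simp: has_bochner_integral_iff ind prob_space)
    then show "integrable M ?R" "expectation ?R = 2 * C * (prob ?B1 + prob ?B2) + 2 * L * \<epsilon>"
      by (auto simp: has_bochner_integral_iff)
  qed
  have le: "\<bar>indicator A \<omega> * g (u T \<omega>) - indicator A \<omega> * g (u (t k) \<omega> * ?J \<omega>)\<bar> \<le> ?R \<omega>" if \<omega>: "\<omega> \<in> space M" for \<omega>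
  proof -
    have J0: "0 \<le> ?J \<omega>" by simp
    have "\<bar>g (u T \<omega>) - g (u (t k) \<omega> * ?J \<omega>)\<bar> \<le> ?R \<omega>"
    proof (cases "\<omega> \<in> ?B1 \<union> ?B2")
      case True
      have "\<bar>g (u T \<omega>) - g (u (t k) \<omega> * ?J \<omega>)\<bar> \<le> 2 * C * 1"
        using bd[of "u T \<omega>"] bd[of "u (t k) \<omega> * ?J \<omega>"] by linarith
      also have "\<dots> \<le> 2 * C * (indicator ?B1 \<omega> + indicator ?B2 \<omega>)"
        using True C by (intro mult_left_mono) (auto simp: indicator_def)
      also have "\<dots> \<le> ?R \<omega>" using L \<epsilon> by (simp add: add_nonneg_nonneg)
      finally show ?thesis .
    next
      case False
      then have b: "\<bar>u T \<omega> - E N \<omega>\<bar> \<le> \<epsilon>" "\<bar>u (t k) \<omega> - E k \<omega>\<bar> \<le> \<epsilon>" using \<omega> by auto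
      have eq: "u T \<omega> - u (t k) \<omega> * ?J \<omega> = (u T \<omega> - E N \<omega>) - (u (t k) \<omega> - E k \<omega>) * ?J \<omega>"
        unfolding E_ratio[OF k] by (simp add: algebra_simps)
      have "\<bar>(u (t k) \<omega> - E k \<omega>) * ?J \<omega>\<bar> \<le> \<epsilon> * ?J \<omega>"
        unfolding abs_mult using mult_right_mono[OF b(2) J0] by simp
      then have "\<bar>u T \<omega> - u (t k) \<omega> * ?J \<omega>\<bar> \<le> \<epsilon> + \<epsilon> * ?J \<omega>"
        unfolding eq using b(1) abs_triangle_ineq4[of "u T \<omega> - E N \<omega>" "(u (t k) \<omega> - E k \<omega>) * ?J \<omega>"] by linarith
      from mult_left_mono[OF this L] have "L * \<bar>u T \<omega> - u (t k) \<omega> * ?J \<omega>\<bar> \<le> L * (\<epsilon> + \<epsilon> * ?J \<omega>)" .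
      then have "\<bar>g (u T \<omega>) - g (u (t k) \<omega> * ?J \<omega>)\<bar> \<le> L * (\<epsilon> + \<epsilon> * ?J \<omega>)"
        using lip[of "u T \<omega>" "u (t k) \<omega> * ?J \<omega>"] by linarith
      also have "\<dots> \<le> ?R \<omega>" using C by (simp add: distrib_left)
      finally show ?thesis .
    qed
    moreover have "0 \<le> ?R \<omega>" using C L \<epsilon> by (intro add_nonneg_nonneg mult_nonneg_nonneg) auto
    ultimately show ?thesis by (auto simp: indicator_def)
  qed
  have "\<bar>expectation (\<lambda>\<omega>. indicator A \<omega> * g (u T \<omega>)) - expectation (\<lambda>\<omega>. indicator A \<omega> * g (u (t k) \<omega> * ?J \<omega>))\<bar> =
     \<bar>expectation (\<lambda>\<omega>. indicator A \<omega> * g (u T \<omega>) - indicator A \<omega> * g (u (t k) \<omega> * ?J \<omega>))\<bar>"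
    by (subst Bochner_Integration.integral_diff) (auto intro!: i)
  also have "\<dots> \<le> expectation (\<lambda>\<omega>. \<bar>indicator A \<omega> * g (u T \<omega>) - indicator A \<omega> * g (u (t k) \<omega> * ?J \<omega>)\<bar>)"
    by (rule integral_abs_bound)
  also have "\<dots> \<le> expectation ?R"
    by (rule integral_mono[OF _ R(1) le]) (auto intro!: Bochner_Integration.integrable_diff i)
  finally show ?thesis unfolding R(2) .
qed

end

context linear_sde
begin

text \<open>For each grid the statement is exact with the lognormal factor \<open>J m\<close> and
  variance \<open>H m\<close>. Under refinement, convergence in probability lets \<open>u T\<close>
  replace \<open>u ?s * J m\<close> inside the Lipschitz function \<open>g\<close>, and
  \<open>H m\<close> tends to \<open>v\<close>.\<close>

lemma conditional_law_lipschitz: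
  assumes p: "p > 0" and j: "j \<le> p" and A: "A \<in> sets (F (real j * T / real p))"
    and bd: "\<And>x. \<bar>g x\<bar> \<le> C" and lip: "\<And>x y. \<bar>g x - g y\<bar> \<le> L * \<bar>x - y\<bar>" and L: "0 \<le> L"
  defines "v \<equiv> integral {real j * T / real p..T} (\<lambda>s. (norm (\<theta> s))\<^sup>2)"
  shows "expectation (\<lambda>\<omega>. indicator A \<omega> * g (u T \<omega>)) =
    expectation (\<lambda>\<omega>. indicator A \<omega> * lognormal_mean g v (u (real j * T / real p) \<omega>))"
proof -
  let ?s = "real j * T / real p"
  have s: "?s \<in> {0..T}" using p j T_pos by (simp add: field_simps)
  have AM [measurable]: "A \<in> sets M" using A sets_F by blast
  have gc: "continuous_on UNIV g" by (rule lipschitz_imp_continuous[OF lip])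
  have [measurable]: "g \<in> borel_measurable borel" by (rule borel_measurable_continuous_onI[OF gc])
  have [measurable]: "u ?s \<in> borel_measurable M" by (rule measurable_F_M[OF u_adapted[OF s]])
  have C: "0 \<le> C" using bd[of 0] by linarith
  obtain N l where N: "\<And>m. N m > 0" "\<And>m. p dvd N m"
    and conv: "\<And>\<epsilon> j. \<epsilon> > 0 \<Longrightarrow> j \<le> p \<Longrightarrow>
      (\<lambda>m. prob {\<omega>\<in>space M. \<epsilon> < \<bar>u (real j * T / real p) \<omega> - euler.E W T y0 (N m) (l m) (j * (N m div p)) \<omega>\<bar>}) \<longlonglongrightarrow> 0"
    and \<Delta>: "(\<lambda>m. \<Sum>k<N m. integral {euler.t T (N m) k..euler.t T (N m) (Suc k)} (\<lambda>s. (norm (\<theta> s - l m k))\<^sup>2)) \<longlonglongrightarrow> 0"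
  proof -
    show ?thesis
    proof (rule euler_converges[OF p], goal_cases)
      case (1 N l)
      show ?thesis by (rule that[OF 1])
    qed
  qed
  have eu: "euler M F W T y0 q \<theta> y I (N m)" for m by unfold_locales (rule N(1))
  let ?k = "\<lambda>m. j * (N m div p)"
  define H where "H m = (\<Sum>i=?k m..<N m. euler.h T (N m) (l m) i)" for m
  define J where "J m \<omega> = exp (- (\<Sum>i=?k m..<N m. euler.dN W T (N m) (l m) i \<omega>) - H m / 2)" for m \<omega>
  have k: "?k m \<le> N m" and tk: "euler.t T (N m) (?k m) = ?s" and pN: "p * (N m div p) = N m" for m
  proof -
    show 1: "p * (N m div p) = N m" using N(2) by simp
    have "?k m \<le> p * (N m div p)" using j by (rule mult_right_mono) simp
    then show "?k m \<le> N m" using 1 by simp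
    obtain c where c: "N m = p * c" using N(2)[of m] by (auto elim: dvdE)
    then have "c > 0" using N(1)[of m] by (cases c) auto
    then show "euler.t T (N m) (?k m) = ?s" unfolding euler.t_def[OF eu] unfolding c using p by simp
  qed
  have step: "expectation (\<lambda>\<omega>. indicator A \<omega> * g (u ?s \<omega> * J m \<omega>)) = expectation (\<lambda>\<omega>. indicator A \<omega> * lognormal_mean g (H m) (u ?s \<omega>))" for m
  proof -
    interpret euler M F W T y0 q \<theta> y I "N m" "l m" by (rule eu)
    have uk: "u ?s \<in> borel_measurable (F (t (?k m)))" "A \<in> sets (F (t (?k m)))"
      unfolding tk using u_adapted[OF s] A by auto
    show ?thesis unfolding J_def H_def by (rule expectation_lognormal_increment[OF k uk(1) _ bd uk(2)]) simp
  qed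
  have diff: "(\<lambda>m. expectation (\<lambda>\<omega>. indicator A \<omega> * g (u ?s \<omega> * J m \<omega>))) \<longlonglongrightarrow> expectation (\<lambda>\<omega>. indicator A \<omega> * g (u T \<omega>))"
  proof (rule LIMSEQ_I)
    fix \<eta> :: real assume \<eta>: "0 < \<eta>"
    define \<epsilon> where "\<epsilon> = \<eta> / (4 * (L + 1))"
    have \<epsilon>: "0 < \<epsilon>" "2 * L * \<epsilon> \<le> \<eta> / 2" using \<eta> L by (auto simp: \<epsilon>_def field_simps)
    let ?P = "\<lambda>m j. prob {\<omega>\<in>space M. \<epsilon> < \<bar>u (real j * T / real p) \<omega> - euler.E W T y0 (N m) (l m) (j * (N m div p)) \<omega>\<bar>}"
    have "(\<lambda>m. 2 * C * (?P m p + ?P m j)) \<longlonglongrightarrow> 2 * C * (0 + 0)"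
      by (intro tendsto_mult_left tendsto_add conv[OF \<epsilon>(1)] j order_refl)
    then have "\<forall>\<^sub>F m in sequentially. 2 * C * (?P m p + ?P m j) < \<eta> / 2" using \<eta> by (intro order_tendstoD(2)) auto
    then obtain m0 where m0: "\<And>m. m \<ge> m0 \<Longrightarrow> 2 * C * (?P m p + ?P m j) < \<eta> / 2"
      by (auto simp: eventually_sequentially)
    show "\<exists>m0. \<forall>m\<ge>m0. norm (expectation (\<lambda>\<omega>. indicator A \<omega> * g (u ?s \<omega> * J m \<omega>)) - expectation (\<lambda>\<omega>. indicator A \<omega> * g (u T \<omega>))) < \<eta>"
    proof (intro exI[of _ m0] allI impI)
      fix m assume "m0 \<le> m"
      interpret euler M F W T y0 q \<theta> y I "N m" "l m" by (rule eu)
      have pT: "real p * T / real p = T" using p by simp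
      have "\<bar>expectation (\<lambda>\<omega>. indicator A \<omega> * g (u T \<omega>)) - expectation (\<lambda>\<omega>. indicator A \<omega> * g (u ?s \<omega> * J m \<omega>))\<bar> \<le>
         2 * C * (?P m p + ?P m j) + 2 * L * \<epsilon>"
        unfolding J_def H_def pN pT using ratio_error[OF k _ bd lip L \<epsilon>(1) AM] unfolding tk by simp
      also have "\<dots> < \<eta>" using m0[OF \<open>m0 \<le> m\<close>] \<epsilon>(2) by linarith
      finally show "norm (expectation (\<lambda>\<omega>. indicator A \<omega> * g (u ?s \<omega> * J m \<omega>)) - expectation (\<lambda>\<omega>. indicator A \<omega> * g (u T \<omega>))) < \<eta>"
        by (simp add: abs_minus_commute)
    qed
  qed
  have Hlim: "H \<longlonglongrightarrow> v"
  proof (rule LIMSEQ_I)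
    fix \<eta> :: real assume \<eta>: "0 < \<eta>"
    define \<Theta> where "\<Theta> = integral {0..T} (\<lambda>s. (norm (\<theta> s))\<^sup>2)"
    have \<Theta>: "0 \<le> \<Theta>" unfolding \<Theta>_def by (rule integral_nonneg[OF \<theta>_int]) simp
    define c where "c = \<eta> / (2 * (\<Theta> + 1))"
    have c: "0 < c" "c * \<Theta> \<le> \<eta> / 2" using \<eta> \<Theta> by (auto simp: c_def field_simps)
    let ?D = "\<lambda>m. \<Sum>k<N m. integral {euler.t T (N m) k..euler.t T (N m) (Suc k)} (\<lambda>s. (norm (\<theta> s - l m k))\<^sup>2)"
    have "(\<lambda>m. (1 + 1 / c) * ?D m) \<longlonglongrightarrow> (1 + 1 / c) * 0" by (intro tendsto_mult_left \<Delta>)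
    then have "\<forall>\<^sub>F m in sequentially. (1 + 1 / c) * ?D m < \<eta> / 2" using \<eta> by (intro order_tendstoD(2)) auto
    then obtain m0 where m0: "\<And>m. m \<ge> m0 \<Longrightarrow> (1 + 1 / c) * ?D m < \<eta> / 2"
      by (auto simp: eventually_sequentially)
    show "\<exists>m0. \<forall>m\<ge>m0. norm (H m - v) < \<eta>"
    proof (intro exI[of _ m0] allI impI)
      fix m assume "m0 \<le> m"
      interpret euler M F W T y0 q \<theta> y I "N m" "l m" by (rule eu)
      have "\<bar>H m - v\<bar> \<le> (1 + 1 / c) * ?D m + c * \<Theta>"
        using sum_h_error[OF c(1) k order_refl] unfolding H_def v_def \<Theta>_def tk tN .
      then show "norm (H m - v) < \<eta>" unfolding real_norm_def using m0[OF \<open>m0 \<le> m\<close>] c(2) by linarith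
    qed
  qed
  have "(\<lambda>m. expectation (\<lambda>\<omega>. indicator A \<omega> * lognormal_mean g (H m) (u ?s \<omega>))) \<longlonglongrightarrow>
     expectation (\<lambda>\<omega>. indicator A \<omega> * lognormal_mean g v (u ?s \<omega>))"
  proof (rule integral_dominated_convergence[where w="\<lambda>_. C"])
    show "AE \<omega> in M. (\<lambda>m. indicator A \<omega> * lognormal_mean g (H m) (u ?s \<omega>)) \<longlonglongrightarrow> indicator A \<omega> * lognormal_mean g v (u ?s \<omega>)"
      by (intro AE_I2 tendsto_mult_left lognormal_mean_tendsto_variance[OF gc bd Hlim])
    show "AE \<omega> in M. norm (indicator A \<omega> * lognormal_mean g (H m) (u ?s \<omega>)) \<le> C" for m
      using lognormal_mean_bound[of g C] bd C by (intro AE_I2) (auto simp: indicator_def)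
  qed auto
  then show ?thesis using LIMSEQ_unique[OF diff[unfolded step]] by simp
qed

text \<open>Passage to bounded pointwise limits of Lipschitz functions; the payoff of interest jumps
  at the level.\<close>

lemma conditional_law:
  assumes p: "p > 0" and j: "j \<le> p" and A: "A \<in> sets (F (real j * T / real p))"
    and g: "\<And>n x. \<bar>g n x\<bar> \<le> C" "\<And>n x y. \<bar>g n x - g n y\<bar> \<le> L n * \<bar>x - y\<bar>" "\<And>n. 0 \<le> L n"
    and lim: "\<And>x. (\<lambda>n. g n x) \<longlonglongrightarrow> f x"
  defines "v \<equiv> integral {real j * T / real p..T} (\<lambda>s. (norm (\<theta> s))\<^sup>2)"
  shows "expectation (\<lambda>\<omega>. indicator A \<omega> * f (u T \<omega>)) =
    expectation (\<lambda>\<omega>. indicator A \<omega> * lognormal_mean f v (u (real j * T / real p) \<omega>))"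
proof -
  let ?s = "real j * T / real p"
  have s: "?s \<in> {0..T}" using p j T_pos by (simp add: field_simps)
  have AM [measurable]: "A \<in> sets M" using A sets_F by blast
  have gm [measurable]: "g n \<in> borel_measurable borel" for n
    by (rule borel_measurable_continuous_onI[OF lipschitz_imp_continuous[OF g(2)]])
  have fm [measurable]: "f \<in> borel_measurable borel"
    by (rule borel_measurable_LIMSEQ_real[OF lim gm])
  have [measurable]: "u ?s \<in> borel_measurable M" by (rule measurable_F_M[OF u_adapted[OF s]])
  have [measurable]: "u T \<in> borel_measurable M" using measurable_F_M[OF u_adapted[of T]] T_pos by simp
  have C: "0 \<le> C" using g(1)[of undefined 0] by linarith
  have "(\<lambda>n. expectation (\<lambda>\<omega>. indicator A \<omega> * g n (u T \<omega>))) \<longlonglongrightarrow> expectation (\<lambda>\<omega>. indicator A \<omega> * f (u T \<omega>))"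
    by (rule integral_dominated_convergence[where w="\<lambda>_. C"])
      (use g(1) C in \<open>auto intro!: AE_I2 tendsto_mult_left lim simp: indicator_def\<close>)
  moreover have "(\<lambda>n. expectation (\<lambda>\<omega>. indicator A \<omega> * lognormal_mean (g n) v (u ?s \<omega>))) \<longlonglongrightarrow>
     expectation (\<lambda>\<omega>. indicator A \<omega> * lognormal_mean f v (u ?s \<omega>))"
  proof (rule integral_dominated_convergence[where w="\<lambda>_. C"])
    show "AE \<omega> in M. (\<lambda>n. indicator A \<omega> * lognormal_mean (g n) v (u ?s \<omega>)) \<longlonglongrightarrow> indicator A \<omega> * lognormal_mean f v (u ?s \<omega>)"
      by (intro AE_I2 tendsto_mult_left lognormal_mean_tendsto[OF gm fm g(1) lim])
    show "AE \<omega> in M. norm (indicator A \<omega> * lognormal_mean (g n) v (u ?s \<omega>)) \<le> C" for n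
      using lognormal_mean_bound[OF gm g(1)] C by (intro AE_I2) (auto simp: indicator_def)
  qed auto
  moreover have "expectation (\<lambda>\<omega>. indicator A \<omega> * g n (u T \<omega>)) = expectation (\<lambda>\<omega>. indicator A \<omega> * lognormal_mean (g n) v (u ?s \<omega>))" for n
    unfolding v_def by (rule conditional_law_lipschitz[OF p j A g])
  ultimately show ?thesis using LIMSEQ_unique by simp
qed

end

section \<open>Gaussian tails and the method of images\<close>

definition normal_tail :: "real \<Rightarrow> real" where
  "normal_tail b = (\<integral>r. std_normal_density r * indicator {b..} r \<partial>lborel)"

lemma integrable_std_normal_indicator:
  assumes [measurable]: "S \<in> sets borel"
  shows "integrable lborel (\<lambda>r. std_normal_density r * indicator S r)"
  by (rule Bochner_Integration.integrable_bound[OF integrable_normal_density[of 1 0]])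
    (auto simp: indicator_def)

lemma normal_tail_erfc: "normal_tail b = 1 / 2 * erfc (b / sqrt 2)"
proof -
  have "normal_tail b = sqrt 2 * (\<integral>r. std_normal_density (sqrt 2 * r) * indicator {b..} (sqrt 2 * r) \<partial>lborel)"
    unfolding normal_tail_def
    by (subst lborel_integral_real_affine[where c="sqrt 2" and t=0]) auto
  also have "(\<lambda>r. std_normal_density (sqrt 2 * r) * indicator {b..} (sqrt 2 * r)) =
      (\<lambda>r. 1 / sqrt (2 * pi) * (indicator {b / sqrt 2..} r *\<^sub>R exp (- (r ^ 2))))"
    by (auto simp: std_normal_density_def indicator_def power_mult_distrib field_simps fun_eq_iff)
  also have "sqrt 2 * (\<integral>r. 1 / sqrt (2 * pi) * (indicator {b / sqrt 2..} r *\<^sub>R exp (- (r ^ 2))) \<partial>lborel) =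
      1 / sqrt pi * (LINT r:{b / sqrt 2..}|lborel. exp (- (r ^ 2)))"
    by (simp add: set_lebesgue_integral_def real_sqrt_mult)
  also have "(LINT r:{b / sqrt 2..}|lborel. exp (- (r ^ 2))) = integral {b / sqrt 2..} (\<lambda>r. exp (- (r ^ 2)))"
  proof (rule set_borel_integral_eq_integral(2))
    have "integrable lborel (\<lambda>r. std_normal_density (sqrt 2 * r))"
      using lborel_integrable_real_affine[of "std_normal_density" "sqrt 2" 0] by simp
    then have "integrable lborel (\<lambda>r. sqrt (2 * pi) * std_normal_density (sqrt 2 * r))" by (rule integrable_mult_right)
    then have "integrable lborel (\<lambda>r. exp (- (r ^ 2)) :: real)"
      by (simp add: std_normal_density_def power_mult_distrib)
    then show "set_integrable lborel {b / sqrt 2..} (\<lambda>r. exp (- (r ^ 2)) :: real)"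
      unfolding set_integrable_def by (intro integrable_mult_indicator) auto
  qed
  finally show ?thesis by (simp add: erfc_def)
qed

lemma normal_tail_lipschitz: "\<bar>normal_tail a - normal_tail b\<bar> \<le> \<bar>a - b\<bar>"
proof -
  have le1: "std_normal_density r \<le> 1" for r
  proof -
    have "1 \<le> sqrt (2 * pi)" using pi_gt3 by (simp add: real_le_rsqrt)
    moreover have "exp (- r\<^sup>2 / 2) \<le> (1::real)" by simp
    ultimately have "exp (- r\<^sup>2 / 2) \<le> sqrt (2 * pi)" by linarith
    then show ?thesis using pi_gt_zero by (simp add: std_normal_density_def field_simps)
  qed
  have ord: "\<bar>normal_tail a - normal_tail b\<bar> \<le> b - a" if "a \<le> b" for a b
  proof -
    have "normal_tail a - normal_tail b = (\<integral>r. std_normal_density r * indicator {a..} r - std_normal_density r * indicator {b..} r \<partial>lborel)"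
      unfolding normal_tail_def by (subst Bochner_Integration.integral_diff) (auto intro!: integrable_std_normal_indicator)
    also have "\<dots> = (\<integral>r. std_normal_density r * indicator {a..<b} r \<partial>lborel)"
      using that by (intro Bochner_Integration.integral_cong) (auto simp: indicator_def)
    finally have eq: "normal_tail a - normal_tail b = (\<integral>r. std_normal_density r * indicator {a..<b} r \<partial>lborel)" .
    have "(\<integral>r. std_normal_density r * indicator {a..<b} r \<partial>lborel) \<le> (\<integral>r. indicator {a..<b} r \<partial>lborel)"
    proof (intro integral_mono integrable_std_normal_indicator integrable_real_indicator)
      show "std_normal_density r * indicator {a..<b} r \<le> indicator {a..<b} r" for r
        using le1[of r] by (simp add: indicator_def)
    qed (use that in auto)
    also have "\<dots> = b - a" using that by simp
    finally have "normal_tail a - normal_tail b \<le> b - a" unfolding eq .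
    moreover have "0 \<le> normal_tail a - normal_tail b" unfolding eq by (intro Bochner_Integration.integral_nonneg) simp
    ultimately show ?thesis by simp
  qed
  show ?thesis using ord[of a b] ord[of b a] by (cases "a \<le> b") auto
qed

lemma normal_tail_continuous: "continuous_on UNIV normal_tail"
  by (rule lipschitz_imp_continuous[where L=1]) (simp add: normal_tail_lipschitz)

text \<open>
  Method of images for Brownian motion with drift \<open>3 / 2\<close>, in the coordinate \<open>exp (- X)\<close>: the payoff
  vanishes before the level \<open>c\<close> is reached and is chosen such that its expected value is exactly \<open>1\<close> at the level.
\<close>

definition stop_payoff :: "real \<Rightarrow> real \<Rightarrow> real" where
  "stop_payoff c x = (if x * exp c \<le> 1 then 1 + (max 0 (x * exp c)) ^ 3 else 0)"

text \<open>Expected payoff when the normalised process is at \<open>x\<close> with clock time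
  \<open>v\<close> left. \<open>lognormal_mean\<close> accounts for \<open>1 / 2\<close> of the
  drift \<open>3 / 2\<close>; the factor \<open>exp (- v)\<close> supplies the rest.\<close>

definition hit_value :: "real \<Rightarrow> real \<Rightarrow> real \<Rightarrow> real" where
  "hit_value c v x = lognormal_mean (stop_payoff c) v (x * exp (- v))"

lemma stop_payoff_measurable [measurable]: "stop_payoff c \<in> borel_measurable borel"
  unfolding stop_payoff_def[abs_def] by measurable

lemma stop_payoff_bounds: "0 \<le> stop_payoff c x" "stop_payoff c x \<le> 2" "\<bar>stop_payoff c x\<bar> \<le> 2"
proof -
  show 1: "0 \<le> stop_payoff c x" by (auto simp: stop_payoff_def)
  show 2: "stop_payoff c x \<le> 2"
    using power_le_one[of "max 0 (x * exp c)" 3] by (auto simp: stop_payoff_def)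
  show "\<bar>stop_payoff c x\<bar> \<le> 2" using 1 2 by simp
qed

lemma hit_value_measurable [measurable]: "hit_value c v \<in> borel_measurable borel"
  unfolding hit_value_def[abs_def] by measurable

lemma hit_value_bounds: "0 \<le> hit_value c v x" "hit_value c v x \<le> 2"
proof -
  show "0 \<le> hit_value c v x" unfolding hit_value_def lognormal_mean_def
    by (intro Bochner_Integration.integral_nonneg stop_payoff_bounds)
  show "hit_value c v x \<le> 2" unfolding hit_value_def
    using lognormal_mean_bound[of "stop_payoff c" 2 v] stop_payoff_bounds(3) by (simp add: abs_le_iff)
qed

text \<open>\<open>z0\<close> is the value of the normal variable at which the terminal value meets
  \<open>exp (- c)\<close>. Beyond it the payoff is 1 plus the cube, and the cube is
  \<open>exp (- 3 * sqrt v * (r - z0))\<close>.\<close>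

lemma hit_value_eq:
  fixes x c v :: real
  assumes x: "x > 0" and v: "v > 0"
  defines "z0 \<equiv> (ln x + c - 3 / 2 * v) / sqrt v"
  shows "hit_value c v x = (\<integral>r. std_normal_density r * indicator {z0..} r \<partial>lborel) +
      (\<integral>r. std_normal_density r * (indicator {z0..} r * exp (- 3 * sqrt v * (r - z0))) \<partial>lborel)"
    and "integrable lborel (\<lambda>r. std_normal_density r * (indicator {z0..} r * exp (- 3 * sqrt v * (r - z0))))"
proof -
  have sv: "sqrt v > 0" "sqrt v * z0 = ln x + c - 3 / 2 * v" using v by (auto simp: z0_def)
  show int: "integrable lborel (\<lambda>r. std_normal_density r * (indicator {z0..} r * exp (- 3 * sqrt v * (r - z0))))"
  proof (rule Bochner_Integration.integrable_bound[OF integrable_normal_density[of 1 0]])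
    have "\<bar>indicator {z0..} r * exp (- 3 * sqrt v * (r - z0))\<bar> \<le> 1" for r
      using sv(1) by (auto simp: indicator_def)
    then have "std_normal_density r * \<bar>indicator {z0..} r * exp (- 3 * sqrt v * (r - z0))\<bar> \<le> std_normal_density r" for r
      by (intro mult_left_le) auto
    then show "AE r in lborel. norm (std_normal_density r * (indicator {z0..} r * exp (- 3 * sqrt v * (r - z0)))) \<le> norm (std_normal_density r)"
      by (intro AE_I2) (simp add: abs_mult)
  qed auto
  have payoff: "stop_payoff c (x * exp (- v) * exp (- (sqrt v * r) - v / 2)) =
      indicator {z0..} r + indicator {z0..} r * exp (- 3 * sqrt v * (r - z0))" for r
  proof -
    have "x * exp (- v) * exp (- (sqrt v * r) - v / 2) * exp c = exp (ln x) * exp (- v) * exp (- (sqrt v * r) - v / 2) * exp c"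
      using x by simp
    also have "\<dots> = exp (sqrt v * z0 - sqrt v * r)"
      unfolding sv(2) exp_add[symmetric] by (rule arg_cong[where f=exp]) simp
    finally have e: "x * exp (- v) * exp (- (sqrt v * r) - v / 2) * exp c = exp (sqrt v * z0 - sqrt v * r)" .
    have "exp (sqrt v * z0 - sqrt v * r) ^ 3 = exp (- 3 * sqrt v * (r - z0))"
      unfolding exp_of_nat_mult[symmetric] by (rule arg_cong[where f=exp]) (simp add: algebra_simps)
    moreover have "exp (sqrt v * z0 - sqrt v * r) \<le> 1 \<longleftrightarrow> z0 \<le> r"
      using sv(1) by simp
    ultimately show ?thesis unfolding stop_payoff_def e by (auto simp: max_def)
  qed
  have "hit_value c v x = (\<integral>r. std_normal_density r * (indicator {z0..} r + indicator {z0..} r * exp (- 3 * sqrt v * (r - z0))) \<partial>lborel)"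
    unfolding hit_value_def lognormal_mean_def payoff by (subst integral_std_normal_distribution) auto
  also have "\<dots> = (\<integral>r. std_normal_density r * indicator {z0..} r + std_normal_density r * (indicator {z0..} r * exp (- 3 * sqrt v * (r - z0))) \<partial>lborel)"
    by (simp add: distrib_left)
  also have "\<dots> = (\<integral>r. std_normal_density r * indicator {z0..} r \<partial>lborel) +
      (\<integral>r. std_normal_density r * (indicator {z0..} r * exp (- 3 * sqrt v * (r - z0))) \<partial>lborel)"
    by (intro Bochner_Integration.integral_add int integrable_std_normal_indicator) simp
  finally show "hit_value c v x = (\<integral>r. std_normal_density r * indicator {z0..} r \<partial>lborel) +
      (\<integral>r. std_normal_density r * (indicator {z0..} r * exp (- 3 * sqrt v * (r - z0))) \<partial>lborel)" .
qed

text \<open>Reflecting the half line below \<open>z0\<close> at \<open>z0\<close> multiplies the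
  normal density by \<open>exp (2 * z0 * (r - z0))\<close>. The total mass 1 thereby takes the same
  form as \<open>hit_value_eq\<close>, and comparing the two reduces to comparing
  \<open>2 * z0\<close> with \<open>- 3 * sqrt v\<close>.\<close>

lemma one_eq_reflected:
  fixes z0 :: real
  shows "1 = (\<integral>r. std_normal_density r * indicator {z0..} r \<partial>lborel) +
      (\<integral>r. std_normal_density r * (indicator {z0<..} r * exp (2 * z0 * (r - z0))) \<partial>lborel)"
    and "integrable lborel (\<lambda>r. std_normal_density r * (indicator {z0<..} r * exp (2 * z0 * (r - z0))))"
proof -
  have refl: "std_normal_density (2 * z0 + (-1) * r) * indicator {..<z0} (2 * z0 + (-1) * r) =
     std_normal_density r * (indicator {z0<..} r * exp (2 * z0 * (r - z0)))" for r
  proof -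
    have "exp (- (2 * z0 - r)\<^sup>2 / 2) = exp (- r\<^sup>2 / 2) * exp (2 * z0 * (r - z0))"
      unfolding exp_add[symmetric] by (rule arg_cong[where f=exp]) (simp add: power2_eq_square field_simps)
    then show ?thesis by (auto simp: std_normal_density_def indicator_def)
  qed
  have "1 = (\<integral>r. std_normal_density r \<partial>lborel)" by simp
  also have "\<dots> = (\<integral>r. std_normal_density r * indicator {z0..} r + std_normal_density r * indicator {..<z0} r \<partial>lborel)"
    by (intro Bochner_Integration.integral_cong) (auto simp: indicator_def)
  also have "\<dots> = (\<integral>r. std_normal_density r * indicator {z0..} r \<partial>lborel) + (\<integral>r. std_normal_density r * indicator {..<z0} r \<partial>lborel)"
    by (intro Bochner_Integration.integral_add integrable_std_normal_indicator) auto
  also have "(\<integral>r. std_normal_density r * indicator {..<z0} r \<partial>lborel) =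
     (\<integral>r. std_normal_density r * (indicator {z0<..} r * exp (2 * z0 * (r - z0))) \<partial>lborel)"
    by (subst lborel_integral_real_affine[where c="-1" and t="2 * z0"]) (simp_all only: refl, simp_all)
  finally show "1 = (\<integral>r. std_normal_density r * indicator {z0..} r \<partial>lborel) +
      (\<integral>r. std_normal_density r * (indicator {z0<..} r * exp (2 * z0 * (r - z0))) \<partial>lborel)" .
  have "integrable lborel (\<lambda>r. std_normal_density r * indicator {..<z0} r)" by (rule integrable_std_normal_indicator) simp
  from lborel_integrable_real_affine[OF this, of "-1" "2 * z0"]
  show "integrable lborel (\<lambda>r. std_normal_density r * (indicator {z0<..} r * exp (2 * z0 * (r - z0))))"
    unfolding refl by simp
qed

text \<open>\<open>2 * z0 + 3 * sqrt v = 2 * (ln x + c) / sqrt v\<close> is not positive here, so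
  the image term dominates the reflected mass. Nonpositive \<open>x\<close> is included because the
  sign of the process is not known pathwise.\<close>

lemma hit_value_above:
  assumes v: "0 \<le> v" and x: "x * exp c \<le> 1"
  shows "1 \<le> hit_value c v x"
proof (cases "x \<le> 0 \<or> v = 0")
  case True
  interpret N: prob_space std_normal_distribution by (rule prob_space_std_normal_distribution)
  have ge: "1 \<le> stop_payoff c (x * exp (- v) * exp (- (sqrt v * r) - v / 2))" for r
  proof (cases "v = 0")
    case False
    then have "x * exp (- v) * exp (- (sqrt v * r) - v / 2) * exp c \<le> 0" using True by (simp add: mult_nonpos_nonneg)
    then show ?thesis by (simp add: stop_payoff_def)
  qed (use x in \<open>simp add: stop_payoff_def\<close>)
  have "(\<integral>r. 1 \<partial>std_normal_distribution) \<le> hit_value c v x"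
    unfolding hit_value_def lognormal_mean_def
    by (intro integral_mono ge N.integrable_const_bound[where B=2]) (use stop_payoff_bounds(3) in auto)
  then show ?thesis using N.prob_space by simp
next
  case False
  then have xp: "x > 0" and vp: "v > 0" using v by auto
  define z0 where "z0 = (ln x + c - 3 / 2 * v) / sqrt v"
  have "ln (x * exp c) \<le> 0" using x xp by simp
  then have lx: "ln x + c \<le> 0" using xp by (simp add: ln_mult)
  have "2 * z0 + 3 * sqrt v = 2 * (ln x + c) / sqrt v" using vp by (simp add: z0_def field_simps)
  also have "\<dots> \<le> 0" using lx vp by (simp add: divide_nonpos_pos)
  finally have z: "2 * z0 \<le> - 3 * sqrt v" by simp
  have "(\<integral>r. std_normal_density r * (indicator {z0<..} r * exp (2 * z0 * (r - z0))) \<partial>lborel) \<le>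
     (\<integral>r. std_normal_density r * (indicator {z0..} r * exp (- 3 * sqrt v * (r - z0))) \<partial>lborel)"
  proof (rule integral_mono[OF one_eq_reflected(2) hit_value_eq(2)[OF xp vp, of c, folded z0_def]])
    fix r
    have "2 * z0 * (r - z0) \<le> - 3 * sqrt v * (r - z0)" if "z0 < r" using z that by (intro mult_right_mono) auto
    then show "std_normal_density r * (indicator {z0<..} r * exp (2 * z0 * (r - z0))) \<le>
      std_normal_density r * (indicator {z0..} r * exp (- 3 * sqrt v * (r - z0)))"
      by (intro mult_left_mono) (auto simp: indicator_def)
  qed
  then show ?thesis using hit_value_eq(1)[OF xp vp, of c] one_eq_reflected(1)[of z0] unfolding z0_def[symmetric] by linarith
qed

text \<open>The same comparison with the opposite sign of \<open>ln x + c\<close>. On the level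
  itself both exponents agree, which is why the payoff is worth exactly 1 there.\<close>

lemma hit_value_below:
  assumes v: "0 \<le> v" and x: "1 < x * exp c"
  shows "hit_value c v x \<le> 1"
proof (cases "v = 0")
  case True
  interpret N: prob_space std_normal_distribution by (rule prob_space_std_normal_distribution)
  show ?thesis using True x by (simp add: hit_value_def lognormal_mean_def stop_payoff_def)
next
  case False
  have xp: "x > 0" using x by (metis exp_gt_zero less_trans not_less_iff_gr_or_eq zero_less_mult_pos2 zero_less_one)
  have vp: "v > 0" using False v by simp
  define z0 where "z0 = (ln x + c - 3 / 2 * v) / sqrt v"
  have "0 < ln (x * exp c)" using x by (intro ln_gt_zero)
  then have lx: "0 \<le> ln x + c" using xp by (simp add: ln_mult)
  have "0 \<le> 2 * (ln x + c) / sqrt v" using lx vp by simp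
  also have "\<dots> = 2 * z0 + 3 * sqrt v" using vp by (simp add: z0_def field_simps)
  finally have z: "- 3 * sqrt v \<le> 2 * z0" by simp
  have "(\<integral>r. std_normal_density r * (indicator {z0..} r * exp (- 3 * sqrt v * (r - z0))) \<partial>lborel) =
     (\<integral>r. std_normal_density r * (indicator {z0<..} r * exp (- 3 * sqrt v * (r - z0))) \<partial>lborel)"
  proof (rule integral_cong_AE)
    show "AE r in lborel. std_normal_density r * (indicator {z0..} r * exp (- 3 * sqrt v * (r - z0))) =
       std_normal_density r * (indicator {z0<..} r * exp (- 3 * sqrt v * (r - z0)))"
      using AE_lborel_singleton[of z0] by eventually_elim (auto simp: indicator_def)
  qed auto
  also have "\<dots> \<le> (\<integral>r. std_normal_density r * (indicator {z0<..} r * exp (2 * z0 * (r - z0))) \<partial>lborel)"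
  proof (rule integral_mono[OF _ one_eq_reflected(2)])
    show "integrable lborel (\<lambda>r. std_normal_density r * (indicator {z0<..} r * exp (- 3 * sqrt v * (r - z0))))"
      by (rule Bochner_Integration.integrable_bound[OF hit_value_eq(2)[OF xp vp, of c, folded z0_def]])
        (auto simp: indicator_def)
    fix r
    have "- 3 * sqrt v * (r - z0) \<le> 2 * z0 * (r - z0)" if "z0 < r" using z that by (intro mult_right_mono) auto
    then show "std_normal_density r * (indicator {z0<..} r * exp (- 3 * sqrt v * (r - z0))) \<le>
      std_normal_density r * (indicator {z0<..} r * exp (2 * z0 * (r - z0)))"
      by (cases "z0 < r") (auto intro!: mult_left_mono)
  qed
  finally show ?thesis using hit_value_eq(1)[OF xp vp, of c] one_eq_reflected(1)[of z0] unfolding z0_def[symmetric] by linarith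
qed

text \<open>In the image term, completing the square shifts the normal variable by
  \<open>3 * sqrt v\<close>. This turns the drift \<open>3 / 2\<close> into \<open>- 3 / 2\<close>
  in the argument of the tail and leaves the constant \<open>exp (3 * c)\<close>.\<close>

lemma hit_value_start:
  assumes v: "v > 0"
  shows "hit_value c v 1 = normal_tail ((c - 3 / 2 * v) / sqrt v) + exp (3 * c) * normal_tail ((c + 3 / 2 * v) / sqrt v)"
proof -
  define z0 where "z0 = (c - 3 / 2 * v) / sqrt v"
  have sv: "sqrt v * z0 = c - 3 / 2 * v" "sqrt v * sqrt v = v" using v by (auto simp: z0_def)
  have shift: "std_normal_density (- 3 * sqrt v + 1 * r) * (indicator {z0..} (- 3 * sqrt v + 1 * r) * exp (- 3 * sqrt v * (- 3 * sqrt v + 1 * r - z0)))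
     = exp (3 * c) * (std_normal_density r * indicator {z0 + 3 * sqrt v..} r)" for r
  proof -
    have "exp (- (- 3 * sqrt v + 1 * r)\<^sup>2 / 2) * exp (- 3 * sqrt v * (- 3 * sqrt v + 1 * r - z0)) = exp (3 * c) * exp (- r\<^sup>2 / 2)"
    proof -
      have "- (- 3 * sqrt v + 1 * r)\<^sup>2 / 2 + - 3 * sqrt v * (- 3 * sqrt v + 1 * r - z0) = 9 / 2 * (sqrt v * sqrt v) + 3 * (sqrt v * z0) - r\<^sup>2 / 2"
        by (simp add: power2_eq_square field_simps)
      also have "\<dots> = 3 * c + - r\<^sup>2 / 2" unfolding sv by simp
      finally show ?thesis unfolding exp_add[symmetric] by simp
    qed
    then show ?thesis by (auto simp: std_normal_density_def indicator_def)
  qed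
  have "(\<integral>r. std_normal_density r * (indicator {z0..} r * exp (- 3 * sqrt v * (r - z0))) \<partial>lborel) =
     exp (3 * c) * normal_tail (z0 + 3 * sqrt v)"
    unfolding normal_tail_def
    by (subst lborel_integral_real_affine[where c=1 and t="- 3 * sqrt v"]) (simp_all only: shift, simp_all)
  moreover have "z0 + 3 * sqrt v = (c + 3 / 2 * v) / sqrt v"
    using v by (simp add: z0_def field_simps)
  ultimately show ?thesis using hit_value_eq(1)[of 1 v c] v by (simp add: normal_tail_def z0_def)
qed

text \<open>A Lipschitz version of the payoff in the variable \<open>x * exp c\<close>. The jump is
  replaced by a ramp to the right of 1 only, so that the limit keeps the value 2 at the level
  itself; the inner \<open>min\<close> keeps the cube bounded on the ramp.\<close>

definition payoff_approx :: "nat \<Rightarrow> real \<Rightarrow> real" where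
  "payoff_approx n y = (1 + (max 0 (min y 1)) ^ 3) * max 0 (min 1 (1 - real n * (y - 1)))"

lemma payoff_approx_bound: "\<bar>payoff_approx n y\<bar> \<le> 2"
proof -
  have "(max 0 (min y 1)) ^ 3 \<le> 1" by (rule power_le_one) auto
  then have "(1 + (max 0 (min y 1)) ^ 3) * max 0 (min 1 (1 - real n * (y - 1))) \<le> 2 * 1"
    by (intro mult_mono) auto
  moreover have "0 \<le> payoff_approx n y" unfolding payoff_approx_def by (intro mult_nonneg_nonneg add_nonneg_nonneg) auto
  ultimately show ?thesis unfolding payoff_approx_def by linarith
qed

lemma payoff_approx_lipschitz: "\<bar>payoff_approx n y - payoff_approx n z\<bar> \<le> (3 + 2 * real n) * \<bar>y - z\<bar>"
proof -
  define A where "A y = max 0 (min y 1)" for y :: real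
  define P where "P y = max 0 (min 1 (1 - real n * (y - 1)))" for y :: real
  have A: "0 \<le> A y" "A y \<le> 1" "\<bar>A y - A z\<bar> \<le> \<bar>y - z\<bar>" for y z by (auto simp: A_def)
  have P: "0 \<le> P y" "P y \<le> 1" for y by (auto simp: P_def)
  have Pl: "\<bar>P y - P z\<bar> \<le> real n * \<bar>y - z\<bar>" for y z
  proof -
    have "\<bar>P y - P z\<bar> \<le> \<bar>(1 - real n * (y - 1)) - (1 - real n * (z - 1))\<bar>" unfolding P_def by (auto simp: max_def min_def)
    also have "\<dots> = \<bar>real n * (y - z)\<bar>" by (simp add: algebra_simps abs_minus_commute)
    finally show ?thesis by (simp add: abs_mult)
  qed
  have cube: "\<bar>A y ^ 3 - A z ^ 3\<bar> \<le> 3 * \<bar>y - z\<bar>"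
  proof -
    have "A y ^ 3 - A z ^ 3 = (A y - A z) * ((A y)\<^sup>2 + A y * A z + (A z)\<^sup>2)"
      by (simp add: power2_eq_square power3_eq_cube algebra_simps)
    then have "\<bar>A y ^ 3 - A z ^ 3\<bar> = \<bar>A y - A z\<bar> * ((A y)\<^sup>2 + A y * A z + (A z)\<^sup>2)"
      using A by (simp add: abs_mult add_nonneg_nonneg)
    also have "\<dots> \<le> \<bar>y - z\<bar> * (1 + 1 * 1 + 1)"
      using A by (intro mult_mono add_mono power_le_one) (auto intro: add_nonneg_nonneg)
    finally show ?thesis by simp
  qed
  have Ay3: "A y ^ 3 \<le> 1" "0 \<le> A y ^ 3" using A by (auto intro: power_le_one)
  have "payoff_approx n y - payoff_approx n z = (1 + A y ^ 3) * (P y - P z) + (A y ^ 3 - A z ^ 3) * P z"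
    unfolding payoff_approx_def A_def[symmetric] P_def[symmetric] by (simp add: algebra_simps)
  also have "\<bar>\<dots>\<bar> \<le> (1 + A y ^ 3) * \<bar>P y - P z\<bar> + \<bar>A y ^ 3 - A z ^ 3\<bar> * P z"
    using Ay3 P by (intro order_trans[OF abs_triangle_ineq]) (simp add: abs_mult)
  also have "\<dots> \<le> 2 * (real n * \<bar>y - z\<bar>) + (3 * \<bar>y - z\<bar>) * 1"
    using Ay3 P Pl cube by (intro add_mono mult_mono) auto
  finally show ?thesis by (simp add: algebra_simps)
qed

lemma payoff_approx_tendsto: "(\<lambda>n. payoff_approx n (x * exp c)) \<longlonglongrightarrow> stop_payoff c x"
proof (cases "x * exp c \<le> 1")
  case True
  then have "payoff_approx n (x * exp c) = stop_payoff c x" for n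
    using mult_nonneg_nonpos[of "real n" "x * exp c - 1"] by (simp add: payoff_approx_def stop_payoff_def min_def)
  then show ?thesis by simp
next
  case False
  then have d: "0 < x * exp c - 1" by simp
  obtain n0 :: nat where n0: "1 / (x * exp c - 1) < real n0" using reals_Archimedean2 by blast
  have "payoff_approx n (x * exp c) = stop_payoff c x" if "n \<ge> n0" for n
  proof -
    have "1 / (x * exp c - 1) < real n" using n0 that by linarith
    then have "1 < real n * (x * exp c - 1)" using d by (simp add: pos_divide_less_eq)
    then show ?thesis using False by (simp add: payoff_approx_def stop_payoff_def)
  qed
  then show ?thesis by (intro tendsto_eventually) (auto simp: eventually_sequentially)
qed

section \<open>The hitting probability\<close>

context linear_sde
begin

definition "A t = integral {0..t} (\<lambda>s. (norm (\<theta> s))\<^sup>2)"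

text \<open>Since \<open>a\<close> and \<open>A\<close> are the integrals of
  \<open>r - |\<theta>|^2\<close> and \<open>|\<theta>|^2\<close> in the application, this is
  \<open>y\<close> discounted at the rate \<open>r\<close> and divided by its initial value. It is
  expressed through \<open>u\<close>, whose conditional law is known; the quotient makes the sign of
  \<open>y0\<close> immaterial.\<close>

definition "V t \<omega> = u t \<omega> * exp (- A t) / y0"

lemma A_split: "t \<in> {0..T} \<Longrightarrow> A T = A t + integral {t..T} (\<lambda>s. (norm (\<theta> s))\<^sup>2)"
  unfolding A_def using Henstock_Kurzweil_Integration.integral_combine[of 0 t T "\<lambda>s. (norm (\<theta> s))\<^sup>2"] \<theta>_int by auto

lemma A_cont: "continuous_on {0..T} A"
  unfolding A_def by (rule indefinite_integral_continuous_1[OF \<theta>_int])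

lemma V_cont: "\<omega> \<in> space M \<Longrightarrow> continuous_on {0..T} (\<lambda>t. V t \<omega>)"
  unfolding V_def u_def divide_inverse by (intro continuous_intros a_cont A_cont y_cont)

lemma V_adapted: "t \<in> {0..T} \<Longrightarrow> V t \<in> borel_measurable (F t)"
  unfolding V_def[abs_def] using u_adapted[of t] by measurable

lemma V_measurable_M: "t \<in> {0..T} \<Longrightarrow> V t \<in> borel_measurable M"
  using V_adapted measurable_F_M by blast

lemma V_initial: "y0 \<noteq> 0 \<Longrightarrow> AE \<omega> in M. V 0 \<omega> = 1"
  using y_initial by eventually_elim (simp add: V_def u_def a_def A_def)

section \<open>Optional stopping on a finite grid\<close>

context
  fixes p :: nat
  assumes p: "p > 0" and y0: "y0 \<noteq> 0"
begin

definition "s j = real j * T / real p"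

lemma s_in: "j \<le> p \<Longrightarrow> s j \<in> {0..T}"
  using p T_pos by (simp add: s_def field_simps)

lemma s_mono: "i \<le> j \<Longrightarrow> s i \<le> s j"
  using T_pos by (simp add: s_def divide_right_mono)

text \<open>\<open>V T\<close> is a constant multiple of \<open>u T\<close>, so the conditional law
  transfers. The constant splits at \<open>s j\<close>: the part up to \<open>s j\<close> turns
  \<open>u (s j)\<close> into \<open>V (s j)\<close>, and the part after it is the factor
  \<open>exp (- v)\<close> in \<open>hit_value\<close>.\<close>

lemma expectation_payoff:
  assumes j: "j \<le> p" and B: "B \<in> sets (F (s j))"
  shows "expectation (\<lambda>\<omega>. indicator B \<omega> * stop_payoff c (V T \<omega>)) =
    expectation (\<lambda>\<omega>. indicator B \<omega> * hit_value c (integral {s j..T} (\<lambda>s. (norm (\<theta> s))\<^sup>2)) (V (s j) \<omega>))"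
proof -
  let ?v = "integral {s j..T} (\<lambda>s. (norm (\<theta> s))\<^sup>2)"
  define r where "r = exp (- A T) / y0"
  have 1: "\<bar>payoff_approx n (x * r * exp c)\<bar> \<le> 2" for n x by (rule payoff_approx_bound)
  have 2: "\<bar>payoff_approx n (x * r * exp c) - payoff_approx n (z * r * exp c)\<bar> \<le> ((3 + 2 * real n) * \<bar>r * exp c\<bar>) * \<bar>x - z\<bar>" for n x z
  proof -
    have "\<bar>x * r * exp c - z * r * exp c\<bar> = \<bar>r * exp c\<bar> * \<bar>x - z\<bar>"
      unfolding abs_mult[symmetric] by (simp add: algebra_simps)
    then show ?thesis using payoff_approx_lipschitz[of n "x * r * exp c" "z * r * exp c"] by (simp add: mult.assoc)
  qed
  have 3: "0 \<le> (3 + 2 * real n) * \<bar>r * exp c\<bar>" for n by simp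
  have 4: "(\<lambda>n. payoff_approx n (x * r * exp c)) \<longlonglongrightarrow> stop_payoff c (x * r)" for x by (rule payoff_approx_tendsto)
  have B': "B \<in> sets (F (real j * T / real p))" using B by (simp add: s_def)
  have "expectation (\<lambda>\<omega>. indicator B \<omega> * stop_payoff c (u T \<omega> * r)) =
    expectation (\<lambda>\<omega>. indicator B \<omega> * lognormal_mean (\<lambda>x. stop_payoff c (x * r)) ?v (u (s j) \<omega>))"
    unfolding s_def using conditional_law[OF p j B', of "\<lambda>n x. payoff_approx n (x * r * exp c)" 2 "\<lambda>n. (3 + 2 * real n) * \<bar>r * exp c\<bar>" "\<lambda>x. stop_payoff c (x * r)"]
      1 2 3 4 by blast
  moreover have "u T \<omega> * r = V T \<omega>" for \<omega> by (simp add: V_def r_def)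
  moreover have "lognormal_mean (\<lambda>x. stop_payoff c (x * r)) ?v (u (s j) \<omega>) = hit_value c ?v (V (s j) \<omega>)" for \<omega>
  proof -
    have "r = exp (- A (s j)) / y0 * exp (- ?v)"
      using A_split[OF s_in[OF j]] by (simp add: r_def exp_add[symmetric])
    then have "u (s j) \<omega> * e * r = V (s j) \<omega> * exp (- ?v) * e" for e by (simp add: V_def)
    then show ?thesis unfolding hit_value_def lognormal_mean_def by (simp only:)
  qed
  ultimately show ?thesis by simp
qed

lemma variance_nonneg: "j \<le> p \<Longrightarrow> 0 \<le> integral {s j..T} (\<lambda>s. (norm (\<theta> s))\<^sup>2)"
  using s_in[of j] by (intro integral_nonneg integrable_subinterval_real[OF \<theta>_int]) auto

lemma expectation_payoff_initial: "expectation (\<lambda>\<omega>. stop_payoff c (V T \<omega>)) = hit_value c (A T) 1"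
proof -
  have s0: "s 0 = 0" by (simp add: s_def)
  have [measurable]: "V 0 \<in> borel_measurable M" using V_measurable_M[of 0] T_pos by simp
  have "expectation (\<lambda>\<omega>. stop_payoff c (V T \<omega>)) = expectation (\<lambda>\<omega>. indicator (space M) \<omega> * stop_payoff c (V T \<omega>))"
    by (intro Bochner_Integration.integral_cong) auto
  also have "\<dots> = expectation (\<lambda>\<omega>. indicator (space M) \<omega> * hit_value c (A T) (V 0 \<omega>))"
    using expectation_payoff[of 0 "space M" c] sets.top[of "F (s 0)"] by (simp add: s0 A_def)
  also have "\<dots> = expectation (\<lambda>\<omega>. hit_value c (A T) 1)"
    using V_initial[OF y0] by (intro integral_cong_AE) auto
  finally show ?thesis by (simp add: prob_space)
qed

text \<open>Stopping at grid index \<open>j\<close>. The event is known at time \<open>s j\<close>,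
  so the conditional law applies on it, and summing over \<open>j\<close> is optional
  stopping.\<close>

definition "first_below c j = {\<omega>\<in>space M. V (s j) \<omega> * exp c \<le> 1 \<and> (\<forall>i<j. 1 < V (s i) \<omega> * exp c)}"

lemma first_below_sets: "j \<le> p \<Longrightarrow> first_below c j \<in> sets (F (s j))"
proof -
  assume j: "j \<le> p"
  have m: "V (s i) \<in> borel_measurable (F (s j))" if "i \<le> j" for i
    using measurable_F_mono[OF V_adapted[OF s_in] s_mono[OF that]] that j by auto
  have "{\<omega>\<in>space (F (s j)). V (s j) \<omega> * exp c \<le> 1 \<and> (\<forall>i\<in>{..<j}. 1 < V (s i) \<omega> * exp c)} \<in> sets (F (s j))"
  proof (intro sets.sets_Collect_conj sets_Collect_Ball_countable)
    note [measurable] = m[OF order_refl]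
    show "{\<omega>\<in>space (F (s j)). V (s j) \<omega> * exp c \<le> 1} \<in> sets (F (s j))" by measurable
  next
    fix i assume "i \<in> {..<j}"
    then have [measurable]: "V (s i) \<in> borel_measurable (F (s j))" using m by simp
    show "{\<omega>\<in>space (F (s j)). 1 < V (s i) \<omega> * exp c} \<in> sets (F (s j))" by measurable
  qed simp
  then show ?thesis by (simp add: first_below_def Ball_def)
qed

lemma first_below_M: "j \<le> p \<Longrightarrow> first_below c j \<in> sets M"
  using first_below_sets sets_F by blast

lemma first_below_disjoint: "disjoint_family_on (first_below c) {..p}"
  unfolding disjoint_family_on_def
proof (intro ballI impI)
  fix i j :: nat assume "i \<noteq> j"
  then show "first_below c i \<inter> first_below c j = {}"
    by (cases i j rule: linorder_cases) (auto simp: first_below_def not_le[symmetric])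
qed

lemma first_below_union: "(\<Union>j\<le>p. first_below c j) = {\<omega>\<in>space M. \<exists>j\<le>p. V (s j) \<omega> * exp c \<le> 1}"
proof (intro set_eqI iffI)
  fix \<omega> assume "\<omega> \<in> {\<omega>\<in>space M. \<exists>j\<le>p. V (s j) \<omega> * exp c \<le> 1}"
  then obtain j where \<omega>: "\<omega> \<in> space M" and j: "j \<le> p" "V (s j) \<omega> * exp c \<le> 1" by auto
  define k where "k = (LEAST k. V (s k) \<omega> * exp c \<le> 1)"
  have "V (s k) \<omega> * exp c \<le> 1" unfolding k_def using j(2) by (rule LeastI)
  moreover have "k \<le> j" unfolding k_def using j(2) by (rule Least_le)
  moreover have "1 < V (s i) \<omega> * exp c" if "i < k" for i
    using not_less_Least[of i "\<lambda>k. V (s k) \<omega> * exp c \<le> 1"] that unfolding k_def by simp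
  ultimately show "\<omega> \<in> (\<Union>j\<le>p. first_below c j)" using \<omega> j(1) by (auto simp: first_below_def)
qed (auto simp: first_below_def)

lemma expectation_on_first_below:
  assumes j: "j \<le> p"
  shows "integrable M (\<lambda>\<omega>. indicator (first_below c j) \<omega> * stop_payoff c' (V T \<omega>))"
    and "integrable M (\<lambda>\<omega>. indicator (first_below c j) \<omega> * hit_value c' v (V (s j) \<omega>))"
proof -
  note [measurable] = first_below_M[OF j, of c] V_measurable_M[OF s_in[OF j]]
  have [measurable]: "V T \<in> borel_measurable M" using V_measurable_M[of T] T_pos by simp
  show "integrable M (\<lambda>\<omega>. indicator (first_below c j) \<omega> * stop_payoff c' (V T \<omega>))"
    by (rule integrable_const_bound[where B=2]) (auto simp: indicator_def stop_payoff_bounds intro!: AE_I2)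
  show "integrable M (\<lambda>\<omega>. indicator (first_below c j) \<omega> * hit_value c' v (V (s j) \<omega>))"
    by (rule integrable_const_bound[where B=2]) (auto simp: indicator_def hit_value_bounds intro!: AE_I2)
qed

text \<open>At the first grid time below the level the conditional mean of the payoff is at least 1,
  whatever the overshoot, and on paths that never get there the payoff is nonnegative.\<close>

lemma prob_below_upper: "prob {\<omega>\<in>space M. \<exists>j\<le>p. V (s j) \<omega> * exp c \<le> 1} \<le> hit_value c (A T) 1"
proof -
  let ?v = "\<lambda>j. integral {s j..T} (\<lambda>s. (norm (\<theta> s))\<^sup>2)"
  have [measurable]: "V T \<in> borel_measurable M" using V_measurable_M[of T] T_pos by simp
  have "prob {\<omega>\<in>space M. \<exists>j\<le>p. V (s j) \<omega> * exp c \<le> 1} = (\<Sum>j\<le>p. prob (first_below c j))"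
    unfolding first_below_union[symmetric]
    by (rule finite_measure_finite_Union) (auto simp: first_below_M first_below_disjoint)
  also have "\<dots> \<le> (\<Sum>j\<le>p. expectation (\<lambda>\<omega>. indicator (first_below c j) \<omega> * stop_payoff c (V T \<omega>)))"
  proof (rule sum_mono)
    fix j assume "j \<in> {..p}"
    then have j: "j \<le> p" by simp
    have "prob (first_below c j) = expectation (indicator (first_below c j))"
      using first_below_M[OF j] by simp
    also have "\<dots> \<le> expectation (\<lambda>\<omega>. indicator (first_below c j) \<omega> * hit_value c (?v j) (V (s j) \<omega>))"
    proof (rule integral_mono[OF _ expectation_on_first_below(2)[OF j]])
      show "integrable M (indicat_real (first_below c j))"
        by (rule integrable_const_bound[where B=1]) (use first_below_M[OF j] in auto)
      show "indicator (first_below c j) \<omega> \<le> indicator (first_below c j) \<omega> * hit_value c (?v j) (V (s j) \<omega>)" for \<omega>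
        using hit_value_above[OF variance_nonneg[OF j], of "V (s j) \<omega>" c] by (auto simp: indicator_def first_below_def)
    qed
    also have "\<dots> = expectation (\<lambda>\<omega>. indicator (first_below c j) \<omega> * stop_payoff c (V T \<omega>))"
      by (rule expectation_payoff[OF j first_below_sets[OF j], symmetric])
    finally show "prob (first_below c j) \<le> expectation (\<lambda>\<omega>. indicator (first_below c j) \<omega> * stop_payoff c (V T \<omega>))" .
  qed
  also have "\<dots> = expectation (\<lambda>\<omega>. \<Sum>j\<le>p. indicator (first_below c j) \<omega> * stop_payoff c (V T \<omega>))"
    by (rule Bochner_Integration.integral_sum[symmetric]) (simp add: expectation_on_first_below)
  also have "\<dots> \<le> expectation (\<lambda>\<omega>. stop_payoff c (V T \<omega>))"
  proof (rule integral_mono)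
    show "integrable M (\<lambda>\<omega>. \<Sum>j\<le>p. indicator (first_below c j) \<omega> * stop_payoff c (V T \<omega>))"
      by (intro Bochner_Integration.integrable_sum expectation_on_first_below) simp
    show "integrable M (\<lambda>\<omega>. stop_payoff c (V T \<omega>))"
      by (rule integrable_const_bound[where B=2]) (auto simp: stop_payoff_bounds intro!: AE_I2)
    fix \<omega>
    have "(\<Sum>j\<le>p. indicator (first_below c j) \<omega> :: real) = indicator (\<Union>j\<le>p. first_below c j) \<omega>"
      by (rule indicator_UN_disjoint[symmetric]) (auto simp: first_below_disjoint)
    then show "(\<Sum>j\<le>p. indicator (first_below c j) \<omega> * stop_payoff c (V T \<omega>)) \<le> stop_payoff c (V T \<omega>)"
      unfolding sum_distrib_right[symmetric] by (simp add: indicator_def stop_payoff_bounds)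
  qed
  also have "\<dots> = hit_value c (A T) 1" by (rule expectation_payoff_initial)
  finally show ?thesis .
qed

text \<open>Stopping uses the level \<open>exp (- c)\<close>, the payoff the lower level
  \<open>exp (- c')\<close>. At the stopping time the conditional mean is at most 1 unless the
  process is already below the lower level; it never exceeds 2, and the excess is charged to that
  overshoot event.\<close>

lemma prob_below_lower:
  assumes c: "c < c'"
  shows "hit_value c' (A T) 1 \<le> prob {\<omega>\<in>space M. \<exists>j\<le>p. V (s j) \<omega> * exp c \<le> 1} +
    prob {\<omega>\<in>space M. \<exists>j\<le>p. V (s j) \<omega> * exp c' \<le> 1 \<and> (\<forall>i<j. 1 < V (s i) \<omega> * exp c)}"
proof -
  let ?v = "\<lambda>j. integral {s j..T} (\<lambda>s. (norm (\<theta> s))\<^sup>2)"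
  let ?D = "\<lambda>j. first_below c j \<inter> {\<omega>\<in>space M. V (s j) \<omega> * exp c' \<le> 1}"
  have [measurable]: "V T \<in> borel_measurable M" using V_measurable_M[of T] T_pos by simp
  have sp: "s p = T" using p by (simp add: s_def)
  have shift: "x * exp c \<le> 1" if "x * exp c' \<le> 1" for x
  proof (cases "x \<le> 0")
    case True
    then have "x * exp c \<le> 0" by (simp add: mult_nonpos_nonneg)
    then show ?thesis by simp
  next
    case False
    then have "x * exp c \<le> x * exp c'" using c by simp
    then show ?thesis using that by linarith
  qed
  have D: "?D j \<in> sets M" if "j \<le> p" for j
    using first_below_M[OF that, of c] V_measurable_M[OF s_in[OF that]] by measurable
  have "hit_value c' (A T) 1 = expectation (\<lambda>\<omega>. stop_payoff c' (V T \<omega>))"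
    by (rule expectation_payoff_initial[symmetric])
  also have "\<dots> \<le> expectation (\<lambda>\<omega>. \<Sum>j\<le>p. indicator (first_below c j) \<omega> * stop_payoff c' (V T \<omega>))"
  proof (rule integral_mono)
    show "integrable M (\<lambda>\<omega>. \<Sum>j\<le>p. indicator (first_below c j) \<omega> * stop_payoff c' (V T \<omega>))"
      by (intro Bochner_Integration.integrable_sum expectation_on_first_below) simp
    show "integrable M (\<lambda>\<omega>. stop_payoff c' (V T \<omega>))"
      by (rule integrable_const_bound[where B=2]) (auto simp: stop_payoff_bounds intro!: AE_I2)
    fix \<omega> assume \<omega>: "\<omega> \<in> space M"
    have "(\<Sum>j\<le>p. indicator (first_below c j) \<omega> :: real) = indicator (\<Union>j\<le>p. first_below c j) \<omega>"
      by (rule indicator_UN_disjoint[symmetric]) (auto simp: first_below_disjoint)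
    \<comment> \<open>The last grid time is \<open>T\<close>, so a path that was never stopped ends
      above both levels.\<close>
    moreover have "stop_payoff c' (V T \<omega>) = 0" if "\<omega> \<notin> (\<Union>j\<le>p. first_below c j)"
    proof -
      have "\<not> V T \<omega> * exp c \<le> 1" using that \<omega> sp unfolding first_below_union by auto
      then have "\<not> V T \<omega> * exp c' \<le> 1" using shift by blast
      then show ?thesis by (simp add: stop_payoff_def)
    qed
    ultimately show "stop_payoff c' (V T \<omega>) \<le> (\<Sum>j\<le>p. indicator (first_below c j) \<omega> * stop_payoff c' (V T \<omega>))"
      unfolding sum_distrib_right[symmetric] by (simp add: indicator_def)
  qed
  also have "\<dots> = (\<Sum>j\<le>p. expectation (\<lambda>\<omega>. indicator (first_below c j) \<omega> * stop_payoff c' (V T \<omega>)))"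
    by (rule Bochner_Integration.integral_sum) (simp add: expectation_on_first_below)
  also have "\<dots> \<le> (\<Sum>j\<le>p. prob (first_below c j) + prob (?D j))"
  proof (rule sum_mono)
    fix j assume "j \<in> {..p}"
    then have j: "j \<le> p" by simp
    have ind: "integrable M (indicat_real S)" if "S \<in> sets M" for S
      by (rule integrable_const_bound[where B=1]) (use that in auto)
    have "expectation (\<lambda>\<omega>. indicator (first_below c j) \<omega> * stop_payoff c' (V T \<omega>)) =
      expectation (\<lambda>\<omega>. indicator (first_below c j) \<omega> * hit_value c' (?v j) (V (s j) \<omega>))"
      by (rule expectation_payoff[OF j first_below_sets[OF j]])
    also have "\<dots> \<le> expectation (\<lambda>\<omega>. indicator (first_below c j) \<omega> + indicator (?D j) \<omega>)"
    proof (rule integral_mono[OF expectation_on_first_below(2)[OF j]])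
      show "integrable M (\<lambda>\<omega>. indicat_real (first_below c j) \<omega> + indicator (?D j) \<omega>)"
        by (intro Bochner_Integration.integrable_add ind first_below_M D j)
      show "indicator (first_below c j) \<omega> * hit_value c' (?v j) (V (s j) \<omega>) \<le> indicator (first_below c j) \<omega> + indicator (?D j) \<omega>"
        if "\<omega> \<in> space M" for \<omega>
        using hit_value_below[OF variance_nonneg[OF j], of "V (s j) \<omega>" c'] hit_value_bounds(2)[of c' "?v j" "V (s j) \<omega>"] that
        by (auto simp: indicator_def)
    qed
    also have "\<dots> = prob (first_below c j) + prob (?D j)"
      using first_below_M[OF j, of c] D[OF j] by (subst Bochner_Integration.integral_add) (auto intro: ind)
    finally show "expectation (\<lambda>\<omega>. indicator (first_below c j) \<omega> * stop_payoff c' (V T \<omega>)) \<le> prob (first_below c j) + prob (?D j)" .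
  qed
  also have "\<dots> = (\<Sum>j\<le>p. prob (first_below c j)) + (\<Sum>j\<le>p. prob (?D j))" by (rule sum.distrib)
  also have "(\<Sum>j\<le>p. prob (first_below c j)) = prob (\<Union>j\<le>p. first_below c j)"
    by (rule finite_measure_finite_Union[symmetric]) (auto simp: first_below_M first_below_disjoint)
  also have "(\<Sum>j\<le>p. prob (?D j)) = prob (\<Union>j\<le>p. ?D j)"
    by (rule finite_measure_finite_Union[symmetric])
      (use D first_below_disjoint[of c] in \<open>auto simp: disjoint_family_on_def\<close>)
  also have "(\<Union>j\<le>p. ?D j) = {\<omega>\<in>space M. \<exists>j\<le>p. V (s j) \<omega> * exp c' \<le> 1 \<and> (\<forall>i<j. 1 < V (s i) \<omega> * exp c)}"
    using shift by (auto simp: first_below_def)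
  finally show ?thesis unfolding first_below_union .
qed

end

section \<open>From grid times to continuous time\<close>

definition "hit c = {\<omega>\<in>space M. \<exists>t\<in>{0..T}. V t \<omega> = exp (- c)}"

lemma le_exp_iff: "x * exp c \<le> 1 \<longleftrightarrow> x \<le> exp (- c)" for x c :: real
  by (simp add: exp_minus field_simps)

lemma hit_iff_le:
  assumes \<omega>: "\<omega> \<in> space M" "V 0 \<omega> = 1" and c: "0 < c"
  shows "\<omega> \<in> hit c \<longleftrightarrow> (\<exists>t\<in>{0..T}. V t \<omega> \<le> exp (- c))"
proof
  assume "\<exists>t\<in>{0..T}. V t \<omega> \<le> exp (- c)"
  then obtain t where t: "t \<in> {0..T}" "V t \<omega> \<le> exp (- c)" by auto
  have "continuous_on {0..t} (\<lambda>t. V t \<omega>)" using V_cont[OF \<omega>(1)] by (rule continuous_on_subset) (use t in auto)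
  then have "\<exists>r\<ge>0. r \<le> t \<and> V r \<omega> = exp (- c)"
    using t \<omega>(2) c by (intro IVT2') auto
  then show "\<omega> \<in> hit c" using t \<omega>(1) by (auto simp: hit_def)
next
  assume "\<omega> \<in> hit c"
  then obtain t where "t \<in> {0..T}" "V t \<omega> = exp (- c)" by (auto simp: hit_def)
  then show "\<exists>t\<in>{0..T}. V t \<omega> \<le> exp (- c)" by (intro bexI[of _ t]) auto
qed

text \<open>\<open>hit\<close> is an uncountable union over times. The countable description
  \<open>H\<close> agrees with it for paths that start at 1, hence almost surely, and completeness
  absorbs the null set where the start differs.\<close>

lemma hit_measurable:
  assumes y0: "y0 \<noteq> 0" and c: "0 < c" and complete: "complete_measure M"
  shows "hit c \<in> sets M"
proof -
  let ?Q = "\<rat> \<inter> {0..T}"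
  have cQ: "countable ?Q" using countable_rat by (rule countable_subset[rotated]) auto
  define H where "H = {\<omega>\<in>space M. \<forall>n\<in>(UNIV::nat set). \<not> (\<forall>r\<in>?Q. \<not> V r \<omega> < exp (- c) + 1 / real (Suc n))}"
  have Hm: "H \<in> sets M" unfolding H_def
  proof (intro sets_Collect_Ball_countable sets.sets_Collect_neg cQ)
    fix n r assume "r \<in> ?Q"
    then have [measurable]: "V r \<in> borel_measurable M" using V_measurable_M by auto
    show "{\<omega> \<in> space M. V r \<omega> < exp (- c) + 1 / real (Suc n)} \<in> sets M" by measurable
  qed simp
  have "AE \<omega> in M. \<omega> \<in> H \<longleftrightarrow> \<omega> \<in> hit c"
    using V_initial[OF y0] AE_space
  proof eventually_elim
    case (elim \<omega>)
    show ?case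
    proof
      assume H: "\<omega> \<in> H"
      obtain t where t: "t \<in> {0..T}" "\<And>r. r \<in> {0..T} \<Longrightarrow> V t \<omega> \<le> V r \<omega>"
        using continuous_attains_inf[OF compact_Icc _ V_cont[OF elim(2)]] T_pos by auto
      have "V t \<omega> \<le> exp (- c) + e" if e: "e > 0" for e
      proof -
        obtain n where "inverse (real (Suc n)) < e" using reals_Archimedean[OF e] by auto
        moreover from H have "\<not> (\<forall>r\<in>?Q. \<not> V r \<omega> < exp (- c) + 1 / real (Suc n))" unfolding H_def by blast
        then obtain r where r: "r \<in> ?Q" "V r \<omega> < exp (- c) + 1 / real (Suc n)" by blast
        ultimately show ?thesis using t(2)[of r] by (simp add: inverse_eq_divide)
      qed
      then have "V t \<omega> \<le> exp (- c)" by (rule field_le_epsilon)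
      then show "\<omega> \<in> hit c" using hit_iff_le[OF elim(2,1) c] t(1) by auto
    next
      assume "\<omega> \<in> hit c"
      then obtain t where t: "t \<in> {0..T}" "V t \<omega> = exp (- c)" by (auto simp: hit_def)
      obtain f where f: "\<And>n::nat. f n \<in> ?Q" "f \<longlonglongrightarrow> t" using rational_sequence[OF t(1)] by blast
      have lim: "(\<lambda>n. V (f n) \<omega>) \<longlonglongrightarrow> V t \<omega>"
        by (rule continuous_on_tendsto_compose[OF V_cont[OF elim(2)] f(2) t(1)]) (use f(1) in \<open>auto intro!: always_eventually\<close>)
      have "\<exists>r\<in>?Q. V r \<omega> < exp (- c) + 1 / real (Suc n)" for n
      proof -
        have "V t \<omega> < exp (- c) + 1 / real (Suc n)" using t(2) by simp
        from order_tendstoD(2)[OF lim this] obtain m where "V (f m) \<omega> < exp (- c) + 1 / real (Suc n)"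
          using eventually_happens' by force
        then show ?thesis using f(1) by blast
      qed
      then show "\<omega> \<in> H" using elim(2) by (auto simp: H_def)
    qed
  qed
  then show ?thesis by (rule complete_measure.in_sets_AE[OF complete _ Hm]) (auto simp: hit_def)
qed

text \<open>A path that touches \<open>exp (- c)\<close> stays below the higher level
  \<open>exp (- c'')\<close> for a short while, so every sufficiently fine grid sees it
  there.\<close>

lemma hit_upper:
  assumes y0: "y0 \<noteq> 0" and c: "0 < c" "c'' < c" and m: "hit c \<in> sets M"
  shows "prob (hit c) \<le> hit_value c'' (A T) 1"
proof -
  define C where "C p = {\<omega>\<in>space M. \<exists>j\<le>p. V (s p j) \<omega> * exp c'' \<le> 1}" for p
  have C: "C (Suc p) \<in> sets M" for p
  proof -
    have "C (Suc p) = (\<Union>j\<le>Suc p. first_below (Suc p) c'' j)"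
      unfolding C_def by (rule first_below_union[OF zero_less_Suc y0, symmetric])
    also have "\<dots> \<in> sets M" by (intro sets.finite_UN first_below_M[OF zero_less_Suc y0]) auto
    finally show ?thesis .
  qed
  \<comment> \<open>Successive grids are not nested, so the events are collected as a limit inferior
    to obtain an increasing sequence.\<close>
  define X where "X n = hit c \<inter> (\<Inter>p\<in>{n..}. C (Suc p))" for n
  have X: "X n \<in> sets M" for n unfolding X_def using m C by (intro sets.Int sets.countable_INT') auto
  have "incseq X" unfolding X_def by (intro incseq_SucI) auto
  moreover have "(\<Union>n. X n) = hit c"
  proof
    show "hit c \<subseteq> (\<Union>n. X n)"
    proof
      fix \<omega> assume h: "\<omega> \<in> hit c"
      then obtain t where \<omega>: "\<omega> \<in> space M" and t: "t \<in> {0..T}" "V t \<omega> = exp (- c)" by (auto simp: hit_def)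
      have "0 < exp (- c'') - exp (- c)" using c by simp
      then obtain d where d: "d > 0" "\<And>r. r \<in> {0..T} \<Longrightarrow> dist r t < d \<Longrightarrow> dist (V r \<omega>) (V t \<omega>) < exp (- c'') - exp (- c)"
        using V_cont[OF \<omega>] t(1) unfolding continuous_on_iff by metis
      obtain n :: nat where n: "T / d < real n" using reals_Archimedean2 by blast
      have "\<omega> \<in> C (Suc p)" if "n \<le> p" for p
      proof -
        define P where "P = real (Suc p)"
        have P: "P > 0" by (simp add: P_def)
        define j where "j = nat \<lfloor>t * P / T\<rfloor>"
        have q0: "0 \<le> t * P / T" using t(1) T_pos P by simp
        have j: "real j \<le> t * P / T" "t * P / T < real j + 1"
          using q0 by (auto simp: j_def)
        have "t * P \<le> T * P" using t(1) P by (intro mult_right_mono) auto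
        then have "t * P / T \<le> P" using T_pos by (simp add: pos_divide_le_eq mult.commute)
        then have "real j \<le> real (Suc p)" using j(1) unfolding P_def by linarith
        then have jp: "j \<le> Suc p" by (simp only: of_nat_le_iff)
        have "real j * T / P \<le> t" using j(1) T_pos P by (simp add: field_simps)
        moreover have "t - real j * T / P < T / P"
        proof -
          have "t * P < (real j + 1) * T" using j(2) T_pos by (simp add: pos_divide_less_eq)
          then have "t < (real j + 1) * T / P" using P by (simp add: pos_less_divide_eq)
          then show ?thesis by (simp add: distrib_right add_divide_distrib)
        qed
        moreover have "T / P < d"
        proof -
          have "T / d < P" using n that unfolding P_def by linarith
          then show ?thesis using d(1) P by (simp add: field_simps)
        qed
        ultimately have "dist (s (Suc p) j) t < d" unfolding s_def[OF zero_less_Suc y0] dist_real_def P_def by linarith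
        then have "dist (V (s (Suc p) j) \<omega>) (V t \<omega>) < exp (- c'') - exp (- c)"
          using d(2) s_in[OF zero_less_Suc y0 jp] by blast
        then have "V (s (Suc p) j) \<omega> \<le> exp (- c'')" using t(2) by (simp add: dist_real_def)
        then show ?thesis using \<omega> jp by (auto simp: C_def le_exp_iff)
      qed
      then show "\<omega> \<in> (\<Union>n. X n)" using h by (auto simp: X_def)
    qed
  qed (auto simp: X_def)
  ultimately have lim: "(\<lambda>n. prob (X n)) \<longlonglongrightarrow> prob (hit c)"
    using finite_Lim_measure_incseq[of X] X by auto
  have "prob (X n) \<le> hit_value c'' (A T) 1" for n
  proof -
    have "prob (X n) \<le> prob (C (Suc n))" using C by (intro finite_measure_mono) (auto simp: X_def)
    also have "\<dots> \<le> hit_value c'' (A T) 1" unfolding C_def by (rule prob_below_upper[OF zero_less_Suc y0])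
    finally show ?thesis .
  qed
  then show ?thesis by (intro LIMSEQ_le_const2[OF lim]) auto
qed

text \<open>The overshoot event demands a fall from above \<open>exp (- c)\<close> to below
  \<open>exp (- c')\<close> within one grid step. Uniform continuity of a path starting at 1 forbids
  this on fine grids, so the limit superior of these events is null.\<close>

lemma hit_lower:
  assumes y0: "y0 \<noteq> 0" and c: "0 < c" "c < c'" and m: "hit c \<in> sets M"
  shows "hit_value c' (A T) 1 \<le> prob (hit c)"
proof -
  define Ov where "Ov p = {\<omega>\<in>space M. \<exists>j\<le>p. V (s p j) \<omega> * exp c' \<le> 1 \<and> (\<forall>i<j. 1 < V (s p i) \<omega> * exp c)}" for p
  have Vm: "V (s (Suc p) j) \<in> borel_measurable M" if "j \<le> Suc p" for p j
    by (rule V_measurable_M[OF s_in[OF zero_less_Suc y0 that]])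
  have Ov: "Ov (Suc p) \<in> sets M" for p
  proof -
    have "Ov (Suc p) = (\<Union>j\<in>{..Suc p}. {\<omega>\<in>space M. V (s (Suc p) j) \<omega> * exp c' \<le> 1 \<and> (\<forall>i\<in>{..<j}. 1 < V (s (Suc p) i) \<omega> * exp c)})"
      by (auto simp: Ov_def)
    also have "\<dots> \<in> sets M"
    proof (intro sets.finite_UN)
      fix j assume j: "j \<in> {..Suc p}"
      have [measurable]: "V (s (Suc p) i) \<in> borel_measurable M" if "i \<le> j" for i using Vm[of i p] j that by auto
      show "{\<omega>\<in>space M. V (s (Suc p) j) \<omega> * exp c' \<le> 1 \<and> (\<forall>i\<in>{..<j}. 1 < V (s (Suc p) i) \<omega> * exp c)} \<in> sets M" by measurable
    qed simp
    finally show ?thesis .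
  qed
  define X where "X n = (\<Union>p\<in>{n..}. Ov (Suc p))" for n
  have X: "X n \<in> sets M" for n unfolding X_def using Ov by (intro sets.countable_UN') auto
  have "decseq X" unfolding X_def by (intro decseq_SucI) (auto intro: Suc_leD)
  then have lim: "(\<lambda>n. prob (X n)) \<longlonglongrightarrow> prob (\<Inter>n. X n)"
    using finite_Lim_measure_decseq[of X] X by auto
  have null: "prob (\<Inter>n. X n) = 0"
  proof -
    have "AE \<omega> in M. \<omega> \<notin> (\<Inter>n. X n)"
      using V_initial[OF y0] AE_space
    proof eventually_elim
      case (elim \<omega>)
      have "0 < exp (- c) - exp (- c')" using c by simp
      moreover have "uniformly_continuous_on {0..T} (\<lambda>t. V t \<omega>)"
        by (rule compact_uniformly_continuous[OF V_cont[OF elim(2)]]) simp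
      ultimately obtain d where d: "d > 0" "\<And>r t. r \<in> {0..T} \<Longrightarrow> t \<in> {0..T} \<Longrightarrow> dist t r < d \<Longrightarrow> dist (V t \<omega>) (V r \<omega>) < exp (- c) - exp (- c')"
        unfolding uniformly_continuous_on_def by metis
      obtain n :: nat where n: "T / d < real n" using reals_Archimedean2 by blast
      have "\<omega> \<notin> Ov (Suc p)" if "n \<le> p" for p
      proof
        let ?P = "real (Suc p)"
        assume "\<omega> \<in> Ov (Suc p)"
        then obtain j where j: "j \<le> Suc p" "V (s (Suc p) j) \<omega> * exp c' \<le> 1" "\<And>i. i < j \<Longrightarrow> 1 < V (s (Suc p) i) \<omega> * exp c"
          by (auto simp: Ov_def)
        have Vj: "V (s (Suc p) j) \<omega> \<le> exp (- c')" using j(2) by (simp add: le_exp_iff)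
        have "exp (- c') < 1" using c by simp
        \<comment> \<open>At index 0 the process is 1, above the lower level, so there is a
          preceding grid time to compare with.\<close>
        then have "j \<noteq> 0" using Vj elim(1) by (cases j) (auto simp: s_def[OF zero_less_Suc y0])
        then obtain i where i: "j = Suc i" by (cases j) auto
        have Vi: "exp (- c) < V (s (Suc p) i) \<omega>" using j(3)[of i] i le_exp_iff[of "V (s (Suc p) i) \<omega>" c] by auto
        have "s (Suc p) j - s (Suc p) i = T / ?P"
          unfolding s_def[OF zero_less_Suc y0] i by (simp only: of_nat_Suc[of i] distrib_right add_divide_distrib)
        moreover have "T / ?P < d"
        proof -
          have "T / d < ?P" using n that by linarith
          then show ?thesis using d(1) by (simp add: field_simps)
        qed
        moreover have "0 < T / ?P" using T_pos by simp
        ultimately have "dist (s (Suc p) j) (s (Suc p) i) < d" unfolding dist_real_def by linarith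
        then have "dist (V (s (Suc p) j) \<omega>) (V (s (Suc p) i) \<omega>) < exp (- c) - exp (- c')"
          using d(2) s_in[OF zero_less_Suc y0] j(1) i by (meson Suc_leD)
        then show False using Vi Vj by (simp add: dist_real_def)
      qed
      then have "\<omega> \<notin> X n" by (auto simp: X_def)
      then show ?case by blast
    qed
    then show ?thesis using X by (subst prob_eq_0) auto
  qed
  have "hit_value c' (A T) 1 \<le> prob (hit c) + prob (X n)" for n
  proof -
    have "hit_value c' (A T) 1 \<le> prob {\<omega>\<in>space M. \<exists>j\<le>Suc n. V (s (Suc n) j) \<omega> * exp c \<le> 1} + prob (Ov (Suc n))"
      unfolding Ov_def by (rule prob_below_lower[OF zero_less_Suc y0 c(2)])
    also have "prob {\<omega>\<in>space M. \<exists>j\<le>Suc n. V (s (Suc n) j) \<omega> * exp c \<le> 1} \<le> prob (hit c)"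
    proof (rule finite_measure_mono_AE[OF _ m])
      show "AE \<omega> in M. \<omega> \<in> {\<omega>\<in>space M. \<exists>j\<le>Suc n. V (s (Suc n) j) \<omega> * exp c \<le> 1} \<longrightarrow> \<omega> \<in> hit c"
        using V_initial[OF y0] AE_space
      proof eventually_elim
        case (elim \<omega>)
        then show ?case using hit_iff_le[OF elim(2,1) c(1)] s_in[OF zero_less_Suc y0, of _ n] by (auto simp: le_exp_iff)
      qed
    qed
    also have "prob (Ov (Suc n)) \<le> prob (X n)" using X by (intro finite_measure_mono) (auto simp: X_def)
    finally show ?thesis by simp
  qed
  moreover have "(\<lambda>n. prob (hit c) + prob (X n)) \<longlonglongrightarrow> prob (hit c) + 0" using lim unfolding null by (intro tendsto_add tendsto_const)
  ultimately show ?thesis using LIMSEQ_le_const[of "\<lambda>n. prob (hit c) + prob (X n)"] by auto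
qed

text \<open>The levels of the two bounds are moved to \<open>c\<close> from either side; continuity
  of the normal tail makes both converge to the same formula.\<close>

lemma hitting_probability:
  assumes y0: "y0 \<noteq> 0" and c: "0 < c" and complete: "complete_measure M" and pos: "0 < A T"
  shows "prob (hit c) = normal_tail ((c - 3 / 2 * A T) / sqrt (A T)) + exp (3 * c) * normal_tail ((c + 3 / 2 * A T) / sqrt (A T))"
proof -
  define f where "f c = normal_tail ((c - 3 / 2 * A T) / sqrt (A T)) + exp (3 * c) * normal_tail ((c + 3 / 2 * A T) / sqrt (A T))" for c
  have f: "hit_value c (A T) 1 = f c" for c unfolding f_def by (rule hit_value_start[OF pos])
  have "continuous_on UNIV f" unfolding f_def using pos
    by (intro continuous_intros continuous_on_compose2[OF normal_tail_continuous]) auto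
  then have cont: "isCont f c" for c by (simp add: continuous_on_eq_continuous_at)
  note m = hit_measurable[OF y0 c complete]
  have "(\<lambda>n. f (c - 1 / real (Suc n))) \<longlonglongrightarrow> f c"
    by (rule isCont_tendsto_compose[OF cont]) real_asymp
  then have "prob (hit c) \<le> f c"
    by (rule LIMSEQ_le_const) (use hit_upper[OF y0 c _ m] f in auto)
  moreover have "(\<lambda>n. f (c + 1 / real (Suc n))) \<longlonglongrightarrow> f c"
    by (rule isCont_tendsto_compose[OF cont]) real_asymp
  then have "f c \<le> prob (hit c)"
    by (rule LIMSEQ_le_const2) (use hit_lower[OF y0 c _ m] f in auto)
  ultimately show ?thesis unfolding f_def by simp
qed

end

section \<open>The efficient portfolio\<close>

lemma borel_measurable_vecI:
  fixes f :: "'a \<Rightarrow> real^'m"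
  assumes f: "\<And>i. (\<lambda>x. f x $ i) \<in> borel_measurable M"
  shows "f \<in> borel_measurable M"
proof (subst borel_measurable_euclidean_space, rule ballI)
  fix b :: "real^'m" assume "b \<in> Basis"
  then obtain i where "b = axis i 1" by (auto simp: Basis_vec_def)
  then show "(\<lambda>x. f x \<bullet> b) \<in> borel_measurable M" using f[of i] by (simp add: inner_axis)
qed

lemma borel_measurable_det:
  fixes A :: "'a \<Rightarrow> real^'m^'m"
  assumes A [measurable]: "\<And>i j. (\<lambda>x. A x $ i $ j) \<in> borel_measurable M"
  shows "(\<lambda>x. det (A x)) \<in> borel_measurable M"
  unfolding det_def by measurable

text \<open>\<open>matrix_inv\<close> is a choice operator without evident measurability in the
  matrix. Cramer's rule gives a measurable function that equals the solution wherever the matrix is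
  invertible, which carries measurability over to \<theta> on the time interval.\<close>

lemma borel_measurable_solve:
  fixes A :: "'a \<Rightarrow> real^'m^'m" and b :: "'a \<Rightarrow> real^'m"
  assumes A: "A \<in> borel_measurable M" and b: "b \<in> borel_measurable M"
  obtains f where "f \<in> borel_measurable M" "\<And>x v. invertible (A x) \<Longrightarrow> A x *v v = b x \<Longrightarrow> f x = v"
proof
  let ?f = "\<lambda>x. \<chi> k. det (\<chi> i j. if j = k then b x $ i else A x $ i $ j) / det (A x)"
  have [measurable]: "(\<lambda>x. b x $ i) \<in> borel_measurable M" for i using b by measurable
  have [measurable]: "(\<lambda>x. A x $ i $ j) \<in> borel_measurable M" for i j
    by (intro borel_measurable_vec_nth A)
  show "?f \<in> borel_measurable M"
  proof (rule borel_measurable_vecI)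
    fix k
    have "(\<lambda>x. det (\<chi> i j. if j = k then b x $ i else A x $ i $ j)) \<in> borel_measurable M"
    proof (rule borel_measurable_det)
      fix i j show "(\<lambda>x. (\<chi> i j. if j = k then b x $ i else A x $ i $ j) $ i $ j) \<in> borel_measurable M"
        by (cases "j = k") simp_all
    qed
    moreover have "(\<lambda>x. det (A x)) \<in> borel_measurable M" by (rule borel_measurable_det) measurable
    ultimately show "(\<lambda>x. ?f x $ k) \<in> borel_measurable M" by simp
  qed
  show "?f x = v" if "invertible (A x)" "A x *v v = b x" for x v
    using cramer[of "A x" v "b x"] that by (simp add: invertible_det_nz)
qed

lemma matrix_inv:
  fixes A :: "'a::semiring_1^'n^'n"
  assumes "invertible A"
  shows matrix_inv_right: "A ** matrix_inv A = mat 1" and matrix_inv_left: "matrix_inv A ** A = mat 1"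
  using someI_ex[OF assms[unfolded invertible_def]] by (auto simp: matrix_inv_def)

text \<open>Ellipticity forces trivial kernels, so the matrices are invertible. Both \<theta> and
  \<open>transpose \<sigma> *v P\<close> are mapped to \<open>b\<close> by \<sigma>, hence agree,
  and then \<open>b \<bullet> P\<close> is \<open>\<theta> \<bullet> \<theta>\<close>.\<close>

lemma market_price_of_risk:
  fixes \<sigma> :: "real^'m^'m" and b :: "real^'m"
  assumes \<delta>: "\<delta> > 0" and ell: "\<And>v. \<delta> * (norm v)\<^sup>2 \<le> v \<bullet> ((\<sigma> ** transpose \<sigma>) *v v)"
  defines "\<theta> \<equiv> b v* matrix_inv (transpose \<sigma>)"
    and "P \<equiv> matrix_inv (\<sigma> ** transpose \<sigma>) *v b"
  shows "invertible \<sigma>" "\<sigma> *v \<theta> = b" "transpose \<sigma> *v P = \<theta>" "b \<bullet> P = (norm \<theta>)\<^sup>2"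
proof -
  have zero: "v = 0" if "(\<sigma> ** transpose \<sigma>) *v v = 0" for v
  proof -
    have "\<delta> * (norm v)\<^sup>2 \<le> 0" using ell[of v] that by simp
    then show ?thesis using \<delta> by (simp add: mult_le_0_iff)
  qed
  have "transpose \<sigma> *v v = 0 \<Longrightarrow> v = 0" for v
    using zero[of v] by (simp add: matrix_vector_mul_assoc[symmetric])
  then have it: "invertible (transpose \<sigma>)"
    unfolding invertible_left_inverse matrix_left_invertible_ker by blast
  then show inv: "invertible \<sigma>" by (simp add: invertible_det_nz)
  have iss: "invertible (\<sigma> ** transpose \<sigma>)"
    unfolding invertible_left_inverse matrix_left_invertible_ker using zero by blast
  have "\<sigma> ** transpose (matrix_inv (transpose \<sigma>)) = transpose (matrix_inv (transpose \<sigma>) ** transpose \<sigma>)"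
    by (simp add: matrix_transpose_mul)
  also have "\<dots> = mat 1" using matrix_inv_left[OF it] by simp
  finally have one: "\<sigma> ** transpose (matrix_inv (transpose \<sigma>)) = mat 1" .
  show s\<theta>: "\<sigma> *v \<theta> = b"
    unfolding \<theta>_def transpose_matrix_vector[symmetric] matrix_vector_mul_assoc one by (rule matrix_vector_mul_lid)
  have "\<sigma> *v (transpose \<sigma> *v P) = b"
    unfolding P_def matrix_vector_mul_assoc matrix_mul_assoc matrix_inv_right[OF iss] by (rule matrix_vector_mul_lid)
  then have "matrix_inv \<sigma> *v (\<sigma> *v (transpose \<sigma> *v P)) = matrix_inv \<sigma> *v (\<sigma> *v \<theta>)" using s\<theta> by simp
  then show sP: "transpose \<sigma> *v P = \<theta>"
    by (simp add: matrix_vector_mul_assoc matrix_inv_left[OF inv] matrix_mul_assoc)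
  have "b \<bullet> P = (P v* \<sigma>) \<bullet> \<theta>" unfolding dot_lmul_matrix s\<theta> by (rule inner_commute)
  also have "\<dots> = \<theta> \<bullet> \<theta>" using sP by simp
  finally show "b \<bullet> P = (norm \<theta>)\<^sup>2" by (simp add: power2_norm_eq_inner)
qed

text \<open>The feedback rule simplifies to \<open>- y \<theta>\<close> by ellipticity, which is
  available for times in \<open>{0..T}\<close> only; the Ito integral does not see other
  times.\<close>

lemma ito_integral_cong:
  assumes ito: "ito_integral M F W T \<phi> I" and eq: "\<And>t \<omega>. t \<in> {0..T} \<Longrightarrow> \<phi> t \<omega> = \<psi> t \<omega>"
  shows "ito_integral M F W T \<psi> I"
proof -
  have eq': "\<phi> t = \<psi> t" if "t \<in> {0..T}" for t using eq[OF that] by auto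
  have "(\<lambda>(t, \<omega>). \<psi> t \<omega>) \<in> borel_measurable (restrict_space lborel {0..T} \<Otimes>\<^sub>M M)"
  proof (subst measurable_cong[of _ _ "\<lambda>(t, \<omega>). \<phi> t \<omega>"])
    show "(case x of (t, \<omega>) \<Rightarrow> \<psi> t \<omega>) = (case x of (t, \<omega>) \<Rightarrow> \<phi> t \<omega>)"
      if "x \<in> space (restrict_space lborel {0..T} \<Otimes>\<^sub>M M)" for x
      using that eq by (auto simp: space_pair_measure space_restrict_space)
  qed (use ito in \<open>simp add: ito_integral_def ito_integrand_def\<close>)
  moreover have "AE \<omega> in M. (\<lambda>t. norm (\<psi> t \<omega>) ^ 2) integrable_on {0..T}"
  proof -
    have "AE \<omega> in M. (\<lambda>t. norm (\<phi> t \<omega>) ^ 2) integrable_on {0..T}"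
      using ito by (simp add: ito_integral_def ito_integrand_def)
    then show ?thesis
      by eventually_elim (rule integrable_eq, assumption, simp add: eq)
  qed
  moreover have "integral {0..T} (\<lambda>t. norm (step_proc ts \<xi> t \<omega> - \<phi> t \<omega>) ^ 2) = integral {0..T} (\<lambda>t. norm (step_proc ts \<xi> t \<omega> - \<psi> t \<omega>) ^ 2)" for ts \<xi> \<omega>
    by (rule Henstock_Kurzweil_Integration.integral_cong) (simp add: eq)
  ultimately show ?thesis using ito eq' by (auto simp: ito_integral_def ito_integrand_def)
qed

theorem theorem3p2:
  fixes M :: "'a measure" and F :: "real \<Rightarrow> 'a measure" and W :: "real \<Rightarrow> 'a \<Rightarrow> real^'m"
    and T :: real and r :: "real \<Rightarrow> real" and \<mu> :: "real \<Rightarrow> real^'m"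
    and \<sigma> :: "real \<Rightarrow> real^'m^'m" and \<delta> x0 z :: real and x :: "real \<Rightarrow> 'a \<Rightarrow> real"
    and B \<theta> :: "real \<Rightarrow> real^'m" and \<Theta> \<gamma> :: real and \<pi> :: "real \<Rightarrow> 'a \<Rightarrow> real^'m"
    and \<tau> :: "'a \<Rightarrow> ereal"
  defines "B \<equiv> (\<lambda>t. \<chi> i. \<mu> t $ i - r t)"
    and "\<theta> \<equiv> (\<lambda>t. B t v* matrix_inv (transpose (\<sigma> t)))"
    and "\<Theta> \<equiv> integral {0..T} (\<lambda>t. norm (\<theta> t) ^ 2)"
    and "\<gamma> \<equiv> (z - x0 * exp (integral {0..T} (\<lambda>t. r t - norm (\<theta> t) ^ 2))) / (1 - exp (- \<Theta>))"
    and "\<pi> \<equiv> (\<lambda>t \<omega>. - ((x t \<omega> - \<gamma> * exp (- integral {t..T} r))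
                         *\<^sub>R (matrix_inv (\<sigma> t ** transpose (\<sigma> t)) *v B t)))"
    and "\<tau> \<equiv> (\<lambda>\<omega>. Inf (ereal ` {t \<in> {0..T}. x t \<omega> = z * exp (- integral {t..T} r)}))"
  assumes "prob_space M" and "complete_measure M"
    and "filtration_on M F" and "std_BM M F W"
    and "T > 0"
    and "\<forall>t\<ge>0. r t > 0"
    and "r \<in> borel_measurable borel" and "\<mu> \<in> borel_measurable borel"
    and "\<sigma> \<in> borel_measurable borel"
    and "r integrable_on {0..T}"
    and A1: "\<delta> > 0" "\<forall>t\<in>{0..T}. \<forall>v. \<delta> * norm v ^ 2 \<le> v \<bullet> ((\<sigma> t ** transpose (\<sigma> t)) *v v)"
    and A2: "(\<lambda>t. norm (\<theta> t) ^ 2) integrable_on {0..T}" "0 < \<Theta>"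
    and "x0 > 0" and "z > x0 * exp (integral {0..T} r)"
    and "wealth_solution M F W T r B \<sigma> x0 \<pi> x"
  shows "measure M {\<omega> \<in> space M. \<tau> \<omega> \<le> ereal T}
           = 1/2 * erfc (- sqrt \<Theta> / (2 * sqrt 2))
             + 1/2 * exp (3 * \<Theta>) * erfc (5 * sqrt \<Theta> / (2 * sqrt 2))"
proof -
  note prob = assms(7) and complete = assms(8) and filt = assms(9) and BM = assms(10) and T = assms(11)
    and r_pos = assms(12) and r_meas = assms(13) and mu_meas = assms(14) and \<sigma>_meas = assms(15) and r_int = assms(16)
    and z = assms(22) and wealth = assms(23)
  interpret prob_space M by (rule prob)
  interpret brownian M F W by unfold_locales (rule filt, rule BM)
  define R where "R = integral {0..T} r"
  define \<rho> where "\<rho> t = exp (- integral {t..T} r)" for t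
  define q where "q s = r s - (norm (\<theta> s))\<^sup>2" for s
  define y where "y t \<omega> = x t \<omega> - \<gamma> * \<rho> t" for t \<omega>
  define y0 where "y0 = x0 - \<gamma> * \<rho> 0"
  have mpr: "invertible (\<sigma> t)" "\<sigma> t *v \<theta> t = B t"
    "transpose (\<sigma> t) *v (matrix_inv (\<sigma> t ** transpose (\<sigma> t)) *v B t) = \<theta> t"
    "B t \<bullet> (matrix_inv (\<sigma> t ** transpose (\<sigma> t)) *v B t) = (norm (\<theta> t))\<^sup>2" if "t \<in> {0..T}" for t
  proof -
    have ell: "\<delta> * (norm v)\<^sup>2 \<le> v \<bullet> ((\<sigma> t ** transpose (\<sigma> t)) *v v)" for v using A1(2) that by blast
    note m = market_price_of_risk(1)[OF A1(1) ell] market_price_of_risk(2-4)[OF A1(1) ell, where b = "B t"]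
    show "invertible (\<sigma> t)" "\<sigma> t *v \<theta> t = B t"
      "transpose (\<sigma> t) *v (matrix_inv (\<sigma> t ** transpose (\<sigma> t)) *v B t) = \<theta> t"
      "B t \<bullet> (matrix_inv (\<sigma> t ** transpose (\<sigma> t)) *v B t) = (norm (\<theta> t))\<^sup>2"
      unfolding \<theta>_def using m by blast+
  qed
  have \<theta>_meas: "\<theta> \<in> borel_measurable (lebesgue_on {0..T})"
  proof -
    have "B \<in> borel_measurable borel" unfolding B_def
      by (rule borel_measurable_vecI) (use r_meas mu_meas in simp)
    from borel_measurable_solve[OF \<sigma>_meas this] obtain f where f: "f \<in> borel_measurable borel"
      "\<And>t v. invertible (\<sigma> t) \<Longrightarrow> \<sigma> t *v v = B t \<Longrightarrow> f t = v" by blast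
    have "f \<in> borel_measurable lebesgue" using f(1) by (intro measurable_completion) simp
    then have "f \<in> borel_measurable (lebesgue_on {0..T})" by (rule measurable_restrict_space1)
    then show ?thesis
      by (rule measurable_cong[THEN iffD1, rotated]) (use f(2)[OF mpr(1,2)] in \<open>simp add: space_restrict_space\<close>)
  qed
  \<comment> \<open>Positivity of \<open>r\<close> upgrades its integrability to absolute
    integrability, which products with continuous functions require.\<close>
  have r_abs: "r absolutely_integrable_on {0..T}"
    by (rule nonnegative_absolutely_integrable_1[OF r_int]) (use r_pos in \<open>auto intro: less_imp_le\<close>)
  have \<theta>_abs: "(\<lambda>s. (norm (\<theta> s))\<^sup>2) absolutely_integrable_on {0..T}"
    by (rule nonnegative_absolutely_integrable_1[OF A2(1)]) simp
  have q_abs: "q absolutely_integrable_on {0..T}"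
    unfolding q_def by (rule set_integral_diff(1)[OF r_abs \<theta>_abs])
  have \<rho>: "\<rho> t = exp (- R) * exp (integral {0..t} r)" if "t \<in> {0..T}" for t
    using Henstock_Kurzweil_Integration.integral_combine[of 0 t T r] that r_int
    by (simp add: \<rho>_def R_def exp_add[symmetric])
  have \<rho>0: "\<rho> 0 = exp (- R)" by (simp add: \<rho>_def R_def)
  \<comment> \<open>The equation \<open>\<rho>' = r \<rho>\<close> in integrated form, as
    \<open>r\<close> is only integrable.\<close>
  have \<rho>_int: "((\<lambda>s. r s * \<rho> s) has_integral \<rho> t - \<rho> 0) {0..t}" if t: "t \<in> {0..T}" for t
  proof -
    have "r absolutely_integrable_on {0..t}"
      using r_abs by (rule absolutely_integrable_on_subinterval) (use t in auto)
    from has_integral_mult_right[OF has_integral_exp_primitive[OF _ this], where c = "exp (- R)"] t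
    have "((\<lambda>s. exp (- R) * (r s * exp (integral {0..s} r))) has_integral exp (- R) * (exp (integral {0..t} r) - 1)) {0..t}" by simp
    then have "((\<lambda>s. r s * \<rho> s) has_integral exp (- R) * (exp (integral {0..t} r) - 1)) {0..t}"
      by (rule has_integral_eq[rotated]) (use t in \<open>simp add: \<rho>\<close>)
    then show ?thesis using \<rho>[OF t] by (simp add: \<rho>0 right_diff_distrib)
  qed
  have \<rho>_cont: "continuous_on {0..T} \<rho>"
    unfolding \<rho>_def by (intro continuous_intros indefinite_integral_continuous_1'[OF r_int])
  have \<pi>: "\<pi> t \<omega> = - (y t \<omega> *\<^sub>R (matrix_inv (\<sigma> t ** transpose (\<sigma> t)) *v B t))" for t \<omega>
    by (simp add: \<pi>_def y_def \<rho>_def)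
  have \<sigma>\<pi>: "transpose (\<sigma> t) *v \<pi> t \<omega> = - (y t \<omega> *\<^sub>R \<theta> t)" if "t \<in> {0..T}" for t \<omega>
    unfolding \<pi> linear_neg[OF matrix_vector_mul_linear] linear_scale[OF matrix_vector_mul_linear] mpr(3)[OF that] ..
  have B\<pi>: "B t \<bullet> \<pi> t \<omega> = - (y t \<omega> * (norm (\<theta> t))\<^sup>2)" if "t \<in> {0..T}" for t \<omega>
    unfolding \<pi> inner_minus_right inner_scaleR_right mpr(4)[OF that] ..
  from wealth obtain I where x_adapted: "\<And>t. t \<in> {0..T} \<Longrightarrow> x t \<in> borel_measurable (F t)"
    and x_cont: "\<And>\<omega>. \<omega> \<in> space M \<Longrightarrow> continuous_on {0..T} (\<lambda>t. x t \<omega>)"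
    and ito: "ito_integral M F W T (\<lambda>t \<omega>. transpose (\<sigma> t) *v \<pi> t \<omega>) I"
    and x_eq: "\<And>t. t \<in> {0..T} \<Longrightarrow> AE \<omega> in M. (\<lambda>s. r s * x s \<omega> + B s \<bullet> \<pi> s \<omega>) integrable_on {0..t} \<and>
           x t \<omega> = x0 + integral {0..t} (\<lambda>s. r s * x s \<omega> + B s \<bullet> \<pi> s \<omega>) + I t \<omega>"
    unfolding wealth_solution_def by blast
  have y_cont: "continuous_on {0..T} (\<lambda>t. y t \<omega>)" if "\<omega> \<in> space M" for \<omega>
    unfolding y_def by (intro continuous_intros x_cont[OF that] \<rho>_cont)
  interpret linear_sde M F W T y0 q \<theta> y I
  proof unfold_locales
    show "0 < T" by (rule T)
    show "y t \<in> borel_measurable (F t)" if "t \<in> {0..T}" for t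
      unfolding y_def using x_adapted[OF that] by measurable
    show "ito_integral M F W T (\<lambda>t \<omega>. - (y t \<omega> *\<^sub>R \<theta> t)) I"
      by (rule ito_integral_cong[OF ito \<sigma>\<pi>])
    show "AE \<omega> in M. y t \<omega> = y0 + integral {0..t} (\<lambda>s. q s * y s \<omega>) + I t \<omega>" if t: "t \<in> {0..T}" for t
      using x_eq[OF t] AE_space
    proof eventually_elim
      case (elim \<omega>)
      have "(\<lambda>s. y s \<omega> * q s) absolutely_integrable_on {0..T}"
        by (rule absolutely_integrable_mult_continuous[OF q_abs y_cont[OF elim(2)]])
      then have "(\<lambda>s. y s \<omega> * q s) absolutely_integrable_on {0..t}"
        by (rule absolutely_integrable_on_subinterval) (use t in auto)
      then have qy: "((\<lambda>s. q s * y s \<omega>) has_integral integral {0..t} (\<lambda>s. q s * y s \<omega>)) {0..t}"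
        by (simp add: absolutely_integrable_on_def mult.commute integrable_integral)
      \<comment> \<open>Insert \<open>x = y + \<gamma> \<rho>\<close>: the part
        \<open>r \<gamma> \<rho>\<close> integrates to
        \<open>\<gamma> * (\<rho> t - \<rho> 0)\<close>, and the portfolio turns \<open>r y\<close>
        into \<open>q y\<close>.\<close>
      have "((\<lambda>s. r s * x s \<omega> + B s \<bullet> \<pi> s \<omega>) has_integral integral {0..t} (\<lambda>s. q s * y s \<omega>) + \<gamma> * (\<rho> t - \<rho> 0)) {0..t}"
        using has_integral_add[OF qy has_integral_mult_right[OF \<rho>_int[OF t], of \<gamma>]]
        by (rule has_integral_eq[rotated]) (use t in \<open>simp add: B\<pi> q_def y_def algebra_simps\<close>)
      then have "integral {0..t} (\<lambda>s. r s * x s \<omega> + B s \<bullet> \<pi> s \<omega>) = integral {0..t} (\<lambda>s. q s * y s \<omega>) + \<gamma> * (\<rho> t - \<rho> 0)"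
        by (rule integral_unique)
      then show ?case using elim(1) by (simp add: y_def y0_def algebra_simps)
    qed
  qed (use q_abs \<theta>_meas A2(1) y_cont in auto)
  have AT: "A T = \<Theta>" by (simp add: A_def \<Theta>_def)
  have \<Theta>1: "exp (- \<Theta>) < 1" using A2(2) by simp
  have int_q: "integral {0..T} (\<lambda>t. r t - norm (\<theta> t) ^ 2) = R - \<Theta>"
    unfolding R_def \<Theta>_def by (rule Henstock_Kurzweil_Integration.integral_diff[OF r_int A2(1)])
  \<comment> \<open>The definition of \<gamma> solved for the final gap: \<open>z - \<gamma>\<close>
    is the initial gap, capitalised at the riskless rate, times \<open>exp (- \<Theta>)\<close>.
    This places the target of the normalised process at \<open>exp (- \<Theta>)\<close>, so that the
    level \<Theta> coincides with the total clock \<open>A T\<close>.\<close>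
  have \<gamma>: "z - \<gamma> = exp (- \<Theta>) * (x0 * exp R - \<gamma>)"
  proof -
    have "\<gamma> = (z - x0 * (exp R * exp (- \<Theta>))) / (1 - exp (- \<Theta>))"
      unfolding \<gamma>_def int_q by (simp add: exp_diff exp_minus divide_inverse)
    then have "\<gamma> * (1 - exp (- \<Theta>)) = z - x0 * (exp R * exp (- \<Theta>))"
      using \<Theta>1 by (simp add: nonzero_eq_divide_eq)
    then show ?thesis by (simp add: algebra_simps)
  qed
  have y0R: "y0 * exp R = x0 * exp R - \<gamma>"
    by (simp add: y0_def \<rho>0 left_diff_distrib mult.assoc exp_add[symmetric])
  \<comment> \<open>The normalisation divides by \<open>y0\<close>. If it vanished, \<open>z\<close>
    would equal the riskless terminal wealth, which the assumption on \<open>z\<close>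
    excludes.\<close>
  have y0: "y0 \<noteq> 0"
  proof
    assume "y0 = 0"
    then have "z = x0 * exp R" using y0R \<gamma> by simp
    then show False using z by (simp add: R_def)
  qed
  have hit_eq: "x t \<omega> = z * exp (- integral {t..T} r) \<longleftrightarrow> V t \<omega> = exp (- \<Theta>)" if t: "t \<in> {0..T}" for t \<omega>
  proof -
    let ?r = "integral {0..t} r"
    have "integral {0..t} q = ?r - A t"
      unfolding q_def A_def using t
      by (intro Henstock_Kurzweil_Integration.integral_diff integrable_subinterval_real[OF r_int] integrable_subinterval_real[OF A2(1)]) auto
    then have "V t \<omega> = exp (- ?r) * y t \<omega> / y0"
      by (simp add: V_def u_def a_def mult_ac exp_add[symmetric])
    then have "V t \<omega> = exp (- \<Theta>) \<longleftrightarrow> exp (- ?r) * y t \<omega> = exp (- \<Theta>) * y0"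
      by (simp only: nonzero_divide_eq_eq[OF y0])
    also have "\<dots> \<longleftrightarrow> y t \<omega> = exp (- \<Theta>) * (y0 * exp ?r)"
      by (simp add: exp_minus field_simps)
    also have "exp (- \<Theta>) * (y0 * exp ?r) = (z - \<gamma>) * \<rho> t"
      unfolding \<gamma> y0R[symmetric] \<rho>[OF t] by (simp add: exp_minus)
    also have "y t \<omega> = (z - \<gamma>) * \<rho> t \<longleftrightarrow> x t \<omega> = z * \<rho> t"
      by (auto simp: y_def left_diff_distrib)
    finally show ?thesis unfolding \<rho>_def by (rule sym)
  qed
  have "\<tau> \<omega> \<le> ereal T \<longleftrightarrow> (\<exists>t\<in>{0..T}. V t \<omega> = exp (- \<Theta>))" for \<omega>
  proof
    assume "\<tau> \<omega> \<le> ereal T"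
    \<comment> \<open>The infimum of the empty set in \<open>ereal\<close> is \<infinity>, so a path
      that never meets the target is outside the event.\<close>
    moreover have "\<tau> \<omega> = \<infinity>" if "{t \<in> {0..T}. x t \<omega> = z * exp (- integral {t..T} r)} = {}"
      unfolding \<tau>_def that by (simp add: top_ereal_def)
    ultimately have "{t \<in> {0..T}. x t \<omega> = z * exp (- integral {t..T} r)} \<noteq> {}" by force
    then show "\<exists>t\<in>{0..T}. V t \<omega> = exp (- \<Theta>)" using hit_eq by blast
  next
    assume "\<exists>t\<in>{0..T}. V t \<omega> = exp (- \<Theta>)"
    then obtain t where t: "t \<in> {0..T}" "V t \<omega> = exp (- \<Theta>)" by blast
    then have "\<tau> \<omega> \<le> ereal t" unfolding \<tau>_def using hit_eq[OF t(1)] by (intro Inf_lower) auto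
    also have "\<dots> \<le> ereal T" using t(1) by simp
    finally show "\<tau> \<omega> \<le> ereal T" .
  qed
  then have "{\<omega> \<in> space M. \<tau> \<omega> \<le> ereal T} = hit \<Theta>" by (auto simp: hit_def)
  then have hit: "measure M {\<omega> \<in> space M. \<tau> \<omega> \<le> ereal T} =
      normal_tail ((\<Theta> - 3 / 2 * \<Theta>) / sqrt \<Theta>) + exp (3 * \<Theta>) * normal_tail ((\<Theta> + 3 / 2 * \<Theta>) / sqrt \<Theta>)"
    using hitting_probability[OF y0 A2(2) complete] A2(2) unfolding AT by simp
  have "\<Theta> = sqrt \<Theta> * sqrt \<Theta>" "sqrt \<Theta> \<noteq> 0" using A2(2) by simp_all
  then have arg: "(\<Theta> - 3 / 2 * \<Theta>) / sqrt \<Theta> = - sqrt \<Theta> / 2" "(\<Theta> + 3 / 2 * \<Theta>) / sqrt \<Theta> = 5 * sqrt \<Theta> / 2"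
    by (simp_all add: nonzero_divide_eq_eq)
  show ?thesis unfolding hit arg normal_tail_erfc by simp
qed

end
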